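(* Let $n\ge 1$. Let $P_{\mu_n}\subset M_{\mu_n}$ be endowed with the partial product obtained by restricting the product of $M_{\mu_n}$ (the product of $a,b\in P_{\mu_n}$ being defined exactly when $ab\in P_{\mu_n}$). Then the natural morphism $M(P_{\mu_n})\to M_{\mu_n}$ is an isomorphism of monoids.
   Context: **Braids.** $X_n$ is the space of subsets of $\mathbf{C}$ of cardinality $n$ with its natural topology, $\mu_n\in X_n$ is the set of $n$-th roots of unity. In fundamental groups, the product $\gamma\gamma'$ means $\gamma$ followed by $\gamma'$. For $x\in X_n$ let $B_x=\pi_1(X_n,x)$. A pair $\{z,z'\}\subset x$ ($z\ne z'$) is non obstructing if the closed segment $[z,z']$ meets $x$ only at $z$ and $z'$. For such a pair, $\delta_{\{z,z'\}}\in B_x$ is the class of the loop whose strings are: $\gamma_{z''}(t)=z''$ for $z''\in x\setminus\{z,z'\}$, $\gamma_z=f(z,z',\epsilon)$, $\gamma_{z'}=f(z',z,\epsilon)$, where $f(z,z',\epsilon)(t)=\frac{z+z'}2+\frac{z-z'}2\cos(\pi t)+i\epsilon\frac{z-z'}2\sin(\pi t)$, $t\in[0,1]$, and $\epsilon>0$ is small enough (depending on $x$). $M_x$ is the submonoid of $B_x$ generated by all the $\delta_{\{z,z'\}}$. **Non obstructing partitions.** A finite non-empty subset of $\mathbf{C}$ is convex if it is a single point, a pair of points, or the set of vertices (three or more) of a non-degenerate convex polygon (no three vertices collinear). A set partition $\lambda$ of $x$ is non obstructing if all its parts are convex and the convex hulls of distinct parts are disjoint. If $\nu$ is a part of a non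 obstructing partition and $z_1,\dots,z_k$ are its elements numbered in clockwise order, $\delta_\nu=\delta_{\{z_1,z_2\}}\delta_{\{z_2,z_3\}}\cdots\delta_{\{z_{k-1},z_k\}}$ (independent of the choice of $z_1$; trivial if $k=1$). For a non obstructing partition $\lambda$, $\delta_\lambda=\prod_{\nu\in\lambda}\delta_\nu$ (the factors commute). $P_x$ is the set of all $\delta_\lambda$, $\lambda$ a non obstructing partition of $x$. **Associated monoid.** For a set $P$ with a partial product with unit $1$, $M(P)$ is the monoid with set of generators $P$ and relations $ab=c$ whenever $a,b,c\in P$, $ab$ is defined in $P$ and equal to $c$ (the element $1\in P$ being the unit of $M(P)$). The natural morphism $M(P_{\mu_n})\to M_{\mu_n}$ is the one extending the inclusion $P_{\mu_n}\subset M_{\mu_n}$. *)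

theory Defs
  imports "HOL-Analysis.Analysis" "HOL-Algebra.FiniteProduct" "HOL-Library.Disjoint_Sets"
begin

section \<open>The space of subsets of the plane of cardinality n\<close>

definition quotient_topology :: "'a topology \<Rightarrow> ('a \<Rightarrow> 'b) \<Rightarrow> 'b topology" where
  "quotient_topology X f =
     topology (\<lambda>U. U \<subseteq> f ` topspace X \<and> openin X {x \<in> topspace X. f x \<in> U})"

lemma openin_quotient_topology:
  "openin (quotient_topology X f) U \<longleftrightarrow>
     U \<subseteq> f ` topspace X \<and> openin X {x \<in> topspace X. f x \<in> U}"
proof -
  have "istopology (\<lambda>U. U \<subseteq> f ` topspace X \<and> openin X {x \<in> topspace X. f x \<in> U})"
    unfolding istopology_def
  proof (intro conjI allI impI)
    fix S T
    assume "S \<subseteq> f ` topspace X \<and> openin X {x \<in> topspace X. f x \<in> S}"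
      "T \<subseteq> f ` topspace X \<and> openin X {x \<in> topspace X. f x \<in> T}"
    moreover have "{x \<in> topspace X. f x \<in> S \<inter> T} =
        {x \<in> topspace X. f x \<in> S} \<inter> {x \<in> topspace X. f x \<in> T}"
      by blast
    ultimately show "S \<inter> T \<subseteq> f ` topspace X" "openin X {x \<in> topspace X. f x \<in> S \<inter> T}"
      by (auto simp: openin_Int)
  next
    fix K
    assume *: "\<forall>S\<in>K. S \<subseteq> f ` topspace X \<and> openin X {x \<in> topspace X. f x \<in> S}"
    have "{x \<in> topspace X. f x \<in> \<Union>K} = (\<Union>S\<in>K. {x \<in> topspace X. f x \<in> S})"
      by blast
    with * show "\<Union>K \<subseteq> f ` topspace X" "openin X {x \<in> topspace X. f x \<in> \<Union>K}"
      by (auto intro: openin_clauses(3))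
  qed
  then show ?thesis
    by (simp add: quotient_topology_def topology_inverse')
qed

lemma topspace_quotient_topology: "topspace (quotient_topology X f) = f ` topspace X"
proof -
  have "{x \<in> topspace X. f x \<in> f ` topspace X} = topspace X"
    by blast
  then have "openin (quotient_topology X f) (f ` topspace X)"
    by (simp add: openin_quotient_topology)
  then have "f ` topspace X \<subseteq> topspace (quotient_topology X f)"
    by (rule openin_subset)
  moreover have "topspace (quotient_topology X f) \<subseteq> f ` topspace X"
    using openin_topspace[of "quotient_topology X f"] unfolding openin_quotient_topology by (rule conjunct1)
  ultimately show ?thesis
    by blast
qed

lemma quotient_map_quotient_topology: "quotient_map X (quotient_topology X f) f"
  by (simp add: quotient_map_def topspace_quotient_topology openin_quotient_topology)

definition ordered_configurations :: "nat \<Rightarrow> (nat \<Rightarrow> complex) topology" where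
  "ordered_configurations n =
     subtopology (product_topology (\<lambda>_. euclidean) {..<n}) {z. inj_on z {..<n}}"

definition configurations :: "nat \<Rightarrow> complex set topology" where
  "configurations n = quotient_topology (ordered_configurations n) (\<lambda>z. z ` {..<n})"

lemma topspace_configurations: "topspace (configurations n) = {x. finite x \<and> card x = n}"
proof (intro equalityI subsetI)
  fix x assume "x \<in> {x::complex set. finite x \<and> card x = n}"
  then obtain h where h: "bij_betw h {..<n} x"
    using ex_bij_betw_nat_finite[of x] by (auto simp: atLeast0LessThan)
  have "restrict h {..<n} \<in> topspace (ordered_configurations n)"
    using h by (simp add: ordered_configurations_def bij_betw_def inj_on_def)
  then have "restrict h {..<n} ` {..<n} \<in> topspace (configurations n)"
    unfolding configurations_def topspace_quotient_topology by (rule imageI)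
  then show "x \<in> topspace (configurations n)"
    using h by (simp add: bij_betw_def)
next
  fix x assume "x \<in> topspace (configurations n)"
  then obtain z where "x = z ` {..<n}" "inj_on z {..<n}"
    unfolding configurations_def topspace_quotient_topology ordered_configurations_def by auto
  then show "x \<in> {x. finite x \<and> card x = n}"
    by (simp add: card_image)
qed

section \<open>Fundamental groups\<close>

text \<open>Paths are functions on the reals of which only the values on the unit interval matter:
  homotopies are continuous on the unit square, so functions agreeing on the interval
  are homotopic.\<close>

definition loops_at :: "'a topology \<Rightarrow> 'a \<Rightarrow> (real \<Rightarrow> 'a) set" where
  "loops_at X a = {p. pathin X p \<and> p 0 = a \<and> p 1 = a}"

definition loop_homotopy :: "'a topology \<Rightarrow> 'a \<Rightarrow> ((real \<Rightarrow> 'a) \<times> (real \<Rightarrow> 'a)) set" where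
  "loop_homotopy X a =
     {(p, q). p \<in> loops_at X a \<and> q \<in> loops_at X a \<and>
        homotopic_with (\<lambda>r. r 0 = a \<and> r 1 = a) (top_of_set {0..1}) X p q}"

text \<open>The library's \<^const>\<open>joinpaths\<close> needs a topology on the whole type, whence this version.
  The path \<open>p\<close> is run through first.\<close>

definition join_loops :: "(real \<Rightarrow> 'a) \<Rightarrow> (real \<Rightarrow> 'a) \<Rightarrow> real \<Rightarrow> 'a" where
  "join_loops p q = (\<lambda>t. if t \<le> 1/2 then p (2 * t) else q (2 * t - 1))"

definition fundamental_group :: "'a topology \<Rightarrow> 'a \<Rightarrow> (real \<Rightarrow> 'a) set monoid" where
  "fundamental_group X a =
     \<lparr>carrier = loops_at X a // loop_homotopy X a,
      mult = (\<lambda>A B. \<Union>p\<in>A. \<Union>q\<in>B. loop_homotopy X a `` {join_loops p q}),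
      one = loop_homotopy X a `` {\<lambda>t. a}\<rparr>"

section \<open>Braids\<close>

type_synonym braid = "(real \<Rightarrow> complex set) set"

definition braid_group :: "complex set \<Rightarrow> braid monoid" where
  "braid_group x = fundamental_group (configurations (card x)) x"

definition non_obstructing_pair :: "complex set \<Rightarrow> complex \<Rightarrow> complex \<Rightarrow> bool" where
  "non_obstructing_pair x z z' \<longleftrightarrow>
     z \<in> x \<and> z' \<in> x \<and> z \<noteq> z' \<and> closed_segment z z' \<inter> x = {z, z'}"

definition half_turn :: "complex \<Rightarrow> complex \<Rightarrow> real \<Rightarrow> real \<Rightarrow> complex" where
  "half_turn z z' \<epsilon> t =
     (z + z') / 2 + (z - z') / 2 * of_real (cos (pi * t))
       + \<i> * of_real \<epsilon> * ((z - z') / 2) * of_real (sin (pi * t))"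

definition half_twist_loop :: "complex set \<Rightarrow> complex \<Rightarrow> complex \<Rightarrow> real \<Rightarrow> real \<Rightarrow> complex set" where
  "half_twist_loop x z z' \<epsilon> t =
     (x - {z, z'}) \<union> {half_turn z z' \<epsilon> t, half_turn z' z \<epsilon> t}"

text \<open>The class containing the above loop for all sufficiently small positive \<open>\<epsilon>\<close>.\<close>

definition half_twist :: "complex set \<Rightarrow> complex \<Rightarrow> complex \<Rightarrow> braid" where
  "half_twist x z z' =
     (THE b. b \<in> carrier (braid_group x) \<and> (\<forall>\<^sub>F \<epsilon> in at_right 0. half_twist_loop x z z' \<epsilon> \<in> b))"

inductive_set submonoid_generated :: "('a, 'b) monoid_scheme \<Rightarrow> 'a set \<Rightarrow> 'a set"
  for G and S where
  one: "\<one>\<^bsub>G\<^esub> \<in> submonoid_generated G S"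
| incl: "s \<in> S \<Longrightarrow> s \<in> submonoid_generated G S"
| mult: "a \<in> submonoid_generated G S \<Longrightarrow> b \<in> submonoid_generated G S \<Longrightarrow>
    a \<otimes>\<^bsub>G\<^esub> b \<in> submonoid_generated G S"

definition braid_monoid :: "complex set \<Rightarrow> braid monoid" where
  "braid_monoid x = braid_group x
     \<lparr>carrier := submonoid_generated (braid_group x)
        {half_twist x z z' | z z'. non_obstructing_pair x z z'}\<rparr>"

section \<open>Non obstructing partitions\<close>

definition convex_part :: "complex set \<Rightarrow> bool" where
  "convex_part v \<longleftrightarrow> card v = 1 \<or> card v = 2 \<or>
     (card v \<ge> 3 \<and> v = {z. z extreme_point_of (convex hull v)} \<and>
      (\<forall>a\<in>v. \<forall>b\<in>v. \<forall>c\<in>v. a \<noteq> b \<and> b \<noteq> c \<and> a \<noteq> c \<longrightarrow> \<not> collinear {a, b, c}))"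

definition non_obstructing_partition :: "complex set \<Rightarrow> complex set set \<Rightarrow> bool" where
  "non_obstructing_partition x L \<longleftrightarrow>
     partition_on x L \<and> (\<forall>v\<in>L. convex_part v) \<and>
     (\<forall>v\<in>L. \<forall>w\<in>L. v \<noteq> w \<longrightarrow> convex hull v \<inter> convex hull w = {})"

text \<open>For vertices \<open>z\<^sub>1, \<dots>, z\<^sub>k\<close> of a convex polygon, being numbered in clockwise order means
  that each triangle \<open>z\<^sub>i, z\<^sub>j, z\<^sub>l\<close> with \<open>i < j < l\<close> is negatively oriented. The condition
  is empty for parts with at most two elements.\<close>

definition clockwise_enumeration :: "complex set \<Rightarrow> complex list \<Rightarrow> bool" where
  "clockwise_enumeration v zs \<longleftrightarrow> distinct zs \<and> set zs = v \<and>
     (\<forall>i j l. i < j \<and> j < l \<and> l < length zs \<longrightarrow>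
        Im (cnj (zs ! j - zs ! i) * (zs ! l - zs ! i)) < 0)"

definition list_product :: "('a, 'b) monoid_scheme \<Rightarrow> 'a list \<Rightarrow> 'a" where
  "list_product G w = foldr (mult G) w \<one>\<^bsub>G\<^esub>"

text \<open>The product over consecutive pairs does not depend on which clockwise enumeration
  is chosen.\<close>

definition part_braid :: "complex set \<Rightarrow> complex set \<Rightarrow> braid" where
  "part_braid x v =
     (let zs = (SOME zs. clockwise_enumeration v zs)
      in list_product (braid_group x) (map2 (half_twist x) zs (tl zs)))"

text \<open>The ambient group is not commutative, but \<^const>\<open>finprod\<close> denotes the common value of the
  products over all orderings of the index set whenever these agree, as is the case for the
  commuting factors here.\<close>

definition partition_braid :: "complex set \<Rightarrow> complex set set \<Rightarrow> braid" where
  "partition_braid x L = finprod (braid_group x) (part_braid x) L"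

definition partition_braids :: "complex set \<Rightarrow> braid set" where
  "partition_braids x = {partition_braid x L | L. non_obstructing_partition x L}"

section \<open>The monoid associated with a partial product\<close>

definition restricted_product :: "('a, 'b) monoid_scheme \<Rightarrow> 'a set \<Rightarrow> 'a \<Rightarrow> 'a \<Rightarrow> 'a option" where
  "restricted_product G P a b = (if a \<otimes>\<^bsub>G\<^esub> b \<in> P then Some (a \<otimes>\<^bsub>G\<^esub> b) else None)"

text \<open>The congruence on words over \<open>P\<close> generated by \<open>ab = c\<close> for each defined product, and by
  identifying the unit \<open>e\<close> of \<open>P\<close> with the empty word.\<close>

inductive word_equiv :: "'a set \<Rightarrow> 'a \<Rightarrow> ('a \<Rightarrow> 'a \<Rightarrow> 'a option) \<Rightarrow> 'a list \<Rightarrow> 'a list \<Rightarrow> bool"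
  for P e m where
  product: "u \<in> lists P \<Longrightarrow> v \<in> lists P \<Longrightarrow> a \<in> P \<Longrightarrow> b \<in> P \<Longrightarrow> c \<in> P \<Longrightarrow> m a b = Some c \<Longrightarrow>
    word_equiv P e m (u @ [a, b] @ v) (u @ [c] @ v)"
| unit: "u \<in> lists P \<Longrightarrow> v \<in> lists P \<Longrightarrow> e \<in> P \<Longrightarrow> word_equiv P e m (u @ [e] @ v) (u @ v)"
| refl: "u \<in> lists P \<Longrightarrow> word_equiv P e m u u"
| sym: "word_equiv P e m u v \<Longrightarrow> word_equiv P e m v u"
| trans: "word_equiv P e m u v \<Longrightarrow> word_equiv P e m v w \<Longrightarrow> word_equiv P e m u w"

definition associated_monoid :: "'a set \<Rightarrow> 'a \<Rightarrow> ('a \<Rightarrow> 'a \<Rightarrow> 'a option) \<Rightarrow> 'a list set monoid" where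
  "associated_monoid P e m =
     \<lparr>carrier = lists P // {(u, v). word_equiv P e m u v},
      mult = (\<lambda>U V. \<Union>u\<in>U. \<Union>v\<in>V. {w. word_equiv P e m (u @ v) w}),
      one = {w. word_equiv P e m [] w}\<rparr>"

text \<open>The morphism extending the inclusion of generators: the class of a word is sent to the
  common value in \<open>G\<close> of the products of its members.\<close>

definition natural_morphism :: "('a, 'b) monoid_scheme \<Rightarrow> 'a list set \<Rightarrow> 'a" where
  "natural_morphism G W = the_elem (list_product G ` W)"

definition roots_of_unity :: "nat \<Rightarrow> complex set" where
  "roots_of_unity n = {z. z ^ n = 1}"

end

theory Submission
  imports Defs "HOL-Combinatorics.Permutations"
begin

text \<open>The set \<open>P\<close> of braids is parametrized by the noncrossing partitions of \<open>{..<n}\<close>. The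
  triangle relations between half twists show that \<open>\<delta>\<^sub>s \<delta>\<^sub>t\<close> is \<open>\<delta>\<close> of the join of
  \<open>s\<close> and \<open>t\<close> whenever \<open>t\<close> lies below the Kreweras complement of \<open>s\<close>. The monoid
  defined by these relations alone is cancellative and its top generator is quasi-central, so that
  it embeds in a group \<open>G\<close> of fractions; this is pure lattice theory. It remains to map the braid
  group back to \<open>G\<close>. For a generic direction, the elements of \<open>G\<close> attached to consecutive points
  satisfy Artin's braid relations, and by Matsumoto's theorem permutations lift to \<open>G\<close>. The lifts
  are the transition elements of a local system on the space of configurations, whose holonomy is the
  desired morphism. Hence words with the same product in the braid group have the same product in
  \<open>G\<close>, and are congruent.\<close>

section \<open>Congruence of words\<close>

text \<open>Surjectivity only asks that the half twists lie in \<open>P\<close>. The obstacle is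
  injectivity: the relations between words in the braid group have to be bounded from above,
  although no presentation of that group is at hand. A homomorphism from the braid group into a
  group that separates the congruence classes of words serves as a substitute. Its target has to be
  a group, since sections of a local system are compared by left quotients and holonomy is such a
  quotient; hence the monoid is first embedded in a group of fractions. For the homomorphism itself,
  holonomy is computed only on half twists between neighbours in a generic direction. The triangle
  relations, which hold on both sides, force the values on all other half twists by cancellation.
  The lattice products \<open>t <= K s\<close> are a priori only some of the products defined in
  \<open>P\<close>. Words with equal product turn out to be congruent by these alone, so every other
  defined product is a consequence of them, and no criterion for \<open>ab\<close> to lie in
  \<open>P\<close> has to be found.\<close>

lemma word_equiv_lists:
  assumes "word_equiv P e m u v"
  shows "u \<in> lists P" "v \<in> lists P"
  using assms by (induction) auto

lemma word_equiv_context: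
  assumes "word_equiv P e m u v" "x \<in> lists P" "y \<in> lists P"
  shows "word_equiv P e m (x @ u @ y) (x @ v @ y)"
  using assms
proof (induction)
  case (product u v a b c)
  then show ?case
    using word_equiv.product[of "x @ u" P "v @ y" a b c m e] by simp
next
  case (unit u v)
  then show ?case
    using word_equiv.unit[of "x @ u" P "v @ y" e m] by simp
next
  case (refl u)
  then show ?case by (intro word_equiv.refl) auto
next
  case (sym u v)
  then show ?case by (blast intro: word_equiv.sym)
next
  case (trans u v w)
  then show ?case by (blast intro: word_equiv.trans)
qed

lemma word_equiv_append:
  assumes "word_equiv P e m u v" "word_equiv P e m u' v'"
  shows "word_equiv P e m (u @ u') (v @ v')"
  using word_equiv_context[OF assms(1), of "[]" u'] word_equiv_context[OF assms(2), of v "[]"]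
    word_equiv_lists[OF assms(1)] word_equiv_lists[OF assms(2)]
  by (auto intro: word_equiv.trans)

lemma word_equiv_Cons:
  assumes "word_equiv P e m u v" "a \<in> P"
  shows "word_equiv P e m (a # u) (a # v)"
  using word_equiv_context[OF assms(1), of "[a]" "[]"] assms(2) by simp

text \<open>A morphism of partial products acts on congruence classes of words. It is applied to the
  twist \<open>T\<close>, to its inverse, and to \<open>nc_braid\<close>.\<close>

lemma word_equiv_map:
  assumes "word_equiv P e m u v" "f e = e'" "f ` P \<subseteq> P'"
    and "\<And>a b c. a \<in> P \<Longrightarrow> b \<in> P \<Longrightarrow> c \<in> P \<Longrightarrow> m a b = Some c \<Longrightarrow> m' (f a) (f b) = Some (f c)"
  shows "word_equiv P' e' m' (map f u) (map f v)"
  using assms(1)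
proof (induction)
  case (product u v a b c)
  have "word_equiv P' e' m' (map f u @ [f a, f b] @ map f v) (map f u @ [f c] @ map f v)"
    using product assms(3) by (intro word_equiv.product assms(4)) (auto simp: image_subset_iff)
  then show ?case by simp
next
  case (unit u v)
  have "word_equiv P' e' m' (map f u @ [e'] @ map f v) (map f u @ map f v)"
    using unit assms(2,3) by (intro word_equiv.unit) (auto simp: image_subset_iff)
  then show ?case using assms(2) by simp
next
  case (refl u)
  then show ?case using assms(3) by (intro word_equiv.refl) (auto simp: image_subset_iff)
next
  case (sym u v)
  then show ?case by (blast intro: word_equiv.sym)
next
  case (trans u v w)
  then show ?case by (blast intro: word_equiv.trans)
qed

lemma word_equiv_product_head:
  assumes "a \<in> P" "b \<in> P" "c \<in> P" "m a b = Some c" "w \<in> lists P"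
  shows "word_equiv P e m (a # b # w) (c # w)"
  using word_equiv.product[of "[]" P w a b c m e] assms by simp

declare word_equiv.trans [trans]

section \<open>Lattices with a complement operation\<close>

text \<open>The product of \<open>s\<close> and \<open>t\<close> is defined when \<open>t\<close> lies below the complement of \<open>s\<close>, and
  is then the join. Accordingly \<open>inf (K s) t\<close> is the quotient \<open>s\<inverse>t\<close> when \<open>s\<close> divides \<open>t\<close>.\<close>

locale complement_germ =
  fixes P :: "'a::semilattice_inf set" and J :: "'a \<Rightarrow> 'a \<Rightarrow> 'a" and K :: "'a \<Rightarrow> 'a" and bot top :: 'a
  assumes finite_P: "finite P"
    and bot_in [simp, intro]: "bot \<in> P" and top_in [simp, intro]: "top \<in> P"
    and bot_le: "a \<in> P \<Longrightarrow> bot \<le> a" and le_top: "a \<in> P \<Longrightarrow> a \<le> top"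
    and inf_in [simp, intro]: "a \<in> P \<Longrightarrow> b \<in> P \<Longrightarrow> inf a b \<in> P"
    and J_in [simp, intro]: "a \<in> P \<Longrightarrow> b \<in> P \<Longrightarrow> J a b \<in> P"
    and J_upper1: "a \<in> P \<Longrightarrow> b \<in> P \<Longrightarrow> a \<le> J a b"
    and J_upper2: "a \<in> P \<Longrightarrow> b \<in> P \<Longrightarrow> b \<le> J a b"
    and J_least: "a \<in> P \<Longrightarrow> b \<in> P \<Longrightarrow> c \<in> P \<Longrightarrow> a \<le> c \<Longrightarrow> b \<le> c \<Longrightarrow> J a b \<le> c"
    and K_in [simp, intro]: "a \<in> P \<Longrightarrow> K a \<in> P"
    and K_J: "a \<in> P \<Longrightarrow> b \<in> P \<Longrightarrow> K (J a b) = inf (K a) (K b)"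
    and J_quotient: "s \<in> P \<Longrightarrow> t \<in> P \<Longrightarrow> s \<le> t \<Longrightarrow> J s (inf (K s) t) = t"
    and quotient_J: "s \<in> P \<Longrightarrow> x \<in> P \<Longrightarrow> x \<le> K s \<Longrightarrow> inf (K s) (J s x) = x"
    and inj_K: "inj_on K P"
begin

lemma J_le_iff: "a \<in> P \<Longrightarrow> b \<in> P \<Longrightarrow> c \<in> P \<Longrightarrow> J a b \<le> c \<longleftrightarrow> a \<le> c \<and> b \<le> c"
  by (metis J_least J_upper1 J_upper2 order_trans)

lemma J_commute: "a \<in> P \<Longrightarrow> b \<in> P \<Longrightarrow> J a b = J b a"
  by (rule order_antisym) (simp_all add: J_le_iff J_upper1 J_upper2)

lemma J_assoc:
  assumes "a \<in> P" "b \<in> P" "c \<in> P" shows "J (J a b) c = J a (J b c)"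
proof -
  have "a \<le> J (J a b) c" "b \<le> J (J a b) c" "b \<le> J a (J b c)" "c \<le> J a (J b c)"
    using assms by (metis J_in J_upper1 J_upper2 order_trans)+
  with assms show ?thesis
    by (intro order_antisym) (simp_all add: J_le_iff J_upper1 J_upper2)
qed

lemma J_absorb: "a \<in> P \<Longrightarrow> b \<in> P \<Longrightarrow> a \<le> b \<Longrightarrow> J a b = b"
  by (rule order_antisym) (simp_all add: J_le_iff J_upper2)

lemma J_idem [simp]: "a \<in> P \<Longrightarrow> J a a = a"
  by (simp add: J_absorb)

lemma J_bot [simp]: "a \<in> P \<Longrightarrow> J bot a = a" "a \<in> P \<Longrightarrow> J a bot = a"
  by (simp_all add: J_absorb bot_le J_commute[of a bot])

text \<open>So \<open>K bot\<close> is \<open>top\<close>: the quotient of \<open>a\<close> by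
  \<open>bot\<close> is \<open>inf (K bot) a\<close>, and joining it with \<open>bot\<close> must
  give \<open>a\<close> back.\<close>

lemma le_K_bot: "a \<in> P \<Longrightarrow> a \<le> K bot"
  using J_quotient[of bot a] J_bot(1)[of "inf (K bot) a"]
  by (metis K_in bot_in bot_le inf.cobounded1 inf_in)

lemma inf_K_self [simp]: "a \<in> P \<Longrightarrow> inf (K a) a = bot"
  using quotient_J[of a bot] by (simp add: bot_le)

lemma K_antimono: "a \<in> P \<Longrightarrow> b \<in> P \<Longrightarrow> a \<le> b \<Longrightarrow> K b \<le> K a"
  by (metis J_absorb K_J inf.cobounded1)

lemma K_le_cancel: "a \<in> P \<Longrightarrow> b \<in> P \<Longrightarrow> K b \<le> K a \<Longrightarrow> a \<le> b"
proof -
  assume *: "a \<in> P" "b \<in> P" "K b \<le> K a"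
  then have "K (J a b) = K b" by (simp add: K_J inf.absorb2)
  then have "J a b = b" using * inj_K by (auto dest: inj_onD)
  then show ?thesis using J_upper1[of a b] * by simp
qed

lemma bij_K: "bij_betw K P P"
  using endo_inj_surj[OF finite_P _ inj_K] inj_K by (auto simp: bij_betw_def)

definition prd :: "'a \<Rightarrow> 'a \<Rightarrow> 'a option" where
  "prd s t = (if t \<le> K s then Some (J s t) else None)"

abbreviation weq :: "'a list \<Rightarrow> 'a list \<Rightarrow> bool" (infix "\<simeq>" 50) where
  "u \<simeq> v \<equiv> word_equiv P bot prd u v"

lemma weq_refl [simp]: "u \<in> lists P \<Longrightarrow> u \<simeq> u"
  by (rule word_equiv.refl)

subsection \<open>Left cancellation\<close>

text \<open>The word representing \<open>p\<inverse>(p \<squnion> w)\<close>, computed letter by letter; the state is the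
  corresponding quotient \<open>w\<inverse>(p \<squnion> w)\<close> by the letters read so far.\<close>

fun residue :: "'a \<Rightarrow> 'a list \<Rightarrow> 'a list" where
  "residue p [] = []"
| "residue p (b # w) = inf (K p) (J p b) # residue (inf (K b) (J p b)) w"

fun residue_state :: "'a \<Rightarrow> 'a list \<Rightarrow> 'a" where
  "residue_state p [] = p"
| "residue_state p (b # w) = residue_state (inf (K b) (J p b)) w"

lemma residue_append: "residue p (u @ v) = residue p u @ residue (residue_state p u) v"
  by (induction p u rule: residue.induct) auto

lemma residue_state_append: "residue_state p (u @ v) = residue_state (residue_state p u) v"
  by (induction p u rule: residue.induct) auto

lemma residue_in: "p \<in> P \<Longrightarrow> u \<in> lists P \<Longrightarrow> residue p u \<in> lists P"
  by (induction p u rule: residue.induct) auto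

lemma residue_state_in: "p \<in> P \<Longrightarrow> u \<in> lists P \<Longrightarrow> residue_state p u \<in> P"
  by (induction p u rule: residue.induct) auto

lemma residue_bot:
  assumes "w \<in> lists P" shows "residue bot w = w" "residue_state bot w = bot"
proof -
  have "inf (K bot) b = b" if "b \<in> P" for b
    using le_K_bot[OF that] by (simp add: inf.absorb2)
  then show "residue bot w = w" "residue_state bot w = bot"
    using assms by (induction w) auto
qed

text \<open>Two squares of least common multiples placed side by side form one. The sides
  \<open>y\<close> and \<open>z1\<close> complete the square on \<open>p\<close> and
  \<open>b\<close>; \<open>z2\<close> and the next state complete that on \<open>y\<close> and
  \<open>c\<close>. The outer rectangle is the square on \<open>p\<close> and the product of
  \<open>b\<close> and \<open>c\<close>, and its far side \<open>z1\<close>, \<open>z2\<close> is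
  again a defined product.\<close>

lemma residue_product:
  assumes in_P: "p \<in> P" "b \<in> P" "c \<in> P" and c: "c \<le> K b"
  defines "y \<equiv> inf (K b) (J p b)"
  defines "z1 \<equiv> inf (K p) (J p b)" and "z2 \<equiv> inf (K y) (J y c)"
  shows "z2 \<le> K z1" "J z1 z2 = inf (K p) (J p (J b c))"
    and "inf (K c) (J y c) = inf (K (J b c)) (J p (J b c))"
proof -
  have yP: "y \<in> P" and zP: "z1 \<in> P" "z2 \<in> P"
    using in_P by (auto simp: y_def z1_def z2_def)
  have b_y: "J b y = J p b"
    unfolding y_def using in_P by (intro J_quotient) (auto intro: J_upper2)
  have pz: "J p z1 = J p b"
    unfolding z1_def using in_P by (intro J_quotient) (auto intro: J_upper1)
  have yz: "J y z2 = J y c"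
    unfolding z2_def using in_P yP by (intro J_quotient) (auto intro: J_upper1)
  have yK: "y \<le> K b" by (simp add: y_def)
  have ycK: "J y c \<le> K b" using yK c in_P yP by (simp add: J_le_iff)
  have byc: "J b (J y c) = J p (J b c)"
    using b_y in_P yP by (simp flip: J_assoc)
  \<comment> \<open>Lying below \<open>K b\<close>, the element \<open>J y c\<close> is the quotient
    of \<open>J b (J y c)\<close> by \<open>b\<close>.\<close>
  have yc: "J y c = inf (K b) (J p (J b c))"
    using quotient_J[OF _ _ ycK] in_P yP byc by simp
  show "inf (K c) (J y c) = inf (K (J b c)) (J p (J b c))"
    using in_P by (simp add: yc K_J inf.assoc inf.commute inf.left_commute)
  have "z2 \<le> K y" by (simp add: z2_def)
  moreover have "z2 \<le> K b"
    using J_upper2[of y z2] yP zP ycK yz by (simp add: order_trans)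
  \<comment> \<open>\<open>J b y\<close>, \<open>J p b\<close> and \<open>J p z1\<close> are one
    element, so lying below its complement means lying below both \<open>K p\<close> and
    \<open>K z1\<close>.\<close>
  ultimately have "z2 \<le> K (J b y)" using in_P yP by (simp add: K_J)
  then have z2: "z2 \<le> K p" "z2 \<le> K z1"
    using in_P zP by (simp_all add: b_y pz[symmetric] K_J)
  then show "z2 \<le> K z1" by simp
  have "J z1 z2 \<le> K p" using z2 zP in_P by (simp add: J_le_iff z1_def)
  then have "J z1 z2 = inf (K p) (J p (J z1 z2))"
    using quotient_J zP in_P by simp
  also have "J p (J z1 z2) = J (J p z1) z2" using zP in_P by (simp add: J_assoc)
  also have "\<dots> = J b (J y z2)" using zP in_P yP by (simp add: pz b_y[symmetric] J_assoc)
  also have "\<dots> = J p (J b c)" by (simp add: yz byc)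
  finally show "J z1 z2 = inf (K p) (J p (J b c))" .
qed

text \<open>Division by \<open>p\<close> is thus defined on congruence classes. In a context
  \<open>u\<close> the only effect of the letters already read is to replace \<open>p\<close> by
  another state, to which \<open>residue_product\<close> applies.\<close>

lemma residue_weq:
  assumes "u \<simeq> v" "p \<in> P"
  shows "residue p u \<simeq> residue p v \<and> residue_state p u = residue_state p v"
  using assms
proof (induction arbitrary: p)
  case (product u v a b c)
  define q where "q = residue_state p u"
  have q: "q \<in> P" using product by (simp add: q_def residue_state_in)
  have c: "c = J a b" "b \<le> K a" using product by (auto simp: prd_def split: if_splits)
  let ?y = "inf (K a) (J q a)"
  note r = residue_product[OF q \<open>a \<in> P\<close> \<open>b \<in> P\<close> c(2)]
  define r1 where "r1 = inf (K q) (J q a)"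
  define r2 where "r2 = inf (K ?y) (J ?y b)"
  define q' where "q' = inf (K c) (J q c)"
  have 1: "residue q [a, b] = [r1, r2]" "residue_state q [a, b] = q'"
    using r(3) by (simp_all add: r1_def r2_def q'_def c(1))
  have 2: "residue q [c] = [J r1 r2]" "residue_state q [c] = q'"
    using r(2) by (simp_all add: r1_def r2_def q'_def c(1))
  have "r1 \<in> P" "r2 \<in> P" "q' \<in> P"
    using q product by (auto simp: r1_def r2_def q'_def)
  moreover have "prd r1 r2 = Some (J r1 r2)"
    using r(1) by (simp add: prd_def r1_def r2_def)
  ultimately have "residue p u @ [r1, r2] @ residue q' v \<simeq> residue p u @ [J r1 r2] @ residue q' v"
    using product by (intro word_equiv.product residue_in) simp_all
  then show ?case
    by (simp only: residue_append residue_state_append q_def[symmetric] 1 2 simp_thms)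
next
  case (unit u v)
  define q where "q = residue_state p u"
  have q: "q \<in> P" using unit by (simp add: q_def residue_state_in)
  have 1: "residue q [bot] = [bot]" "residue_state q [bot] = q"
    using q le_K_bot[OF q] by (simp_all add: inf.absorb2)
  have "residue p u @ [bot] @ residue q v \<simeq> residue p u @ residue q v"
    using unit q by (intro word_equiv.unit residue_in) simp_all
  then show ?case
    by (simp only: residue_append residue_state_append q_def[symmetric] 1 simp_thms)
next
  case (refl u)
  then show ?case using word_equiv.refl[OF residue_in[of p u]] by simp
next
  case (sym u v)
  then show ?case by (metis word_equiv.sym)
next
  case (trans u v w)
  then show ?case by (metis word_equiv.trans)
qed

lemma weq_bot_Cons: "w \<in> lists P \<Longrightarrow> bot # w \<simeq> w"
  using word_equiv.unit[of "[]" P w bot prd] by simp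

text \<open>\<open>residue a\<close> undoes the prefixing of \<open>a\<close> up to a leading
  \<open>bot\<close>: once \<open>a\<close> has been read the state is \<open>bot\<close>, and from
  then on letters are copied.\<close>

lemma weq_cancel_left:
  assumes "a # u \<simeq> a # v" shows "u \<simeq> v"
proof -
  have P: "a \<in> P" "u \<in> lists P" "v \<in> lists P" using word_equiv_lists[OF assms] by auto
  have "residue a (a # w) = bot # w" if "w \<in> lists P" for w
    using P that by (simp add: residue_bot)
  then have "bot # u \<simeq> bot # v" using residue_weq[OF assms \<open>a \<in> P\<close>] P by simp
  then show ?thesis
    using P weq_bot_Cons word_equiv.sym word_equiv.trans by metis
qed

subsection \<open>The quasi-central element\<close>

abbreviation T :: "'a \<Rightarrow> 'a" where "T a \<equiv> K (K a)"

lemma T_le_iff: "a \<in> P \<Longrightarrow> b \<in> P \<Longrightarrow> T a \<le> T b \<longleftrightarrow> a \<le> b"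
  by (meson K_antimono K_in K_le_cancel)

lemma bij_T: "bij_betw T P P"
  using bij_betw_trans[OF bij_K bij_K] by (simp add: comp_def)

lemma T_surj: assumes "a \<in> P" obtains c where "c \<in> P" "a = T c"
  using bij_betw_imp_surj_on[OF bij_T] assms by blast

lemma T_J: assumes "a \<in> P" "b \<in> P" shows "T (J a b) = J (T a) (T b)"
proof (rule antisym)
  obtain c where c: "c \<in> P" "J (T a) (T b) = T c"
    using T_surj[of "J (T a) (T b)"] assms by auto
  have "a \<le> c" "b \<le> c"
    using J_upper1[of "T a" "T b"] J_upper2[of "T a" "T b"] assms c by (simp_all add: T_le_iff)
  then show "T (J a b) \<le> J (T a) (T b)"
    using c assms by (simp add: T_le_iff J_le_iff)
qed (use assms in \<open>simp add: J_le_iff T_le_iff J_upper1 J_upper2\<close>)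

lemma T_bot: "T bot = bot"
proof -
  obtain c where "c \<in> P" "bot = T c" using T_surj[of bot] by auto
  then show ?thesis
    using T_le_iff[of bot c] bot_le[of c] bot_le[of "T bot"] by (simp add: order_antisym)
qed

lemma T_top: "T top = top"
proof -
  obtain c where "c \<in> P" "top = T c" using T_surj[of top] by auto
  then show ?thesis
    using T_le_iff[of c top] le_top[of c] le_top[of "T top"] by (simp add: order_antisym)
qed

text \<open>\<open>T\<close> is an order automorphism, hence preserves joins, and it commutes with
  \<open>K\<close> because it is the square of \<open>K\<close>. So it is an automorphism of the
  partial product.\<close>

lemma prd_T: "a \<in> P \<Longrightarrow> b \<in> P \<Longrightarrow> prd (T a) (T b) = map_option T (prd a b)"
  using T_le_iff[of b "K a"] by (simp add: prd_def T_J)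

lemma weq_T: "u \<simeq> v \<Longrightarrow> map T u \<simeq> map T v"
  by (erule word_equiv_map) (auto simp: T_bot prd_T)

lemma weq_T_cancel:
  assumes "map T u \<simeq> map T v" "u \<in> lists P" "v \<in> lists P" shows "u \<simeq> v"
proof -
  define S where "S = inv_into P T"
  have ST: "S (T a) = a" if "a \<in> P" for a
    unfolding S_def by (rule inv_into_f_f[OF bij_betw_imp_inj_on[OF bij_T] that])
  have TS: "\<exists>a'\<in>P. a = T a'" if "a \<in> P" for a
    using T_surj[OF that] by blast
  have "map S (map T u) \<simeq> map S (map T v)"
    using assms(1)
  proof (rule word_equiv_map)
    show "S bot = bot" using ST[of bot] by (simp add: T_bot)
    show "S ` P \<subseteq> P" using TS ST by force
    fix a b c assume *: "a \<in> P" "b \<in> P" "c \<in> P" "prd a b = Some c"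
    obtain a' b' where ab: "a' \<in> P" "b' \<in> P" "a = T a'" "b = T b'"
      using TS[OF *(1)] TS[OF *(2)] by auto
    have "map_option T (prd a' b') = Some c" using *(4) prd_T[OF ab(1,2)] ab(3,4) by simp
    then obtain c' where "prd a' b' = Some c'" "c = T c'" by auto
    moreover have "c' \<in> P" using \<open>prd a' b' = Some c'\<close> ab by (auto simp: prd_def split: if_splits)
    ultimately show "prd (S a) (S b) = Some (S c)" using ab ST by simp
  qed
  moreover have "map S (map T w) = w" if "w \<in> lists P" for w
    using that ST by (auto simp: in_lists_conv_set intro: map_idI)
  ultimately show ?thesis using assms by simp
qed

lemma weq_complement: "a \<in> P \<Longrightarrow> w \<in> lists P \<Longrightarrow> a # K a # w \<simeq> top # w"
  using J_quotient[of a top] le_top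
  by (intro word_equiv_product_head) (auto simp: prd_def inf.absorb1)

text \<open>Both sides are congruent to \<open>a\<close>, \<open>K a\<close>, \<open>T a\<close>,
  since \<open>top\<close> is the product of any element with its complement. Conjugation by
  \<open>top\<close> is therefore \<open>T\<close>.\<close>

lemma weq_top_swap1: assumes "a \<in> P" "w \<in> lists P" shows "a # top # w \<simeq> top # T a # w"
proof -
  have "a # top # w \<simeq> a # K a # T a # w"
    using assms by (intro word_equiv_Cons word_equiv.sym[OF weq_complement]) auto
  also have "\<dots> \<simeq> top # T a # w"
    using assms by (intro weq_complement) auto
  finally show ?thesis .
qed

lemma weq_top_swap: "u \<in> lists P \<Longrightarrow> u @ [top] \<simeq> top # map T u"
proof (induction u)
  case (Cons a u)
  then have "a # u @ [top] \<simeq> a # top # map T u" by (intro word_equiv_Cons) auto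
  also have "\<dots> \<simeq> top # T a # map T u"
    using Cons by (intro weq_top_swap1) auto
  finally show ?case by simp
qed auto

lemma T_pow_in: "a \<in> P \<Longrightarrow> (T ^^ k) a \<in> P"
  by (induction k) auto

lemma map_T_pow_lists: "u \<in> lists P \<Longrightarrow> map (T ^^ k) u \<in> lists P"
  using T_pow_in by auto

lemma replicate_top_lists [simp]: "replicate k top \<in> lists P"
  by (auto simp: in_lists_conv_set)

lemma map_T_pow_Suc: "map (T ^^ k) (map T u) = map (T ^^ Suc k) u"
  by (simp add: funpow_Suc_right del: funpow.simps)

lemma weq_top_pow_swap:
  "u \<in> lists P \<Longrightarrow> u @ replicate k top \<simeq> replicate k top @ map (T ^^ k) u"
proof (induction k arbitrary: u)
  case (Suc k)
  have "(u @ [top]) @ replicate k top \<simeq> (top # map T u) @ replicate k top"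
    using Suc.prems by (intro word_equiv_append weq_top_swap weq_refl) auto
  also have "(top # map T u) @ replicate k top = top # map T u @ replicate k top"
    by simp
  also have "top # map T u @ replicate k top \<simeq> top # replicate k top @ map (T ^^ k) (map T u)"
    using Suc.prems by (intro word_equiv_Cons Suc.IH) auto
  finally show ?case by (simp only: map_T_pow_Suc) (simp add: comp_def)
qed (auto simp: id_def)

lemma weq_T_pow: "u \<simeq> v \<Longrightarrow> map (T ^^ k) u \<simeq> map (T ^^ k) v"
proof (induction k arbitrary: u v)
  case (Suc k)
  show ?case using Suc.IH[OF weq_T[OF Suc.prems]] by (simp only: map_T_pow_Suc)
qed (simp add: id_def)

text \<open>Right cancellation of \<open>top\<close> is reduced to left cancellation:
  \<open>top\<close> is moved to the front at the price of \<open>T\<close>, which is injective on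
  classes.\<close>

lemma weq_cancel_right_top:
  assumes "u @ replicate k top \<simeq> v @ replicate k top" "u \<in> lists P" "v \<in> lists P"
  shows "u \<simeq> v"
  using assms
proof (induction k arbitrary: u v)
  case (Suc k)
  have "(u @ [top]) @ replicate k top \<simeq> (v @ [top]) @ replicate k top"
    using Suc.prems(1) by (simp add: replicate_app_Cons_same)
  then have "u @ [top] \<simeq> v @ [top]" by (rule Suc.IH) (use Suc.prems(2,3) in auto)
  then have "top # map T u \<simeq> top # map T v"
    using weq_top_swap[OF Suc.prems(2)] weq_top_swap[OF Suc.prems(3)]
    by (metis word_equiv.sym word_equiv.trans)
  then show ?case by (rule weq_T_cancel[OF weq_cancel_left]) (use Suc.prems in auto)
qed auto

subsection \<open>The group of fractions\<close>

text \<open>The pair \<open>(w, k)\<close> stands for the fraction \<open>w top\<^sup>-\<^sup>k\<close>.\<close>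

definition frac_rel :: "(('a list \<times> nat) \<times> ('a list \<times> nat)) set" where
  "frac_rel = {((w, k), (v, l)). w \<in> lists P \<and> v \<in> lists P \<and>
     w @ replicate l top \<simeq> v @ replicate k top}"

text \<open>Since \<open>v top^k\<close> is congruent to \<open>top^k T^k(v)\<close>, moving
  \<open>top^-k\<close> to the right past \<open>v\<close> applies \<open>T^k\<close> to
  \<open>v\<close>.\<close>

definition frac_mult :: "'a list \<times> nat \<Rightarrow> 'a list \<times> nat \<Rightarrow> 'a list \<times> nat" where
  "frac_mult x y = (fst x @ map (T ^^ snd x) (fst y), snd x + snd y)"

abbreviation frac_dom :: "('a list \<times> nat) set" where
  "frac_dom \<equiv> lists P \<times> UNIV"

lemma equiv_frac_rel: "equiv frac_dom frac_rel"
proof (rule equivI)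
  show "frac_rel \<subseteq> frac_dom \<times> frac_dom" "refl_on frac_dom frac_rel" "sym frac_rel"
    by (auto simp: refl_on_def sym_def frac_rel_def intro: word_equiv.sym word_equiv.refl)
  show "trans frac_rel"
  proof (rule transI)
    fix x y z assume rel: "(x, y) \<in> frac_rel" "(y, z) \<in> frac_rel"
    obtain w k v l u m where eq: "x = (w, k)" "y = (v, l)" "z = (u, m)"
      by (meson surj_pair)
    have P: "w \<in> lists P" "v \<in> lists P" "u \<in> lists P"
      and 1: "w @ replicate l top \<simeq> v @ replicate k top"
      and 2: "v @ replicate m top \<simeq> u @ replicate l top"
      using rel by (simp_all add: eq frac_rel_def)
    \<comment> \<open>The two outer fractions can only be compared after a further multiplication by
      \<open>top^l\<close>, the middle denominator, which is cancelled at the end.\<close>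
    have "(w @ replicate m top) @ replicate l top = (w @ replicate l top) @ replicate m top"
      by (simp add: add.commute flip: replicate_add)
    also have "\<dots> \<simeq> (v @ replicate k top) @ replicate m top"
      by (intro word_equiv_append 1) auto
    also have "\<dots> = (v @ replicate m top) @ replicate k top"
      by (simp add: add.commute flip: replicate_add)
    also have "\<dots> \<simeq> (u @ replicate l top) @ replicate k top"
      by (intro word_equiv_append 2) auto
    also have "\<dots> = (u @ replicate k top) @ replicate l top"
      by (simp add: add.commute flip: replicate_add)
    finally have "w @ replicate m top \<simeq> u @ replicate k top"
      by (rule weq_cancel_right_top) (use P in simp_all)
    then show "(x, z) \<in> frac_rel" using P by (simp add: frac_rel_def eq)
  qed
qed

lemma T_pow_top: "(T ^^ k) top = top"
  by (induction k) (simp_all add: T_top)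

lemma frac_mult_in: "x \<in> frac_dom \<Longrightarrow> y \<in> frac_dom \<Longrightarrow> frac_mult x y \<in> frac_dom"
  using T_pow_in by (auto simp: frac_mult_def)

lemma frac_mult_assoc: "frac_mult (frac_mult x y) z = frac_mult x (frac_mult y z)"
  by (simp add: frac_mult_def funpow_add)

lemma frac_mult_cong:
  assumes "(x, x') \<in> frac_rel" "(y, y') \<in> frac_rel"
  shows "(frac_mult x y, frac_mult x' y') \<in> frac_rel"
proof -
  obtain w k v l where x: "x = (w, k)" "x' = (v, l)"
    by (meson surj_pair)
  have wv: "w \<in> lists P" "v \<in> lists P" "w @ replicate l top \<simeq> v @ replicate k top"
    using assms(1) by (simp_all add: x frac_rel_def)
  obtain u m z j where y: "y = (u, m)" "y' = (z, j)"
    by (meson surj_pair)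
  have uz: "u \<in> lists P" "z \<in> lists P" "u @ replicate j top \<simeq> z @ replicate m top"
    using assms(2) by (simp_all add: y frac_rel_def)
  \<comment> \<open>\<open>push\<close> brings the extra power of \<open>top\<close> next to the
    first factor, where the relation between \<open>x\<close> and \<open>x'\<close> applies. The
    second factor then carries the same power \<open>T^(l + k)\<close> on both sides.\<close>
  have push: "a @ map (T ^^ i) b @ replicate i' top \<simeq> (a @ replicate i' top) @ map (T ^^ (i' + i)) b"
    if "a \<in> lists P" "b \<in> lists P" for a b i i'
    using word_equiv_append[OF weq_refl[OF that(1)] weq_top_pow_swap[OF map_T_pow_lists[OF that(2), of i], of i']]
    by (simp add: funpow_add)
  have "(w @ map (T ^^ k) u) @ replicate (l + j) top
      = (w @ map (T ^^ k) u @ replicate l top) @ replicate j top"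
    by (simp add: replicate_add)
  also have "\<dots> \<simeq> ((w @ replicate l top) @ map (T ^^ (l + k)) u) @ replicate j top"
    by (intro word_equiv_append push wv uz) auto
  also have "\<dots> = (w @ replicate l top) @ map (T ^^ (l + k)) (u @ replicate j top)"
    by (simp add: T_pow_top)
  also have "\<dots> \<simeq> (v @ replicate k top) @ map (T ^^ (l + k)) (z @ replicate m top)"
    by (intro word_equiv_append wv weq_T_pow uz)
  also have "\<dots> = ((v @ replicate k top) @ map (T ^^ (k + l)) z) @ replicate m top"
    by (simp add: T_pow_top add.commute)
  also have "\<dots> \<simeq> (v @ map (T ^^ l) z @ replicate k top) @ replicate m top"
    by (intro word_equiv_append word_equiv.sym[OF push] wv uz) auto
  also have "\<dots> = (v @ map (T ^^ l) z) @ replicate (k + m) top"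
    by (simp add: replicate_add)
  finally show ?thesis
    using wv uz map_T_pow_lists by (simp add: x y frac_mult_def frac_rel_def)
qed

definition frac_group :: "('a list \<times> nat) set monoid" where
  "frac_group = \<lparr>carrier = frac_dom // frac_rel,
     mult = (\<lambda>A B. \<Union>x\<in>A. \<Union>y\<in>B. frac_rel `` {frac_mult x y}),
     one = frac_rel `` {([], 0)}\<rparr>"

abbreviation cl :: "'a list \<times> nat \<Rightarrow> ('a list \<times> nat) set" where
  "cl x \<equiv> frac_rel `` {x}"

lemma cl_eq_iff: "x \<in> frac_dom \<Longrightarrow> y \<in> frac_dom \<Longrightarrow> cl x = cl y \<longleftrightarrow> (x, y) \<in> frac_rel"
  using eq_equiv_class_iff[OF equiv_frac_rel] by blast

lemma frac_group_mult:
  assumes "x \<in> frac_dom" "y \<in> frac_dom"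
  shows "cl x \<otimes>\<^bsub>frac_group\<^esub> cl y = cl (frac_mult x y)"
proof -
  have "congruent2 frac_rel frac_rel (\<lambda>x y. cl (frac_mult x y))"
    by (intro congruent2I' equiv_class_eq[OF equiv_frac_rel] frac_mult_cong)
  then show ?thesis
    using UN_equiv_class2[OF equiv_frac_rel equiv_frac_rel _ assms] by (simp add: frac_group_def)
qed

lemma cl_in: "x \<in> frac_dom \<Longrightarrow> cl x \<in> carrier frac_group"
  unfolding frac_group_def by (simp add: quotientI)

lemma frac_group_elem:
  assumes "A \<in> carrier frac_group" obtains x where "x \<in> frac_dom" "A = cl x"
  using assms unfolding frac_group_def by (auto elim!: quotientE)

text \<open>\<open>K a\<close> over \<open>top\<close> is a left inverse of \<open>a\<close>: moving
  \<open>top^-1\<close> past \<open>a\<close> turns \<open>a\<close> into \<open>T a\<close>, which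
  is the complement of \<open>K a\<close>. For the empty word the inverse of \<open>top^-k\<close>
  is \<open>top^k\<close>.\<close>

lemma frac_mult_left_inverse: "w \<in> lists P \<Longrightarrow> \<exists>y\<in>frac_dom. (frac_mult y (w, k), ([], 0)) \<in> frac_rel"
proof (induction w)
  case Nil
  have "(frac_mult (replicate k top, 0) ([], k), ([], 0)) \<in> frac_rel"
    by (auto simp: frac_mult_def frac_rel_def intro!: word_equiv.refl)
  then show ?case by (intro bexI) auto
next
  case (Cons a w)
  then obtain y where y: "y \<in> frac_dom" "(frac_mult y (w, k), ([], 0)) \<in> frac_rel" by auto
  have "(([K a, T a], 1), ([], 0)) \<in> frac_rel"
    using Cons.prems weq_complement[of "K a" "[]"] by (auto simp: frac_rel_def)
  then have "(frac_mult ([K a, T a], 1) (w, k), frac_mult ([], 0) (w, k)) \<in> frac_rel"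
    using Cons.prems by (intro frac_mult_cong) (auto simp: frac_rel_def intro!: word_equiv.refl)
  moreover have "frac_mult ([K a, T a], 1) (w, k) = frac_mult ([K a], 1) (a # w, k)"
    "frac_mult ([], 0) (w, k) = (w, k)"
    by (auto simp: frac_mult_def)
  ultimately have "(frac_mult y (frac_mult ([K a], 1) (a # w, k)), frac_mult y (w, k)) \<in> frac_rel"
    using y(1) eq_equiv_class_iff[OF equiv_frac_rel] equiv_class_self[OF equiv_frac_rel]
    by (intro frac_mult_cong) auto
  then have "(frac_mult (frac_mult y ([K a], 1)) (a # w, k), ([], 0)) \<in> frac_rel"
    using y(2) equiv_frac_rel unfolding frac_mult_assoc by (meson equivE transD)
  moreover have "frac_mult y ([K a], 1) \<in> frac_dom"
    using y(1) Cons.prems by (intro frac_mult_in) auto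
  ultimately show ?case by (rule bexI)
qed

lemma group_frac_group: "group frac_group"
proof (rule groupI)
  show one: "\<one>\<^bsub>frac_group\<^esub> \<in> carrier frac_group"
    unfolding frac_group_def by (simp add: quotientI)
  have one_cl: "\<one>\<^bsub>frac_group\<^esub> = cl ([], 0)" by (simp add: frac_group_def)
  fix x assume "x \<in> carrier frac_group"
  then obtain a where a: "a \<in> frac_dom" "x = cl a" by (rule frac_group_elem)
  obtain w k where wk: "a = (w, k)" "w \<in> lists P" using a(1) by auto
  show "\<one>\<^bsub>frac_group\<^esub> \<otimes>\<^bsub>frac_group\<^esub> x = x"
    using a by (simp add: one_cl frac_group_mult) (simp add: frac_mult_def)
  obtain y where y: "y \<in> frac_dom" "(frac_mult y (w, k), ([], 0)) \<in> frac_rel"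
    using frac_mult_left_inverse[OF wk(2)] by blast
  then have "cl y \<otimes>\<^bsub>frac_group\<^esub> x = \<one>\<^bsub>frac_group\<^esub>"
    using equiv_class_eq[OF equiv_frac_rel y(2)] a wk by (simp only: one_cl frac_group_mult)
  then show "\<exists>y\<in>carrier frac_group. y \<otimes>\<^bsub>frac_group\<^esub> x = \<one>\<^bsub>frac_group\<^esub>"
    using cl_in[OF y(1)] by blast
  fix y assume "y \<in> carrier frac_group"
  then obtain b where b: "b \<in> frac_dom" "y = cl b" by (rule frac_group_elem)
  show "x \<otimes>\<^bsub>frac_group\<^esub> y \<in> carrier frac_group"
    using frac_mult_in[OF a(1) b(1)] by (simp only: a b frac_group_mult cl_in)
  fix z assume "z \<in> carrier frac_group"
  then obtain c where c: "c \<in> frac_dom" "z = cl c" by (rule frac_group_elem)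
  show "x \<otimes>\<^bsub>frac_group\<^esub> y \<otimes>\<^bsub>frac_group\<^esub> z = x \<otimes>\<^bsub>frac_group\<^esub> (y \<otimes>\<^bsub>frac_group\<^esub> z)"
    using a(1) b(1) c(1) frac_mult_in
    by (simp only: a(2) b(2) c(2) frac_group_mult frac_mult_in frac_mult_assoc)
qed

lemma list_product_frac_group:
  "w \<in> lists P \<Longrightarrow> list_product frac_group (map (\<lambda>s. cl ([s], 0)) w) = cl (w, 0)"
proof (induction w)
  case (Cons a w)
  then have "list_product frac_group (map (\<lambda>s. cl ([s], 0)) (a # w)) = cl ([a], 0) \<otimes>\<^bsub>frac_group\<^esub> cl (w, 0)"
    by (simp add: list_product_def)
  also have "\<dots> = cl (a # w, 0)"
    using Cons.prems by (subst frac_group_mult) (auto simp: frac_mult_def)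
  finally show ?case .
qed (simp add: list_product_def frac_group_def)

text \<open>Between fractions with denominator \<open>top^0\<close> the relation
  \<open>frac_rel\<close> is the congruence itself, so words are separated up to congruence.\<close>

theorem embeds_in_group:
  obtains G :: "('a list \<times> nat) set monoid" and \<iota> where "group G" "\<iota> \<in> P \<rightarrow> carrier G"
    "\<And>s t. s \<in> P \<Longrightarrow> t \<in> P \<Longrightarrow> t \<le> K s \<Longrightarrow> \<iota> s \<otimes>\<^bsub>G\<^esub> \<iota> t = \<iota> (J s t)"
    "\<And>u v. u \<in> lists P \<Longrightarrow> v \<in> lists P \<Longrightarrow>
       list_product G (map \<iota> u) = list_product G (map \<iota> v) \<Longrightarrow> u \<simeq> v"
proof
  let ?i = "\<lambda>s. cl ([s], 0)"
  show "group frac_group" by (rule group_frac_group)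
  show "?i \<in> P \<rightarrow> carrier frac_group" using cl_in by auto
  show "?i s \<otimes>\<^bsub>frac_group\<^esub> ?i t = ?i (J s t)" if "s \<in> P" "t \<in> P" "t \<le> K s" for s t
  proof -
    have "([s, t], 0) \<in> frac_dom" "([J s t], 0) \<in> frac_dom" using that by auto
    moreover have "(([s, t], 0), ([J s t], 0)) \<in> frac_rel"
      using that word_equiv_product_head[of s P t "J s t" prd "[]" bot]
      by (auto simp: frac_rel_def prd_def)
    ultimately have "cl ([s, t], 0) = cl ([J s t], 0)" by (simp only: cl_eq_iff)
    then show ?thesis using that by (subst frac_group_mult) (auto simp: frac_mult_def)
  qed
  show "u \<simeq> v" if "u \<in> lists P" "v \<in> lists P"
    "list_product frac_group (map ?i u) = list_product frac_group (map ?i v)" for u v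
  proof -
    have "cl (u, 0) = cl (v, 0)" using that by (simp only: list_product_frac_group)
    then have "((u, 0), (v, 0)) \<in> frac_rel" using that by (subst (asm) cl_eq_iff) auto
    then show ?thesis by (simp add: frac_rel_def)
  qed
qed

end

section \<open>Noncrossing equivalence relations\<close>

text \<open>Partitions are kept as equivalence relations: refinement is then inclusion and the meet
  is intersection, as \<open>complement_germ\<close> expects of the order and of
  \<open>inf\<close>.\<close>

definition noncrossing :: "nat \<Rightarrow> nat rel set" where
  "noncrossing n = {r. equiv {..<n} r \<and>
     (\<forall>a b c d. a < b \<and> b < c \<and> c < d \<and> (a, c) \<in> r \<and> (b, d) \<in> r \<longrightarrow> (a, b) \<in> r)}"

definition saturated :: "nat rel \<Rightarrow> nat set \<Rightarrow> bool" where
  "saturated r A \<longleftrightarrow> (\<forall>a b. (a, b) \<in> r \<longrightarrow> (a \<in> A \<longleftrightarrow> b \<in> A))"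

text \<open>The complement lives on points inserted after each \<open>i\<close>; two of them are related when the
  chord joining them separates no block of \<open>r\<close>.\<close>

definition kreweras :: "nat \<Rightarrow> nat rel \<Rightarrow> nat rel" where
  "kreweras n r = {(i, j). i < n \<and> j < n \<and>
     (\<forall>a b. (a, b) \<in> r \<longrightarrow> ((a \<le> i \<longleftrightarrow> a \<le> j) \<longleftrightarrow> (b \<le> i \<longleftrightarrow> b \<le> j)))}"

text \<open>The union of two such relations is in general neither transitive nor noncrossing after
  transitive closure, so the join is taken as the intersection of all upper bounds.\<close>

definition nc_join :: "nat \<Rightarrow> nat rel \<Rightarrow> nat rel \<Rightarrow> nat rel" where
  "nc_join n s t = \<Inter> {r \<in> noncrossing n. s \<subseteq> r \<and> t \<subseteq> r}"

lemma noncrossingD: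
  assumes "r \<in> noncrossing n"
  shows "a < n \<Longrightarrow> (a, a) \<in> r" "(a, b) \<in> r \<Longrightarrow> (b, a) \<in> r"
    "(a, b) \<in> r \<Longrightarrow> (b, c) \<in> r \<Longrightarrow> (a, c) \<in> r" "(a, b) \<in> r \<Longrightarrow> a < n \<and> b < n"
    "(a, c) \<in> r \<Longrightarrow> (b, d) \<in> r \<Longrightarrow> a < b \<Longrightarrow> b < c \<Longrightarrow> c < d \<Longrightarrow> (a, b) \<in> r"
proof -
  have e: "equiv {..<n} r" using assms by (simp add: noncrossing_def)
  show "a < n \<Longrightarrow> (a, a) \<in> r" using e by (auto simp: equiv_def refl_on_def)
  show "(a, b) \<in> r \<Longrightarrow> (b, a) \<in> r" using e by (auto simp: equiv_def sym_def)
  show "(a, b) \<in> r \<Longrightarrow> (b, c) \<in> r \<Longrightarrow> (a, c) \<in> r" using e unfolding equiv_def trans_def by blast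
  show "(a, b) \<in> r \<Longrightarrow> a < n \<and> b < n" using equiv_type[OF e] by auto
  show "(a, c) \<in> r \<Longrightarrow> (b, d) \<in> r \<Longrightarrow> a < b \<Longrightarrow> b < c \<Longrightarrow> c < d \<Longrightarrow> (a, b) \<in> r"
    using assms unfolding noncrossing_def by blast
qed

lemma noncrossingI:
  assumes "\<And>a. a < n \<Longrightarrow> (a, a) \<in> r" "\<And>a b. (a, b) \<in> r \<Longrightarrow> (b, a) \<in> r"
    "\<And>a b c. (a, b) \<in> r \<Longrightarrow> (b, c) \<in> r \<Longrightarrow> (a, c) \<in> r" "\<And>a b. (a, b) \<in> r \<Longrightarrow> a < n \<and> b < n"
    "\<And>a b c d. (a, c) \<in> r \<Longrightarrow> (b, d) \<in> r \<Longrightarrow> a < b \<Longrightarrow> b < c \<Longrightarrow> c < d \<Longrightarrow> (a, b) \<in> r"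
  shows "r \<in> noncrossing n"
proof -
  have "equiv {..<n} r"
  proof (rule equivI)
    show "r \<subseteq> {..<n} \<times> {..<n}" using assms(4) by auto
    show "refl_on {..<n} r" using assms(1) by (auto simp: refl_on_def)
    show "sym r" using assms(2) by (auto simp: sym_def)
    show "trans r" using assms(3) unfolding trans_def by blast
  qed
  with assms(5) show ?thesis by (auto simp: noncrossing_def)
qed

lemma noncrossing_subsetI:
  assumes "r \<in> noncrossing n" "r' \<in> noncrossing n"
    and less: "\<And>i j. (i, j) \<in> r \<Longrightarrow> i < j \<Longrightarrow> (i, j) \<in> r'"
  shows "r \<subseteq> r'"
proof (rule subrelI)
  fix i j assume ij: "(i, j) \<in> r"
  consider "i < j" | "i = j" | "j < i" by linarith
  then show "(i, j) \<in> r'"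
  proof cases
    case 2
    then show ?thesis using noncrossingD(1)[OF assms(2)] noncrossingD(4)[OF assms(1) ij] by simp
  next
    case 3
    then show ?thesis using less noncrossingD(2)[OF assms(1) ij] noncrossingD(2)[OF assms(2)] by blast
  qed (use less ij in simp)
qed

lemma finite_noncrossing: "finite (noncrossing n)"
proof (rule finite_subset)
  show "noncrossing n \<subseteq> Pow ({..<n} \<times> {..<n})"
    using noncrossingD(4) by fastforce
qed simp

lemma noncrossing_Id_on: "Id_on {..<n} \<in> noncrossing n"
  by (rule noncrossingI) auto

lemma noncrossing_full: "{..<n} \<times> {..<n} \<in> noncrossing n"
  by (rule noncrossingI) auto

lemma noncrossing_two_blocks:
  "{(a, b). a < n \<and> b < n \<and> (a \<in> {k<..l} \<longleftrightarrow> b \<in> {k<..l})} \<in> noncrossing n"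
  by (rule noncrossingI) auto

lemma noncrossing_Inter:
  assumes "S \<noteq> {}" "S \<subseteq> noncrossing n" shows "\<Inter>S \<in> noncrossing n"
proof -
  have *: "r \<in> noncrossing n" if "r \<in> S" for r using assms(2) that by blast
  show ?thesis
  proof (rule noncrossingI)
    show "(a, a) \<in> \<Inter>S" if "a < n" for a using noncrossingD(1)[OF *] that by blast
    show "(b, a) \<in> \<Inter>S" if "(a, b) \<in> \<Inter>S" for a b using noncrossingD(2)[OF *] that by blast
    show "(a, c) \<in> \<Inter>S" if "(a, b) \<in> \<Inter>S" "(b, c) \<in> \<Inter>S" for a b c
      using noncrossingD(3)[OF *] that by blast
    show "a < n \<and> b < n" if "(a, b) \<in> \<Inter>S" for a b
      using noncrossingD(4)[OF *] that assms(1) by blast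
    show "(a, b) \<in> \<Inter>S" if "(a, c) \<in> \<Inter>S" "(b, d) \<in> \<Inter>S" "a < b" "b < c" "c < d" for a b c d
      using noncrossingD(5)[OF * _ _ that(3,4,5)] that(1,2) by blast
  qed
qed

lemma noncrossing_Int: "r \<in> noncrossing n \<Longrightarrow> s \<in> noncrossing n \<Longrightarrow> r \<inter> s \<in> noncrossing n"
  using noncrossing_Inter[of "{r, s}" n] by simp

lemma nc_join_in: "s \<in> noncrossing n \<Longrightarrow> t \<in> noncrossing n \<Longrightarrow> nc_join n s t \<in> noncrossing n"
  unfolding nc_join_def
proof (rule noncrossing_Inter)
  assume "s \<in> noncrossing n" "t \<in> noncrossing n"
  then have "{..<n} \<times> {..<n} \<in> {r \<in> noncrossing n. s \<subseteq> r \<and> t \<subseteq> r}"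
    using noncrossing_full noncrossingD(4) by fastforce
  then show "{r \<in> noncrossing n. s \<subseteq> r \<and> t \<subseteq> r} \<noteq> {}" by blast
qed blast

lemma nc_join_upper: "s \<subseteq> nc_join n s t" "t \<subseteq> nc_join n s t"
  by (auto simp: nc_join_def)

lemma nc_join_least: "r \<in> noncrossing n \<Longrightarrow> s \<subseteq> r \<Longrightarrow> t \<subseteq> r \<Longrightarrow> nc_join n s t \<subseteq> r"
  by (auto simp: nc_join_def)

text \<open>This is special to intervals. The partition into an interval and its complement is
  noncrossing, hence an upper bound of \<open>s\<close> and \<open>t\<close> as soon as both respect
  it.\<close>

lemma saturated_nc_join:
  assumes "s \<in> noncrossing n" "t \<in> noncrossing n" "saturated s {k<..l}" "saturated t {k<..l}"
  shows "saturated (nc_join n s t) {k<..l}"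
proof -
  have "nc_join n s t \<subseteq> {(a, b). a < n \<and> b < n \<and> (a \<in> {k<..l} \<longleftrightarrow> b \<in> {k<..l})}"
  proof (rule nc_join_least[OF noncrossing_two_blocks])
    show "s \<subseteq> {(a, b). a < n \<and> b < n \<and> (a \<in> {k<..l} \<longleftrightarrow> b \<in> {k<..l})}"
      using assms(3) noncrossingD(4)[OF assms(1)] unfolding saturated_def by blast
    show "t \<subseteq> {(a, b). a < n \<and> b < n \<and> (a \<in> {k<..l} \<longleftrightarrow> b \<in> {k<..l})}"
      using assms(4) noncrossingD(4)[OF assms(2)] unfolding saturated_def by blast
  qed
  then show ?thesis unfolding saturated_def by blast
qed

lemma kreweras_iff:
  "i < j \<Longrightarrow> (i, j) \<in> kreweras n r \<longleftrightarrow> j < n \<and> saturated r {i<..j}"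
proof -
  assume "i < j"
  then have "(a \<le> i \<longleftrightarrow> a \<le> j) \<longleftrightarrow> a \<notin> {i<..j}" for a by auto
  with \<open>i < j\<close> show ?thesis unfolding kreweras_def saturated_def by auto
qed

lemma saturatedI:
  assumes "r \<in> noncrossing n" "\<And>a b. (a, b) \<in> r \<Longrightarrow> a \<in> A \<Longrightarrow> b \<in> A"
  shows "saturated r A"
  using assms(2) noncrossingD(2)[OF assms(1)] unfolding saturated_def by blast

text \<open>If two chords of the complement crossed, the interval between their first ends would be
  a difference of two saturated sets, hence saturated.\<close>

lemma kreweras_in: "kreweras n r \<in> noncrossing n"
proof (rule noncrossingI)
  fix a b c d assume "(a, c) \<in> kreweras n r" "(b, d) \<in> kreweras n r" and less: "a < b" "b < c" "c < d"
  then have *: "saturated r {a<..c}" "saturated r {b<..d}" "b < n"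
    using kreweras_iff by auto
  have "{a<..b} = {a<..c} - {b<..d}" using less by auto
  then have "saturated r {a<..b}" using * unfolding saturated_def by blast
  then show "(a, b) \<in> kreweras n r" using * less by (simp add: kreweras_iff)
qed (auto simp: kreweras_def)

lemma kreweras_nc_join:
  assumes "s \<in> noncrossing n" "t \<in> noncrossing n"
  shows "kreweras n (nc_join n s t) = kreweras n s \<inter> kreweras n t"
proof
  show "kreweras n (nc_join n s t) \<subseteq> kreweras n s \<inter> kreweras n t"
    using nc_join_upper[of s n t] nc_join_upper[of t n s] unfolding kreweras_def by blast
  show "kreweras n s \<inter> kreweras n t \<subseteq> kreweras n (nc_join n s t)"
    by (rule noncrossing_subsetI[OF noncrossing_Int[OF kreweras_in kreweras_in] kreweras_in])
      (auto simp: kreweras_iff intro: saturated_nc_join assms)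
qed

text \<open>If no relation leads from \<open>{e<..q}\<close> downwards out of it, take for \<open>l\<close> the largest element
  related to one of \<open>{e<..q}\<close>.\<close>

lemma saturated_gap:
  assumes x: "x \<in> noncrossing n" "x \<subseteq> kreweras n s" and eq: "e < q" "q < n"
    and s: "saturated s {e<..q}"
    and gap: "\<And>a b. e < a \<Longrightarrow> a \<le> q \<Longrightarrow> (a, b) \<in> x \<Longrightarrow> e < b"
  obtains l where "q \<le> l" "l < n" "saturated s {e<..l}" "saturated x {e<..l}"
proof -
  define B where "B = {b. \<exists>a. e < a \<and> a \<le> q \<and> (a, b) \<in> x}"
  define l where "l = Max B"
  have B_less: "b < n" if "b \<in> B" for b using that noncrossingD(4)[OF x(1)] by (auto simp: B_def)
  then have fin: "finite B" by (meson finite_nat_set_iff_bounded)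
  have qB: "q \<in> B" using eq noncrossingD(1)[OF x(1)] by (auto simp: B_def)
  then have l: "l \<in> B" "\<And>b. b \<in> B \<Longrightarrow> b \<le> l"
    using Max_in[OF fin] Max_ge[OF fin] unfolding l_def by blast+
  obtain a where a: "e < a" "a \<le> q" "(a, l) \<in> x" using l(1) unfolding B_def by blast
  have ql: "q \<le> l" using l qB by blast
  have maxl: False if "e < c" "c \<le> q" "(c, d) \<in> x" "l < d" for c d
    using that l(2)[of d] unfolding B_def by (auto simp flip: not_less)
  have "saturated s {e<..l}"
  proof (cases "a < l")
    case True
    then have "saturated s {a<..l}" using a(3) x(2) by (auto simp: kreweras_iff)
    moreover have "{e<..l} = {e<..q} \<union> {a<..l}" using a ql by auto
    ultimately show ?thesis using s unfolding saturated_def by blast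
  next
    case False
    then have "l = q" using a ql by simp
    then show ?thesis using s by simp
  qed
  moreover have "saturated x {e<..l}"
  proof -
    have "d \<in> {e<..l}" if cd: "(c, d) \<in> x" and c: "c \<in> {e<..l}" for c d
    proof (cases "c \<le> q")
      case True
      then show ?thesis using gap[of c d] maxl[of c d] cd c by (auto simp flip: not_less)
    next
      case False
      \<comment> \<open>Such a pair \<open>(c, d)\<close> would cross or share an end with
        \<open>(a, l)\<close>, so \<open>d\<close> would be related to \<open>a\<close>, against the
        maximality of \<open>l\<close>.\<close>
      have "\<not> l < d"
      proof
        assume "l < d"
        have "(a, c) \<in> x"
        proof (cases "c = l")
          case False
          then show ?thesis
            using noncrossingD(5)[OF x(1) a(3) cd] c \<open>l < d\<close> a \<open>\<not> c \<le> q\<close> by auto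
        qed (use a in simp)
        then have "(a, d) \<in> x" using cd noncrossingD(3)[OF x(1)] by blast
        then show False using maxl[OF a(1,2)] \<open>l < d\<close> by blast
      qed
      moreover have "e < d"
      proof (rule ccontr)
        assume "\<not> e < d"
        have "(d, a) \<in> x"
        proof (cases "c = l")
          case True
          then show ?thesis using a(3) cd noncrossingD(2,3)[OF x(1)] by blast
        next
          case False
          then show ?thesis
            using noncrossingD(5)[OF x(1) noncrossingD(2)[OF x(1) cd] a(3)] c \<open>\<not> e < d\<close> a \<open>\<not> c \<le> q\<close> by auto
        qed
        then show False using gap[OF a(1,2)] noncrossingD(2)[OF x(1)] \<open>\<not> e < d\<close> by blast
      qed
      ultimately show ?thesis by simp
    qed
    then show ?thesis by (rule saturatedI[OF x(1)])
  qed
  ultimately show thesis using that ql l(1) B_less by blast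
qed

text \<open>The interval found is a certificate that the join of \<open>s\<close> and
  \<open>x\<close> does not relate \<open>p\<close> to \<open>q\<close>. Let \<open>e\<close> be the
  last point up to \<open>q\<close> in the \<open>x\<close>-block of \<open>p\<close>. If
  \<open>x\<close> does not lead from \<open>{e<..q}\<close> down to \<open>e\<close> or below, this
  interval is extended upwards by \<open>saturated_gap\<close>. Otherwise let \<open>k\<close> be
  the largest point up to \<open>e\<close> that is related to one of \<open>{e<..q}\<close>; then
  \<open>k < p\<close>, and \<open>{k<..e}\<close> contains \<open>p\<close> but not
  \<open>q\<close>.\<close>

lemma separating_interval:
  assumes x: "x \<in> noncrossing n" "x \<subseteq> kreweras n s"
    and pq: "(p, q) \<in> kreweras n s" "(p, q) \<notin> x" "p < q"
  obtains k l where "k < l" "l < n" "saturated s {k<..l}" "saturated x {k<..l}"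
    "p \<in> {k<..l} \<longleftrightarrow> q \<notin> {k<..l}"
proof -
  have n: "p < n" "q < n" using pq by (auto simp: kreweras_def)
  define X where "X = {c. (p, c) \<in> x \<and> c \<le> q}"
  define e where "e = Max X"
  have "finite X" unfolding X_def by auto
  moreover have "p \<in> X" using n pq noncrossingD(1)[OF x(1)] by (auto simp: X_def)
  ultimately have e: "e \<in> X" "\<And>c. c \<in> X \<Longrightarrow> c \<le> e" "p \<le> e"
    using Max_in[of X] Max_ge[of X] unfolding e_def by blast+
  then have "e < q" "(p, e) \<in> x" using pq(2) unfolding X_def by (auto simp: le_less)
  have eX: "(p, c) \<notin> x" if "e < c" "c \<le> q" for c
    using e(2)[of c] that by (auto simp: X_def)
  have s: "saturated s {e<..q}"
  proof -
    have "saturated s {p<..e}"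
    proof (cases "p < e")
      case True
      then show ?thesis using x(2) \<open>(p, e) \<in> x\<close> kreweras_iff by blast
    qed (simp add: saturated_def)
    moreover have "saturated s {p<..q}" using pq kreweras_iff by blast
    moreover have "{e<..q} = {p<..q} - {p<..e}" using e(3) by auto
    ultimately show ?thesis unfolding saturated_def by blast
  qed
  show thesis
  proof (cases "\<forall>a b. e < a \<longrightarrow> a \<le> q \<longrightarrow> (a, b) \<in> x \<longrightarrow> e < b")
    case True
    then obtain l where "q \<le> l" "l < n" "saturated s {e<..l}" "saturated x {e<..l}"
      using saturated_gap[OF x \<open>e < q\<close> n(2) s] by blast
    then show thesis using that[of e l] \<open>e < q\<close> e(3) by auto
  next
    case False
    define A where "A = {b. b \<le> e \<and> (\<exists>a. e < a \<and> a \<le> q \<and> (a, b) \<in> x)}"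
    define k where "k = Max A"
    have "finite A" unfolding A_def by auto
    moreover obtain a0 b0 where "e < a0" "a0 \<le> q" "(a0, b0) \<in> x" "\<not> e < b0"
      using False by blast
    then have "b0 \<in> A" unfolding A_def by auto
    ultimately have k: "k \<in> A" "\<And>b. b \<in> A \<Longrightarrow> b \<le> k"
      using Max_in[of A] Max_ge[of A] unfolding k_def by blast+
    then obtain a where a: "e < a" "a \<le> q" "(a, k) \<in> x" "k \<le> e" unfolding A_def by blast
    have ka: "(k, a) \<in> x" using a(3) noncrossingD(2)[OF x(1)] by blast
    have maxk: False if "k < c" "c \<le> e" "(a', c) \<in> x" "e < a'" "a' \<le> q" for c a'
      using k(2)[of c] that unfolding A_def by auto
    have not_pk: "(p, k) \<notin> x"
      using eX[OF a(1,2)] ka noncrossingD(3)[OF x(1)] by blast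
    have "k < p"
    proof (rule ccontr)
      assume "\<not> k < p"
      moreover have "p \<noteq> k" using not_pk n noncrossingD(1)[OF x(1)] by blast
      moreover have "k \<noteq> e" using not_pk \<open>(p, e) \<in> x\<close> by blast
      ultimately have "(p, k) \<in> x"
        using noncrossingD(5)[OF x(1) \<open>(p, e) \<in> x\<close> ka] a by auto
      then show False using not_pk by blast
    qed
    have "saturated s {k<..a}" using ka x(2) \<open>k < p\<close> e(3) a(1) kreweras_iff[of k a] by auto
    moreover have "{k<..e} = {k<..a} - {e<..q}" using a by auto
    ultimately have 1: "saturated s {k<..e}" using s unfolding saturated_def by blast
    have "d \<in> {k<..e}" if cd: "(c, d) \<in> x" and c: "c \<in> {k<..e}" for c d
    proof -
      have not_ac: "(a, c) \<notin> x" using maxk[of c a] c a by auto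
      have "\<not> e < d"
      proof
        assume "e < d"
        show False
        proof (cases "d \<le> q")
          case True
          then show False using maxk[of c d] c \<open>e < d\<close> cd noncrossingD(2)[OF x(1)] by auto
        next
          case False
          then have "(k, c) \<in> x" using noncrossingD(5)[OF x(1) ka cd] c a by auto
          then show False using not_ac a(3) noncrossingD(3)[OF x(1)] by blast
        qed
      qed
      moreover have "k < d"
      proof (rule ccontr)
        assume "\<not> k < d"
        have "(d, k) \<in> x"
        proof (cases "d = k")
          case True
          then show ?thesis using noncrossingD(1,4)[OF x(1)] cd by blast
        next
          case False
          then show ?thesis
            using noncrossingD(5)[OF x(1) noncrossingD(2)[OF x(1) cd] ka] c a \<open>\<not> k < d\<close> by auto
        qed
        then show False using not_ac cd a(3) noncrossingD(2,3)[OF x(1)] by blast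
      qed
      ultimately show ?thesis by simp
    qed
    then have "saturated x {k<..e}" by (rule saturatedI[OF x(1)])
    then show thesis using that[of k e] 1 \<open>k < p\<close> e(3) \<open>e < q\<close> n by auto
  qed
qed

text \<open>Dividing the product of \<open>s\<close> and \<open>x\<close> by \<open>s\<close> gives
  \<open>x\<close> back. A pair of the quotient outside \<open>x\<close> is excluded by a separating
  interval, which is saturated for the join too.\<close>

lemma kreweras_inter_nc_join:
  assumes "s \<in> noncrossing n" "x \<in> noncrossing n" "x \<subseteq> kreweras n s"
  shows "kreweras n s \<inter> nc_join n s x = x"
proof
  show "kreweras n s \<inter> nc_join n s x \<subseteq> x"
  proof (rule noncrossing_subsetI[OF noncrossing_Int[OF kreweras_in nc_join_in]])
    fix p q assume *: "(p, q) \<in> kreweras n s \<inter> nc_join n s x" "p < q"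
    show "(p, q) \<in> x"
    proof (rule ccontr)
      assume "(p, q) \<notin> x"
      then obtain k l where "saturated s {k<..l}" "saturated x {k<..l}"
        and kl: "p \<in> {k<..l} \<longleftrightarrow> q \<notin> {k<..l}"
        using separating_interval[OF assms(2,3)] * by blast
      then have "saturated (nc_join n s x) {k<..l}" using assms by (intro saturated_nc_join)
      then show False using * kl unfolding saturated_def by blast
    qed
  qed (use assms in auto)
qed (use assms nc_join_upper in auto)

lemma kreweras_le_cancel:
  assumes "r \<in> noncrossing n" "r' \<in> noncrossing n" "kreweras n r' \<subseteq> kreweras n r"
  shows "r \<subseteq> r'"
proof (rule noncrossing_subsetI[OF assms(1,2)])
  fix i j assume *: "(i, j) \<in> r" "i < j"
  show "(i, j) \<in> r'"
  proof (rule ccontr)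
    assume "(i, j) \<notin> r'"
    \<comment> \<open>The complement of the identity relates everything, so
      \<open>separating_interval\<close> applies to every pair outside \<open>r'\<close>.\<close>
    have "kreweras n (Id_on {..<n}) = {..<n} \<times> {..<n}"
      by (auto simp: kreweras_def)
    then have "r' \<subseteq> kreweras n (Id_on {..<n})" "(i, j) \<in> kreweras n (Id_on {..<n})"
      using noncrossingD(4)[OF assms(2)] noncrossingD(4)[OF assms(1) *(1)] by auto
    then obtain k l where kl: "k < l" "l < n" "saturated r' {k<..l}" "i \<in> {k<..l} \<longleftrightarrow> j \<notin> {k<..l}"
      using separating_interval[OF assms(2)] \<open>(i, j) \<notin> r'\<close> * by metis
    then have "(k, l) \<in> kreweras n r" using assms(3) kreweras_iff[of k l n r'] by blast
    then have "saturated r {k<..l}" using kl by (simp add: kreweras_iff)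
    then show False using * kl unfolding saturated_def by blast
  qed
qed

text \<open>Suppose a block \<open>T\<close> of \<open>t\<close> has points inside and outside the
  interval. Let \<open>a2\<close> be its last point inside and \<open>a0\<close> its last point
  outside, in cyclic order. The chord from \<open>a0\<close> to \<open>a2\<close> separates no block
  of \<open>s\<close>: blocks of \<open>s\<close> within \<open>T\<close> respect the interval, the
  others cannot cross \<open>T\<close>. So it belongs to the quotient, although its ends are on
  different sides of the interval.\<close>

lemma saturated_of_quotient:
  assumes st: "s \<subseteq> t" and s: "s \<in> noncrossing n" and t: "t \<in> noncrossing n"
    and ij: "saturated s {i<..j}" and q: "saturated (kreweras n s \<inter> t) {i<..j}"
  shows "saturated t {i<..j}"
proof -
  have "b \<in> {i<..j}" if ab: "(a, b) \<in> t" and a: "a \<in> {i<..j}" for a b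
  proof (rule ccontr)
    assume b: "b \<notin> {i<..j}"
    define T where "T = {c. (a, c) \<in> t}"
    have T_rel: "(c, d) \<in> t" if "c \<in> T" "d \<in> T" for c d
      using that noncrossingD(2,3)[OF t] unfolding T_def by blast
    have T_closed: "d \<in> T" if "c \<in> T" "(c, d) \<in> t" for c d
      using that noncrossingD(3)[OF t] unfolding T_def by blast
    have aT: "a \<in> T" "b \<in> T" using ab noncrossingD(1,4)[OF t] unfolding T_def by blast+
    have finT: "finite T"
      using noncrossingD(4)[OF t] unfolding T_def by (auto simp: finite_nat_set_iff_bounded)
    have T_less: "c < n" if "c \<in> T" for c using that noncrossingD(4)[OF t] unfolding T_def by blast
    define a2 where "a2 = Max (T \<inter> {i<..j})"
    have a2: "a2 \<in> T" "i < a2" "a2 \<le> j" "\<And>c. c \<in> T \<Longrightarrow> i < c \<Longrightarrow> c \<le> j \<Longrightarrow> c \<le> a2"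
    proof -
      have "finite (T \<inter> {i<..j})" "T \<inter> {i<..j} \<noteq> {}" using finT aT(1) a by auto
      from Max_in[OF this] Max_ge[OF this(1)] show "a2 \<in> T" "i < a2" "a2 \<le> j"
        "\<And>c. c \<in> T \<Longrightarrow> i < c \<Longrightarrow> c \<le> j \<Longrightarrow> c \<le> a2"
        unfolding a2_def by auto
    qed
    have contra: False if "k < l" "k \<in> T" "l \<in> T" "saturated s {k<..l}" "k \<in> {i<..j} \<longleftrightarrow> l \<notin> {i<..j}" for k l
    proof -
      have "(k, l) \<in> kreweras n s \<inter> t" using that T_rel T_less by (simp add: kreweras_iff)
      then show False using q that(5) unfolding saturated_def by blast
    qed
    \<comment> \<open>A block of \<open>s\<close> outside \<open>T\<close> lies in another block of
      \<open>t\<close>, which cannot cross the chord from \<open>k\<close> to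
      \<open>l\<close>.\<close>
    have between: "k < d \<and> d < l"
      if "(c, d) \<in> s" "c \<notin> T" "k \<in> T" "l \<in> T" "k < c" "c < l" for c d k l
    proof -
      have cd: "(c, d) \<in> t" "(d, c) \<in> t" using that st noncrossingD(2)[OF t] by auto
      have "d \<notin> T" using T_closed[of d c] cd that by blast
      have "\<not> l < d"
        using noncrossingD(5)[OF t T_rel[OF that(3,4)] cd(1)] that T_closed[of k c] by blast
      moreover have "\<not> d < k"
      proof
        assume "d < k"
        then have "(d, k) \<in> t" using noncrossingD(5)[OF t cd(2) T_rel[OF that(3,4)]] that by blast
        then show False using T_closed[OF that(3)] noncrossingD(2)[OF t] \<open>d \<notin> T\<close> by blast
      qed
      ultimately show ?thesis using \<open>d \<notin> T\<close> that(3,4) by (metis linorder_neqE_nat)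
    qed
    show False
    proof (cases "T \<inter> {..i} = {}")
      case False
      define a0 where "a0 = Max (T \<inter> {..i})"
      have a0: "a0 \<in> T" "a0 \<le> i" "\<And>c. c \<in> T \<Longrightarrow> c \<le> i \<Longrightarrow> c \<le> a0"
        using Max_in[OF _ False] Max_ge[of "T \<inter> {..i}"] finT unfolding a0_def by auto
      have "saturated s {a0<..a2}"
      proof (rule saturatedI[OF s])
        fix c d assume cd: "(c, d) \<in> s" and c: "c \<in> {a0<..a2}"
        show "d \<in> {a0<..a2}"
        proof (cases "c \<in> T")
          case True
          then have "i < c" using a0(3)[of c] c by (auto simp flip: not_less)
          then have "c \<in> {i<..j}" using c a2 by auto
          then have "d \<in> {i<..j}" using ij cd unfolding saturated_def by blast
          moreover have "d \<in> T" using T_closed True cd st by blast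
          ultimately show ?thesis using a2(4)[of d] a0 by auto
        next
          case False
          then have "c \<noteq> a2" using a2(1) by blast
          then show ?thesis using between[OF cd False a0(1) a2(1)] c by auto
        qed
      qed
      then show False using contra[of a0 a2] a0 a2 by auto
    next
      case True
      define a0 where "a0 = Max T"
      have a0: "a0 \<in> T" "\<And>c. c \<in> T \<Longrightarrow> c \<le> a0"
        using Max_in[of T] Max_ge[of T] finT aT unfolding a0_def by blast+
      have above: "i < c" if "c \<in> T" for c using True that by (auto simp flip: not_less)
      have "j < a0" using above[OF aT(2)] b a0(2)[OF aT(2)] by auto
      have "saturated s {a2<..a0}"
      proof (rule saturatedI[OF s])
        fix c d assume cd: "(c, d) \<in> s" and c: "c \<in> {a2<..a0}"
        show "d \<in> {a2<..a0}"
        proof (cases "c \<in> T")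
          case True
          then have "c \<notin> {i<..j}" using a2(4)[of c] c by auto
          then have "d \<notin> {i<..j}" using ij cd unfolding saturated_def by blast
          moreover have "d \<in> T" using T_closed True cd st by blast
          ultimately show ?thesis using above[of d] a0(2)[of d] a2(3) by auto
        next
          case False
          then have "c \<noteq> a0" using a0(1) by blast
          then show ?thesis using between[OF cd False a2(1) a0(1)] c by auto
        qed
      qed
      then show False using contra[of a2 a0] a0 a2 \<open>j < a0\<close> by auto
    qed
  qed
  then show ?thesis by (rule saturatedI[OF t])
qed

text \<open>The inclusion of \<open>t\<close> in the join is tested on complements. There it says
  that an interval saturated for \<open>s\<close> and for the quotient is saturated for
  \<open>t\<close>.\<close>

lemma nc_join_kreweras:
  assumes "s \<in> noncrossing n" "t \<in> noncrossing n" "s \<subseteq> t"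
  shows "nc_join n s (kreweras n s \<inter> t) = t"
proof
  have m: "kreweras n s \<inter> t \<in> noncrossing n" by (intro noncrossing_Int kreweras_in assms)
  show "nc_join n s (kreweras n s \<inter> t) \<subseteq> t" by (intro nc_join_least) (use assms in auto)
  show "t \<subseteq> nc_join n s (kreweras n s \<inter> t)"
  proof (rule kreweras_le_cancel[OF assms(2)])
    show "kreweras n (nc_join n s (kreweras n s \<inter> t)) \<subseteq> kreweras n t"
      unfolding kreweras_nc_join[OF assms(1) m]
      by (rule noncrossing_subsetI[OF noncrossing_Int[OF kreweras_in kreweras_in] kreweras_in])
        (use saturated_of_quotient[OF assms(3,1,2)] in \<open>simp add: kreweras_iff\<close>)
  qed (use assms m in \<open>intro nc_join_in\<close>)
qed

lemma complement_germ_noncrossing: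
  "complement_germ (noncrossing n) (nc_join n) (kreweras n) (Id_on {..<n}) ({..<n} \<times> {..<n})"
proof
  show "finite (noncrossing n)" by (rule finite_noncrossing)
  show "Id_on {..<n} \<in> noncrossing n" by (rule noncrossing_Id_on)
  show "{..<n} \<times> {..<n} \<in> noncrossing n" by (rule noncrossing_full)
  show "inj_on (kreweras n) (noncrossing n)"
  proof (rule inj_onI)
    fix r s assume "r \<in> noncrossing n" "s \<in> noncrossing n" "kreweras n r = kreweras n s"
    then show "r = s" by (simp add: subset_antisym kreweras_le_cancel)
  qed
  fix a assume a: "a \<in> noncrossing n"
  show "Id_on {..<n} \<subseteq> a" using noncrossingD(1)[OF a] by auto
  show "a \<subseteq> {..<n} \<times> {..<n}" using noncrossingD(4)[OF a] by auto
  show "kreweras n a \<in> noncrossing n" by (rule kreweras_in)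
  fix b assume b: "b \<in> noncrossing n"
  show "inf a b \<in> noncrossing n" using noncrossing_Int[OF a b] by simp
  show "nc_join n a b \<in> noncrossing n" by (rule nc_join_in[OF a b])
  show "a \<subseteq> nc_join n a b" "b \<subseteq> nc_join n a b" by (rule nc_join_upper)+
  show "kreweras n (nc_join n a b) = inf (kreweras n a) (kreweras n b)"
    using kreweras_nc_join[OF a b] by simp
  show "nc_join n a (inf (kreweras n a) b) = b" if "a \<subseteq> b"
    using nc_join_kreweras[OF a b that] by simp
  show "inf (kreweras n a) (nc_join n a b) = b" if "b \<subseteq> kreweras n a"
    using kreweras_inter_nc_join[OF a b that] by simp
  show "nc_join n a b \<subseteq> c" if "c \<in> noncrossing n" "a \<subseteq> c" "b \<subseteq> c" for c
    using that by (rule nc_join_least)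
qed

section \<open>Positive lifts of permutations\<close>

definition inversions :: "nat \<Rightarrow> (nat \<Rightarrow> nat) \<Rightarrow> (nat \<times> nat) set" where
  "inversions n f = {(i, j). i < j \<and> j < n \<and> f j < f i}"

abbreviation adj :: "nat \<Rightarrow> nat \<Rightarrow> nat" where
  "adj i \<equiv> Transposition.transpose i (Suc i)"

lemma finite_inversions: "finite (inversions n f)"
  by (rule finite_subset[of _ "{..<n} \<times> {..<n}"]) (auto simp: inversions_def)

lemma adj_less: "Suc i < n \<Longrightarrow> k < n \<Longrightarrow> adj i k < n"
  by (auto simp: Transposition.transpose_def)

lemma adj_mono: "k < l \<Longrightarrow> \<not> (k = i \<and> l = Suc i) \<Longrightarrow> adj i k < adj i l"
  by (auto simp: Transposition.transpose_def)

text \<open>Exchanging the two values at a descent removes the inversion \<open>(i, Suc i)\<close>;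
  the inversions that remain are relabelled ones of \<open>f\<close>.\<close>

lemma card_inversions_adj:
  assumes "Suc i < n" "f (Suc i) < f i"
  shows "card (inversions n (f \<circ> adj i)) < card (inversions n f)"
proof -
  let ?s = "map_prod (adj i) (adj i)"
  have "?s ` inversions n (f \<circ> adj i) \<subseteq> inversions n f - {(i, Suc i)}"
  proof
    fix x assume "x \<in> ?s ` inversions n (f \<circ> adj i)"
    then obtain k l where x: "x = (adj i k, adj i l)" and kl: "k < l" "l < n" "f (adj i l) < f (adj i k)"
      by (auto simp: inversions_def)
    have "\<not> (k = i \<and> l = Suc i)" using kl(3) assms(2) by auto
    then have "adj i k < adj i l" using adj_mono kl(1) by blast
    moreover have "\<not> (adj i k = i \<and> adj i l = Suc i)"
      using kl(1) by (auto simp: transpose_eq_iff)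
    ultimately show "x \<in> inversions n f - {(i, Suc i)}"
      using kl adj_less[OF assms(1) kl(2)] by (auto simp: x inversions_def)
  qed
  then have "card (?s ` inversions n (f \<circ> adj i)) \<le> card (inversions n f - {(i, Suc i)})"
    by (rule card_mono[OF finite_Diff[OF finite_inversions]])
  moreover have "(i, Suc i) \<in> inversions n f" using assms by (simp add: inversions_def)
  then have "card (inversions n f - {(i, Suc i)}) < card (inversions n f)"
    by (rule card_Diff1_less[OF finite_inversions])
  moreover have "inj ?s" by (intro prod.inj_map inj_transpose)
  ultimately show ?thesis by (simp add: card_image inj_on_subset)
qed

lemma permutes_no_descent:
  assumes "b permutes {..<n}" "\<And>i. Suc i < n \<Longrightarrow> b i \<le> b (Suc i)"
  shows "b = id"
proof -
  have "i \<le> b i" if "i < n" for i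
    using that
  proof (induction i)
    case (Suc i)
    have "b i \<noteq> b (Suc i)" using permutes_inj[OF assms(1)] by (simp add: inj_eq)
    then have "b i < b (Suc i)" using assms(2)[of i] Suc.prems by simp
    then show ?case using Suc by simp
  qed simp
  then show ?thesis using permutes_natset_ge[OF assms(1)] by auto
qed

locale braid_relations = group G for G (structure) +
  fixes n :: nat and \<sigma> :: "nat \<Rightarrow> 'a"
  assumes sigma_in [simp, intro]: "Suc i < n \<Longrightarrow> \<sigma> i \<in> carrier G"
    and sigma_commute: "Suc i < j \<Longrightarrow> Suc j < n \<Longrightarrow> \<sigma> i \<otimes> \<sigma> j = \<sigma> j \<otimes> \<sigma> i"
    and sigma_braid: "Suc (Suc i) < n \<Longrightarrow> \<sigma> i \<otimes> \<sigma> (Suc i) \<otimes> \<sigma> i = \<sigma> (Suc i) \<otimes> \<sigma> i \<otimes> \<sigma> (Suc i)"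
begin

inductive lifts :: "(nat \<Rightarrow> nat) \<Rightarrow> 'a \<Rightarrow> bool" where
  sorted: "(\<And>i. Suc i < n \<Longrightarrow> f i \<le> f (Suc i)) \<Longrightarrow> lifts f \<one>"
| descent: "Suc i < n \<Longrightarrow> f (Suc i) < f i \<Longrightarrow> lifts (f \<circ> adj i) g \<Longrightarrow> lifts f (g \<otimes> \<sigma> i)"

lemma lifts_in: "lifts f g \<Longrightarrow> g \<in> carrier G"
  by (induction rule: lifts.induct) auto

lemma lifts_exists: "\<exists>g. lifts f g"
proof (induction "card (inversions n f)" arbitrary: f rule: less_induct)
  case less
  show ?case
  proof (cases "\<exists>i. Suc i < n \<and> f (Suc i) < f i")
    case True
    then obtain i where i: "Suc i < n" "f (Suc i) < f i" by blast
    then obtain g where "lifts (f \<circ> adj i) g" using less card_inversions_adj by blast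
    then show ?thesis using descent i by blast
  next
    case False
    then have "lifts f \<one>" by (intro sorted) (meson not_less)
    then show ?thesis ..
  qed
qed

text \<open>Matsumoto's theorem as a diamond argument. By induction on inversions, two lifts ending
  in \<open>\<sigma> i\<close> and \<open>\<sigma> j\<close> may both be routed through a common
  function \<open>h\<close>, sorted at both places. The two routes agree by the braid relation if
  \<open>j = Suc i\<close>, and by commutation if the places are further apart.\<close>

lemma lifts_unique: "lifts f g \<Longrightarrow> lifts f g' \<Longrightarrow> g = g'"
proof (induction "card (inversions n f)" arbitrary: f g g' rule: less_induct)
  case less
  have IH: "g = g'" if "Suc i < n" "f (Suc i) < f i" "lifts (f \<circ> adj i) g" "lifts (f \<circ> adj i) g'" for i g g'
    using less.hyps card_inversions_adj that by blast
  have main: "g1 \<otimes> \<sigma> i = g2 \<otimes> \<sigma> j" if i: "Suc i < n" "f (Suc i) < f i" "lifts (f \<circ> adj i) g1"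
    and j: "Suc j < n" "f (Suc j) < f j" "lifts (f \<circ> adj j) g2" and "i \<le> j" for i j g1 g2
  proof -
    consider "i = j" | "j = Suc i" | "Suc i < j" using \<open>i \<le> j\<close> by linarith
    then show ?thesis
    proof cases
      case 1
      then show ?thesis using IH i j by blast
    next
      case 2
      define h where "h = f \<circ> adj i \<circ> adj (Suc i) \<circ> adj i"
      have h: "h = f \<circ> adj (Suc i) \<circ> adj i \<circ> adj (Suc i)"
        unfolding h_def by (rule ext) (simp add: Transposition.transpose_def)
      obtain k where k: "lifts h k" using lifts_exists by blast
      have n: "Suc (Suc i) < n" using j(1) 2 by simp
      note f = i(2) j(2)[unfolded 2]
      have "lifts (f \<circ> adj i \<circ> adj (Suc i)) (k \<otimes> \<sigma> i)"
        by (rule descent) (use k f i in \<open>auto simp: h_def Transposition.transpose_def\<close>)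
      then have "lifts (f \<circ> adj i) (k \<otimes> \<sigma> i \<otimes> \<sigma> (Suc i))"
        by (intro descent[of "Suc i"]) (use f n in \<open>auto simp: Transposition.transpose_def\<close>)
      then have g1: "g1 = k \<otimes> \<sigma> i \<otimes> \<sigma> (Suc i)" using IH i by blast
      have "lifts (f \<circ> adj (Suc i) \<circ> adj i) (k \<otimes> \<sigma> (Suc i))"
        by (rule descent) (use k f n in \<open>auto simp: h Transposition.transpose_def\<close>)
      then have "lifts (f \<circ> adj (Suc i)) (k \<otimes> \<sigma> (Suc i) \<otimes> \<sigma> i)"
        by (intro descent[of i]) (use f n in \<open>auto simp: Transposition.transpose_def\<close>)
      then have g2: "g2 = k \<otimes> \<sigma> (Suc i) \<otimes> \<sigma> i" using IH j 2 by blast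
      show ?thesis
        using sigma_braid[OF n] lifts_in[OF k] n by (simp add: g1 g2 2 m_assoc)
    next
      case 3
      define h where "h = f \<circ> adj i \<circ> adj j"
      have h: "h = f \<circ> adj j \<circ> adj i"
        unfolding h_def using 3 by (intro ext) (simp add: Transposition.transpose_def)
      obtain k where k: "lifts h k" using lifts_exists by blast
      have "lifts (f \<circ> adj i) (k \<otimes> \<sigma> j)"
        by (rule descent) (use k 3 j in \<open>auto simp: h_def Transposition.transpose_def\<close>)
      then have g1: "g1 = k \<otimes> \<sigma> j" using IH i by blast
      have "lifts (f \<circ> adj j) (k \<otimes> \<sigma> i)"
        by (rule descent) (use k 3 i in \<open>auto simp: h Transposition.transpose_def\<close>)
      then have g2: "g2 = k \<otimes> \<sigma> i" using IH j by blast
      show ?thesis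
        using sigma_commute[OF 3 j(1)] lifts_in[OF k] i j by (simp add: g1 g2 m_assoc)
    qed
  qed
  show ?case
    using less.prems(1)
  proof cases
    case sorted
    show ?thesis using less.prems(2) by cases (use sorted in \<open>auto simp: not_less dest: leD\<close>)
  next
    case (descent i g1)
    note i = this
    show ?thesis using less.prems(2)
    proof cases
      case sorted
      then show ?thesis using i(2,3) by (auto dest: leD)
    next
      case (descent j g2)
      then show ?thesis using i main[of i g1 j g2] main[of j g2 i g1] by (metis nat_le_linear)
    qed
  qed
qed

definition lift :: "(nat \<Rightarrow> nat) \<Rightarrow> 'a" where
  "lift f = (THE g. lifts f g)"

lemma lift_eq: "lifts f g \<Longrightarrow> lift f = g"
  unfolding lift_def using lifts_unique by blast

lemma lifts_lift: "lifts f (lift f)"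
  using lifts_exists lift_eq by blast

lemma lift_in [simp, intro]: "lift f \<in> carrier G"
  using lifts_lift lifts_in by blast

lemma lift_sorted: "(\<And>i. Suc i < n \<Longrightarrow> f i \<le> f (Suc i)) \<Longrightarrow> lift f = \<one>"
  by (intro lift_eq sorted)

lemma lift_id [simp]: "lift id = \<one>"
  by (rule lift_sorted) simp

lemma lift_descent: "Suc i < n \<Longrightarrow> f (Suc i) < f i \<Longrightarrow> lift f = lift (f \<circ> adj i) \<otimes> \<sigma> i"
  by (intro lift_eq descent lifts_lift)

lemma lift_adj: "Suc i < n \<Longrightarrow> lift (adj i) = \<sigma> i"
  using lift_descent[of i "adj i"] by (simp add: transpose_comp_involutory)

text \<open>The hypothesis says that every inversion of \<open>b\<close> is one of the composite, in
  other words that lengths add. Positive lifts are not multiplicative in general: for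
  \<open>a = b = adj i\<close> the left side is \<open>\<one>\<close> and the right side the square
  of \<open>\<sigma> i\<close>.\<close>

lemma lift_comp:
  assumes "b permutes {..<n}" "\<And>k l. k < l \<Longrightarrow> l < n \<Longrightarrow> b l < b k \<Longrightarrow> a (b l) < a (b k)"
  shows "lift (a \<circ> b) = lift a \<otimes> lift b"
  using assms
proof (induction "card (inversions n b)" arbitrary: b rule: less_induct)
  case less
  show ?case
  proof (cases "\<exists>i. Suc i < n \<and> b (Suc i) < b i")
    case True
    then obtain i where i: "Suc i < n" "b (Suc i) < b i" by blast
    have p: "b \<circ> adj i permutes {..<n}"
      using i less.prems(1) by (intro permutes_compose permutes_swap_id) auto
    have inv: "a ((b \<circ> adj i) l) < a ((b \<circ> adj i) k)"
      if kl: "k < l" "l < n" "(b \<circ> adj i) l < (b \<circ> adj i) k" for k l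
    proof -
      have "\<not> (k = i \<and> l = Suc i)" using kl(3) i by auto
      then have "adj i k < adj i l" using adj_mono kl(1) by blast
      then show ?thesis using less.prems(2) adj_less[OF i(1) kl(2)] kl(3) by simp
    qed
    have "lift (a \<circ> b) = lift (a \<circ> b \<circ> adj i) \<otimes> \<sigma> i"
      using i less.prems(2)[of i "Suc i"] by (intro lift_descent) auto
    also have "lift (a \<circ> b \<circ> adj i) = lift a \<otimes> lift (b \<circ> adj i)"
      unfolding comp_assoc by (rule less.hyps[OF card_inversions_adj[OF i] p inv])
    also have "lift a \<otimes> lift (b \<circ> adj i) \<otimes> \<sigma> i = lift a \<otimes> lift b"
      using lift_descent[OF i] i by (simp add: m_assoc)
    finally show ?thesis .
  next
    case False
    then have "b = id" by (intro permutes_no_descent[OF less.prems(1)]) (meson not_less)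
    then show ?thesis by simp
  qed
qed

end

section \<open>The fundamental group of a topological space\<close>

lemma continuous_map_eu_compose:
  assumes "continuous_map (top_of_set C) X \<Psi>" "continuous_on S f" "f \<in> S \<rightarrow> C"
  shows "continuous_map (top_of_set S) X (\<lambda>s. \<Psi> (f s))"
proof -
  have "continuous_map (top_of_set S) (top_of_set C) f"
    using assms(2,3) by (simp add: continuous_map_subtopology_eu)
  from continuous_map_compose[OF this assms(1)] show ?thesis by (simp add: comp_def)
qed

lemma loops_at_iff:
  "p \<in> loops_at X a \<longleftrightarrow> continuous_map (top_of_set {0..1}) X p \<and> p 0 = a \<and> p 1 = a"
  by (simp add: loops_at_def pathin_def)

lemma loop_homotopy_iff:
  "(p, q) \<in> loop_homotopy X a \<longleftrightarrow> p 0 = a \<and> p 1 = a \<and> q 0 = a \<and> q 1 = a \<and>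
     (\<exists>H. continuous_map (top_of_set ({0..1::real} \<times> {0..1})) X H \<and>
        (\<forall>t\<in>{0..1}. H (0, t) = p t \<and> H (1, t) = q t \<and> H (t, 0) = a \<and> H (t, 1) = a))"
proof -
  have *: "homotopic_with (\<lambda>r. r 0 = a \<and> r 1 = a) (top_of_set {0..1}) X p q \<longleftrightarrow>
    (\<exists>H. continuous_map (top_of_set ({0..1::real} \<times> {0..1})) X H \<and>
      (\<forall>t\<in>{0..1}. H (0, t) = p t) \<and> (\<forall>t\<in>{0..1}. H (1, t) = q t) \<and>
      (\<forall>t\<in>{0..1}. H (t, 0) = a \<and> H (t, 1) = a))"
    by (subst homotopic_with) simp_all
  have "p \<in> loops_at X a \<and> q \<in> loops_at X a \<longleftrightarrow> p 0 = a \<and> p 1 = a \<and> q 0 = a \<and> q 1 = a"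
    if "homotopic_with (\<lambda>r. r 0 = a \<and> r 1 = a) (top_of_set {0..1}) X p q"
    using homotopic_with_imp_continuous_maps[OF that] by (auto simp: loops_at_iff)
  then show ?thesis unfolding loop_homotopy_def using * by auto
qed

lemma equiv_loop_homotopy: "equiv (loops_at X a) (loop_homotopy X a)"
proof (rule equivI)
  show "loop_homotopy X a \<subseteq> loops_at X a \<times> loops_at X a"
    by (auto simp: loop_homotopy_def)
  show "refl_on (loops_at X a) (loop_homotopy X a)"
    by (auto simp: refl_on_def loop_homotopy_def loops_at_iff)
  show "sym (loop_homotopy X a)"
    by (auto simp: sym_def loop_homotopy_def homotopic_with_sym)
  show "trans (loop_homotopy X a)"
    unfolding trans_def loop_homotopy_def using homotopic_with_trans by blast
qed

abbreviation loop_class :: "'a topology \<Rightarrow> 'a \<Rightarrow> (real \<Rightarrow> 'a) \<Rightarrow> (real \<Rightarrow> 'a) set" where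
  "loop_class X a p \<equiv> loop_homotopy X a `` {p}"

lemma loop_class_eqI: "(p, q) \<in> loop_homotopy X a \<Longrightarrow> loop_class X a p = loop_class X a q"
  by (rule equiv_class_eq[OF equiv_loop_homotopy])

lemma loop_homotopy_loops: "(p, q) \<in> loop_homotopy X a \<Longrightarrow> p \<in> loops_at X a \<and> q \<in> loops_at X a"
  by (simp add: loop_homotopy_def)

text \<open>Homotopies are obtained in a convex domain of parameters, where the straight one is
  available, and carried over by \<open>\<Psi>\<close>. Reparametrizations and the commutation of
  disjoint half twists are instances.\<close>

lemma loop_homotopy_convex:
  fixes C :: "'b::real_normed_vector set"
  assumes \<Psi>: "continuous_map (top_of_set C) X \<Psi>" and C: "convex C"
    and u: "continuous_on {0..1} u" "u \<in> {0..1} \<rightarrow> C" and v: "continuous_on {0..1} v" "v \<in> {0..1} \<rightarrow> C"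
    and ends: "u 0 = v 0" "u 1 = v 1" "\<Psi> (u 0) = a" "\<Psi> (u 1) = a"
  shows "(\<lambda>t. \<Psi> (u t), \<lambda>t. \<Psi> (v t)) \<in> loop_homotopy X a"
proof -
  let ?f = "\<lambda>x. (1 - fst x) *\<^sub>R u (snd x) + fst x *\<^sub>R v (snd x)"
  have "continuous_on ({0..1} \<times> {0..1}) ?f"
    by (intro continuous_intros continuous_on_compose2[OF u(1)] continuous_on_compose2[OF v(1)]) auto
  moreover have "?f \<in> {0..1} \<times> {0..1} \<rightarrow> C"
    using u(2) v(2) by (auto simp: Pi_iff intro!: convexD[OF C])
  ultimately have "continuous_map (top_of_set ({0..1} \<times> {0..1})) X (\<lambda>x. \<Psi> (?f x))"
    by (rule continuous_map_eu_compose[OF \<Psi>])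
  moreover have "?f (t, 0) = u 0" "?f (t, 1) = u 1" for t
    by (simp_all add: ends(1,2)[symmetric] flip: scaleR_add_left)
  ultimately show ?thesis
    unfolding loop_homotopy_iff using ends by (auto intro!: exI[of _ "\<lambda>x. \<Psi> (?f x)"])
qed

text \<open>With \<open>S\<close> a single point this is the continuity of a joined loop, with
  \<open>S\<close> the unit interval that of a homotopy between joined loops.\<close>

lemma continuous_map_join:
  assumes f: "continuous_map (top_of_set (S \<times> {0..1})) X (\<lambda>(s, t). f s t)"
    and g: "continuous_map (top_of_set (S \<times> {0..1})) X (\<lambda>(s, t). g s t)"
    and fg: "\<And>s. s \<in> S \<Longrightarrow> f s 1 = g s (0::real)"
  shows "continuous_map (top_of_set (S \<times> {0..1})) X (\<lambda>(s, t). join_loops (f s) (g s) t)"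
proof -
  have "continuous_map (top_of_set (S \<times> {0..1})) X
    (\<lambda>x. if snd x \<le> 1/2 then (case (fst x, 2 * snd x) of (s, t) \<Rightarrow> f s t)
         else (case (fst x, 2 * snd x - 1) of (s, t) \<Rightarrow> g s t))"
  proof (rule continuous_map_cases_le)
    show "continuous_map (subtopology (top_of_set (S \<times> {0..1})) {x \<in> topspace (top_of_set (S \<times> {0..1})). snd x \<le> 1/2}) X
      (\<lambda>x. case (fst x, 2 * snd x) of (s, t) \<Rightarrow> f s t)"
      unfolding subtopology_subtopology
      by (intro continuous_map_eu_compose[OF f] continuous_intros) auto
    show "continuous_map (subtopology (top_of_set (S \<times> {0..1})) {x \<in> topspace (top_of_set (S \<times> {0..1})). 1/2 \<le> snd x}) X
      (\<lambda>x. case (fst x, 2 * snd x - 1) of (s, t) \<Rightarrow> g s t)"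
      unfolding subtopology_subtopology
      by (intro continuous_map_eu_compose[OF g] continuous_intros) auto
    show "(case (fst x, 2 * snd x) of (s, t) \<Rightarrow> f s t) = (case (fst x, 2 * snd x - 1) of (s, t) \<Rightarrow> g s t)"
      if "x \<in> topspace (top_of_set (S \<times> {0..1}))" "snd x = 1/2" for x
    proof -
      have "2 * snd x = 1" "fst x \<in> S" using that by auto
      then show ?thesis using fg[of "fst x"] by simp
    qed
  qed (auto intro!: continuous_intros continuous_on_fst continuous_on_snd)
  then show ?thesis by (simp add: join_loops_def case_prod_unfold cong: if_cong)
qed

lemma continuous_map_drop_fst:
  assumes "continuous_map (top_of_set T) X p"
  shows "continuous_map (top_of_set (S \<times> T)) X (\<lambda>(s, t). p t)"
  unfolding case_prod_beta' by (intro continuous_map_eu_compose[OF assms] continuous_intros) auto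

lemma join_loops_in:
  assumes "p \<in> loops_at X a" "q \<in> loops_at X a"
  shows "join_loops p q \<in> loops_at X a"
proof -
  have "continuous_map (top_of_set ({0::real} \<times> {0..1})) X (\<lambda>(s, t). join_loops p q t)"
    using assms by (intro continuous_map_join continuous_map_drop_fst) (auto simp: loops_at_iff)
  from continuous_map_eu_compose[OF this, of "{0..1}" "\<lambda>t. (0, t)"]
  have "continuous_map (top_of_set {0..1}) X (join_loops p q)"
    by (simp add: continuous_on_Pair continuous_on_id continuous_on_const)
  then show ?thesis using assms by (auto simp: loops_at_iff join_loops_def)
qed

lemma join_loops_cong:
  assumes "(p, p') \<in> loop_homotopy X a" "(q, q') \<in> loop_homotopy X a"
  shows "(join_loops p q, join_loops p' q') \<in> loop_homotopy X a"
proof -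
  obtain F where F: "continuous_map (top_of_set ({0..1} \<times> {0..1})) X F"
    "\<And>t. t\<in>{0..1} \<Longrightarrow> F (0, t) = p t \<and> F (1, t) = p' t \<and> F (t, 0) = a \<and> F (t, 1) = a"
    using assms(1) unfolding loop_homotopy_iff by blast
  obtain G where G: "continuous_map (top_of_set ({0..1} \<times> {0..1})) X G"
    "\<And>t. t\<in>{0..1} \<Longrightarrow> G (0, t) = q t \<and> G (1, t) = q' t \<and> G (t, 0) = a \<and> G (t, 1) = a"
    using assms(2) unfolding loop_homotopy_iff by blast
  have "continuous_map (top_of_set ({0..1} \<times> {0..1})) X
    (\<lambda>(s, t). join_loops (\<lambda>t. F (s, t)) (\<lambda>t. G (s, t)) t)"
    using F G by (intro continuous_map_join) auto
  then show ?thesis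
    using assms F(2) G(2) unfolding loop_homotopy_iff
    by (intro conjI exI[of _ "\<lambda>(s, t). join_loops (\<lambda>t. F (s, t)) (\<lambda>t. G (s, t)) t"])
      (auto simp: join_loops_def)
qed

lemma join_loops_reparametrize:
  assumes p: "p \<in> loops_at X a"
    and \<phi>: "continuous_on {0..1} \<phi>" "\<phi> \<in> {0..1} \<rightarrow> {0..1}" "\<phi> 0 = 0" "\<phi> 1 = (1::real)"
  shows "(\<lambda>t. p (\<phi> t), p) \<in> loop_homotopy X a"
  using loop_homotopy_convex[of "{0..1}" X p \<phi> "\<lambda>t. t" a] assms
  by (auto simp: loops_at_iff intro: continuous_intros)

lemma const_in_loops: "a \<in> topspace X \<Longrightarrow> (\<lambda>t. a) \<in> loops_at X a"
  by (simp add: loops_at_iff)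

lemma join_parameters:
  fixes t :: real
  shows "min 1 (2 * t) = (if t \<le> 1/2 then 2 * t else 1)"
    "max 0 (2 * t - 1) = (if t \<le> 1/2 then 0 else 2 * t - 1)"
  by auto

lemma join_const_left: "p \<in> loops_at X a \<Longrightarrow> (join_loops (\<lambda>t. a) p, p) \<in> loop_homotopy X a"
proof -
  assume p: "p \<in> loops_at X a"
  have "(\<lambda>t. p (max 0 (2 * t - 1)), p) \<in> loop_homotopy X a"
    by (rule join_loops_reparametrize[OF p]) (auto intro!: continuous_intros)
  moreover have "(\<lambda>t. p (max 0 (2 * t - 1))) = join_loops (\<lambda>t. a) p"
    using p by (intro ext) (simp add: join_loops_def loops_at_iff join_parameters)
  ultimately show ?thesis by simp
qed

lemma join_const_right: "p \<in> loops_at X a \<Longrightarrow> (join_loops p (\<lambda>t. a), p) \<in> loop_homotopy X a"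
proof -
  assume p: "p \<in> loops_at X a"
  have "(\<lambda>t. p (min 1 (2 * t)), p) \<in> loop_homotopy X a"
    by (rule join_loops_reparametrize[OF p]) (auto intro!: continuous_intros)
  moreover have "(\<lambda>t. p (min 1 (2 * t))) = join_loops p (\<lambda>t. a)"
    using p by (intro ext) (simp add: join_loops_def loops_at_iff join_parameters)
  ultimately show ?thesis by simp
qed

lemma join_assoc:
  assumes "p \<in> loops_at X a" "q \<in> loops_at X a" "r \<in> loops_at X a"
  shows "(join_loops (join_loops p q) r, join_loops p (join_loops q r)) \<in> loop_homotopy X a"
proof -
  \<comment> \<open>The piecewise linear map sending \<open>1/4\<close> to \<open>1/2\<close> and
    \<open>1/2\<close> to \<open>3/4\<close>. Its slopes \<open>2\<close>, \<open>1\<close>,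
    \<open>1/2\<close> decrease, so it is a minimum of linear functions and thereby visibly
    continuous.\<close>
  let ?\<phi> = "\<lambda>t::real. min (2 * t) (min (t + 1/4) ((t + 1) / 2))"
  have "(\<lambda>t. join_loops p (join_loops q r) (?\<phi> t), join_loops p (join_loops q r)) \<in> loop_homotopy X a"
    by (intro join_loops_reparametrize join_loops_in assms continuous_intros) (auto simp: min_def)
  moreover have "(\<lambda>t. join_loops p (join_loops q r) (?\<phi> t)) = join_loops (join_loops p q) r"
  proof
    fix t :: real
    consider "t \<le> 1/4" | "1/4 < t" "t \<le> 1/2" | "1/2 < t" by linarith
    then show "join_loops p (join_loops q r) (?\<phi> t) = join_loops (join_loops p q) r t"
    proof cases
      case 1
      then have "?\<phi> t = 2 * t" by (simp add: min_def)
      with 1 show ?thesis by (simp add: join_loops_def)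
    next
      case 2
      then have "?\<phi> t = t + 1/4" by (simp add: min_def)
      with 2 show ?thesis by (simp add: join_loops_def algebra_simps)
    next
      case 3
      then have "?\<phi> t = (t + 1) / 2" by (auto simp add: min_def)
      with 3 show ?thesis by (simp add: join_loops_def field_simps)
    qed
  qed
  ultimately show ?thesis by simp
qed

lemma fundamental_group_mult:
  assumes "p \<in> loops_at X a" "q \<in> loops_at X a"
  shows "loop_class X a p \<otimes>\<^bsub>fundamental_group X a\<^esub> loop_class X a q = loop_class X a (join_loops p q)"
proof -
  have "congruent2 (loop_homotopy X a) (loop_homotopy X a) (\<lambda>p q. loop_class X a (join_loops p q))"
    by (intro congruent2I' loop_class_eqI join_loops_cong)
  then show ?thesis
    using UN_equiv_class2[OF equiv_loop_homotopy equiv_loop_homotopy _ assms]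
    by (simp add: fundamental_group_def)
qed

lemma fundamental_group_elem:
  assumes "b \<in> carrier (fundamental_group X a)"
  obtains p where "p \<in> loops_at X a" "b = loop_class X a p"
  using assms by (auto simp: fundamental_group_def elim!: quotientE)

lemma loop_class_in: "p \<in> loops_at X a \<Longrightarrow> loop_class X a p \<in> carrier (fundamental_group X a)"
  by (simp add: fundamental_group_def quotientI)

lemma fundamental_group_one: "\<one>\<^bsub>fundamental_group X a\<^esub> = loop_class X a (\<lambda>t. a)"
  by (simp add: fundamental_group_def)

lemma monoid_fundamental_group:
  assumes a: "a \<in> topspace X" shows "monoid (fundamental_group X a)"
proof (rule monoidI)
  let ?G = "fundamental_group X a"
  show "\<one>\<^bsub>?G\<^esub> \<in> carrier ?G"
    unfolding fundamental_group_one by (intro loop_class_in const_in_loops a)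
  fix x assume "x \<in> carrier ?G"
  then obtain p where p: "p \<in> loops_at X a" "x = loop_class X a p" by (rule fundamental_group_elem)
  show "\<one>\<^bsub>?G\<^esub> \<otimes>\<^bsub>?G\<^esub> x = x"
    unfolding fundamental_group_one p(2) fundamental_group_mult[OF const_in_loops[OF a] p(1)]
    by (intro loop_class_eqI join_const_left p)
  show "x \<otimes>\<^bsub>?G\<^esub> \<one>\<^bsub>?G\<^esub> = x"
    unfolding fundamental_group_one p(2) fundamental_group_mult[OF p(1) const_in_loops[OF a]]
    by (intro loop_class_eqI join_const_right p)
  fix y assume "y \<in> carrier ?G"
  then obtain q where q: "q \<in> loops_at X a" "y = loop_class X a q" by (rule fundamental_group_elem)
  show "x \<otimes>\<^bsub>?G\<^esub> y \<in> carrier ?G"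
    unfolding p(2) q(2) fundamental_group_mult[OF p(1) q(1)]
    by (intro loop_class_in join_loops_in p q)
  fix z assume "z \<in> carrier ?G"
  then obtain r where r: "r \<in> loops_at X a" "z = loop_class X a r" by (rule fundamental_group_elem)
  show "x \<otimes>\<^bsub>?G\<^esub> y \<otimes>\<^bsub>?G\<^esub> z = x \<otimes>\<^bsub>?G\<^esub> (y \<otimes>\<^bsub>?G\<^esub> z)"
    unfolding p(2) q(2) r(2)
    by (simp only: fundamental_group_mult join_loops_in p(1) q(1) r(1))
      (intro loop_class_eqI join_assoc p q r)
qed

section \<open>Motions of configurations\<close>

text \<open>A numbering of the strings lifts the motion to ordered configurations, where continuity
  is checked string by string.\<close>

lemma continuous_map_configurations:
  fixes T :: "'b::topological_space set"
  assumes x: "finite x" and cont: "\<And>z. z \<in> x \<Longrightarrow> continuous_on T (\<gamma> z)"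
    and inj: "\<And>t. t \<in> T \<Longrightarrow> inj_on (\<lambda>z. \<gamma> z t) x"
  shows "continuous_map (top_of_set T) (configurations (card x)) (\<lambda>t. (\<lambda>z. \<gamma> z t) ` x)"
proof -
  obtain e where e: "bij_betw e {..<card x} x"
    using ex_bij_betw_nat_finite[OF x] by (auto simp: atLeast0LessThan)
  let ?F = "\<lambda>t. restrict (\<lambda>i. \<gamma> (e i) t) {..<card x}"
  have "continuous_map (top_of_set T) (product_topology (\<lambda>_. euclidean) {..<card x}) ?F"
    unfolding continuous_map_componentwise
    using cont bij_betwE[OF e] by auto
  moreover have "inj_on (?F t) {..<card x}" if "t \<in> T" for t
  proof -
    have "inj_on (\<lambda>i. \<gamma> (e i) t) {..<card x}"
      using comp_inj_on[of e "{..<card x}" "\<lambda>z. \<gamma> z t"] e inj[OF that] by (simp add: bij_betw_def comp_def)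
    then show ?thesis by (simp add: inj_on_def)
  qed
  ultimately have F: "continuous_map (top_of_set T) (ordered_configurations (card x)) ?F"
    unfolding ordered_configurations_def continuous_map_in_subtopology by auto
  have "continuous_map (ordered_configurations (card x)) (configurations (card x)) (\<lambda>z. z ` {..<card x})"
    unfolding configurations_def by (rule quotient_imp_continuous_map[OF quotient_map_quotient_topology])
  from continuous_map_compose[OF F this] have
    "continuous_map (top_of_set T) (configurations (card x)) (\<lambda>t. ?F t ` {..<card x})"
    by (simp add: comp_def)
  moreover have "?F t ` {..<card x} = (\<lambda>z. \<gamma> z t) ` (e ` {..<card x})" for t
    by (simp add: image_image)
  then have "?F t ` {..<card x} = (\<lambda>z. \<gamma> z t) ` x" for t
    using bij_betw_imp_surj_on[OF e] by simp
  ultimately show ?thesis by simp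
qed

lemma strings_homotopic:
  fixes \<gamma> \<gamma>' :: "complex \<Rightarrow> real \<Rightarrow> complex"
  assumes x: "finite x" and cont: "\<And>z. z \<in> x \<Longrightarrow> continuous_on {0..1} (\<gamma> z)"
      "\<And>z. z \<in> x \<Longrightarrow> continuous_on {0..1} (\<gamma>' z)"
    and ends: "\<And>z. z \<in> x \<Longrightarrow> \<gamma> z 0 = \<gamma>' z 0" "\<And>z. z \<in> x \<Longrightarrow> \<gamma> z 1 = \<gamma>' z 1"
      "(\<lambda>z. \<gamma> z 0) ` x = x" "(\<lambda>z. \<gamma> z 1) ` x = x"
    and inj: "\<And>s t. s \<in> {0..1} \<Longrightarrow> t \<in> {0..1} \<Longrightarrow> inj_on (\<lambda>z. (1 - s) *\<^sub>R \<gamma> z t + s *\<^sub>R \<gamma>' z t) x"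
  shows "(\<lambda>t. (\<lambda>z. \<gamma> z t) ` x, \<lambda>t. (\<lambda>z. \<gamma>' z t) ` x) \<in> loop_homotopy (configurations (card x)) x"
proof -
  let ?H = "\<lambda>st. (\<lambda>z. (1 - fst st) *\<^sub>R \<gamma> z (snd st) + fst st *\<^sub>R \<gamma>' z (snd st)) ` x"
  have "continuous_map (top_of_set ({0..1} \<times> {0..1})) (configurations (card x)) ?H"
  proof (rule continuous_map_configurations[OF x])
    show "continuous_on ({0..1} \<times> {0..1}) (\<lambda>st. (1 - fst st) *\<^sub>R \<gamma> z (snd st) + fst st *\<^sub>R \<gamma>' z (snd st))"
      if "z \<in> x" for z
      by (intro continuous_intros continuous_on_compose2[OF cont(1)[OF that]]
          continuous_on_compose2[OF cont(2)[OF that]]) auto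
  qed (use inj in auto)
  moreover have "?H (s, 0) = x" "?H (s, 1) = x" for s
  proof -
    have "?H (s, 0) = (\<lambda>z. \<gamma> z 0) ` x" "?H (s, 1) = (\<lambda>z. \<gamma> z 1) ` x"
      using ends(1,2) by (auto intro!: image_cong simp flip: scaleR_add_left)
    then show "?H (s, 0) = x" "?H (s, 1) = x" using ends by simp_all
  qed
  moreover have "(\<lambda>z. \<gamma>' z 0) ` x = x" "(\<lambda>z. \<gamma>' z 1) ` x = x"
    using ends by (simp_all cong: image_cong)
  ultimately show ?thesis
    unfolding loop_homotopy_iff using ends(3,4) by (intro conjI exI[of _ ?H]) simp_all
qed

section \<open>Half twists\<close>

definition near_segment :: "real \<Rightarrow> complex \<Rightarrow> complex \<Rightarrow> complex \<Rightarrow> bool" where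
  "near_segment r a b p \<longleftrightarrow> (\<exists>q\<in>closed_segment a b. dist q p \<le> r)"

definition clear_segment :: "real \<Rightarrow> complex set \<Rightarrow> complex \<Rightarrow> complex \<Rightarrow> bool" where
  "clear_segment r x a b \<longleftrightarrow> (\<forall>w\<in>x - {a, b}. \<not> near_segment r a b w)"

definition pair_motion :: "complex set \<Rightarrow> complex \<Rightarrow> complex \<Rightarrow> (real \<Rightarrow> complex) \<Rightarrow> (real \<Rightarrow> complex) \<Rightarrow> real \<Rightarrow> complex set" where
  "pair_motion x a b A B t = (x - {a, b}) \<union> {A t, B t}"

text \<open>The last condition expresses that the pair turns counterclockwise by half a turn.\<close>

definition twisting :: "real \<Rightarrow> complex \<Rightarrow> complex \<Rightarrow> (real \<Rightarrow> complex) \<Rightarrow> (real \<Rightarrow> complex) \<Rightarrow> bool" where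
  "twisting r a b A B \<longleftrightarrow> continuous_on {0..1} A \<and> continuous_on {0..1} B \<and>
     A 0 = a \<and> A 1 = b \<and> B 0 = b \<and> B 1 = a \<and>
     (\<forall>t\<in>{0..1}. near_segment r a b (A t) \<and> near_segment r a b (B t)) \<and>
     (\<forall>t. 0 < t \<and> t < 1 \<longrightarrow> 0 < Im ((A t - B t) / (a - b)))"

lemma near_segment_convex:
  assumes "near_segment r a b p" "near_segment r a b p'" "0 \<le> s" "s \<le> 1"
  shows "near_segment r a b ((1 - s) *\<^sub>R p + s *\<^sub>R p')"
proof -
  obtain q q' where q: "q \<in> closed_segment a b" "dist q p \<le> r" "q' \<in> closed_segment a b" "dist q' p' \<le> r"
    using assms by (auto simp: near_segment_def)
  have "(1 - s) *\<^sub>R q + s *\<^sub>R q' - ((1 - s) *\<^sub>R p + s *\<^sub>R p') = (1 - s) *\<^sub>R (q - p) + s *\<^sub>R (q' - p')"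
    by (simp add: algebra_simps)
  then have "dist ((1 - s) *\<^sub>R q + s *\<^sub>R q') ((1 - s) *\<^sub>R p + s *\<^sub>R p') \<le> (1 - s) * dist q p + s * dist q' p'"
    using assms(3,4) norm_triangle_ineq[of "(1 - s) *\<^sub>R (q - p)" "s *\<^sub>R (q' - p')"]
    by (simp add: dist_norm)
  also have "\<dots> \<le> (1 - s) * r + s * r"
    using assms(3,4) q by (intro add_mono mult_left_mono) auto
  also have "\<dots> = r" by (simp add: algebra_simps)
  finally show ?thesis
    using convexD[OF convex_closed_segment q(1,3), of "1 - s" s] assms(3,4)
    by (auto simp: near_segment_def)
qed

lemma clear_segment_exists:
  assumes "finite x" "non_obstructing_pair x a b"
  obtains r where "r > 0" "clear_segment r x a b"
proof -
  have "closed_segment a b \<inter> (x - {a, b}) = {}"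
    using assms(2) by (auto simp: non_obstructing_pair_def)
  then obtain d where d: "d > 0" "\<And>p q. p \<in> closed_segment a b \<Longrightarrow> q \<in> x - {a, b} \<Longrightarrow> d \<le> dist p q"
    using separate_compact_closed[of "closed_segment a b" "x - {a, b}"] assms(1)
    by (auto simp: finite_imp_closed)
  have "clear_segment (d / 2) x a b"
    unfolding clear_segment_def near_segment_def
  proof (intro ballI notI, elim bexE)
    fix w q assume "w \<in> x - {a, b}" "q \<in> closed_segment a b" "dist q w \<le> d / 2"
    then show False using d(2)[of q w] d(1) by simp
  qed
  then show thesis using that[of "d / 2"] d(1) by simp
qed

lemma clear_segment_mono:
  assumes "clear_segment r x a b" "r' \<le> r" shows "clear_segment r' x a b"
  using assms unfolding clear_segment_def near_segment_def by (meson order_trans)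

lemma twisting_distinct:
  assumes "twisting r a b A B" "a \<noteq> b" "t \<in> {0..1}" shows "A t \<noteq> B t"
proof (cases "t = 0 \<or> t = 1")
  case True
  then show ?thesis using assms by (auto simp: twisting_def)
next
  case False
  then have "0 < Im ((A t - B t) / (a - b))" using assms by (auto simp: twisting_def)
  then show ?thesis by auto
qed

abbreviation pair_strings :: "complex \<Rightarrow> complex \<Rightarrow> (real \<Rightarrow> complex) \<Rightarrow> (real \<Rightarrow> complex) \<Rightarrow> complex \<Rightarrow> real \<Rightarrow> complex" where
  "pair_strings a b A B z t \<equiv> (if z = a then A t else if z = b then B t else z)"

lemma pair_strings_image:
  assumes "a \<in> x" "b \<in> x" "a \<noteq> b"
  shows "(\<lambda>z. pair_strings a b A B z t) ` x = pair_motion x a b A B t"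
  using assms by (auto simp: pair_motion_def image_iff)

lemma pair_strings_inj:
  assumes "clear_segment r x a b" "near_segment r a b (A t)" "near_segment r a b (B t)" "A t \<noteq> B t"
  shows "inj_on (\<lambda>z. pair_strings a b A B z t) x"
  using assms unfolding inj_on_def clear_segment_def by auto

text \<open>The conditions in \<open>twisting\<close> are convex. Under linear interpolation the
  positive imaginary part keeps the two moving points apart, and the tube around the segment keeps
  them away from the rest of \<open>x\<close>.\<close>

lemma twisting_homotopic:
  assumes x: "finite x" "a \<in> x" "b \<in> x" "a \<noteq> b" and clear: "clear_segment r x a b"
    and tw: "twisting r a b A B" "twisting r a b A' B'"
  shows "(pair_motion x a b A B, pair_motion x a b A' B') \<in> loop_homotopy (configurations (card x)) x"
proof -
  let ?C = "\<lambda>s t. (1 - s) *\<^sub>R A t + s *\<^sub>R A' t" and ?D = "\<lambda>s t. (1 - s) *\<^sub>R B t + s *\<^sub>R B' t"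
  note def = tw[unfolded twisting_def]
  have "(\<lambda>t. (\<lambda>z. pair_strings a b A B z t) ` x, \<lambda>t. (\<lambda>z. pair_strings a b A' B' z t) ` x)
    \<in> loop_homotopy (configurations (card x)) x"
  proof (rule strings_homotopic[OF x(1)])
    fix s t :: real assume st: "s \<in> {0..1}" "t \<in> {0..1}"
    have "?C s t \<noteq> ?D s t"
    proof (cases "t = 0 \<or> t = 1")
      case True
      then show ?thesis using def x(4) by (auto simp flip: scaleR_add_left)
    next
      case False
      then have "0 < Im ((A t - B t) / (a - b))" "0 < Im ((A' t - B' t) / (a - b))"
        using def st by auto
      then have "0 < (1 - s) * Im ((A t - B t) / (a - b)) + s * Im ((A' t - B' t) / (a - b))"
        using st by (cases "s = 0") (auto intro!: add_nonneg_pos)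
      also have "\<dots> = Im ((?C s t - ?D s t) / (a - b))"
      proof -
        have "(?C s t - ?D s t) / (a - b) = (1 - s) *\<^sub>R ((A t - B t) / (a - b)) + s *\<^sub>R ((A' t - B' t) / (a - b))"
          by (simp add: scaleR_conv_of_real divide_inverse algebra_simps)
        then show ?thesis by simp
      qed
      finally show ?thesis by auto
    qed
    then have "inj_on (\<lambda>z. pair_strings a b (?C s) (?D s) z t) x"
      using def st by (intro pair_strings_inj[OF clear] near_segment_convex) auto
    moreover have "pair_strings a b (?C s) (?D s) z t
      = (1 - s) *\<^sub>R pair_strings a b A B z t + s *\<^sub>R pair_strings a b A' B' z t" for z
      by (auto simp flip: scaleR_add_left)
    ultimately show "inj_on (\<lambda>z. (1 - s) *\<^sub>R pair_strings a b A B z t + s *\<^sub>R pair_strings a b A' B' z t) x"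
      by simp
  next
    fix z
    show "continuous_on {0..1} (\<lambda>t. pair_strings a b A B z t)"
      "continuous_on {0..1} (\<lambda>t. pair_strings a b A' B' z t)"
      using def by (cases "z = a"; cases "z = b"; simp)+
  qed (use def x in \<open>auto simp: image_iff\<close>)
  then show ?thesis by (simp only: pair_strings_image[OF x(2-4)])
qed

text \<open>The half turn follows an ellipse whose minor semi-axis is
  \<open>\<epsilon> * dist a b / 2\<close>, which explains the bound. The imaginary part required by
  \<open>twisting\<close> is \<open>\<epsilon> * sin (pi * t)\<close>.\<close>

lemma half_turn_twisting:
  assumes "a \<noteq> b" "0 < \<epsilon>" "\<epsilon> * dist a b \<le> 2 * r"
  shows "twisting r a b (half_turn a b \<epsilon>) (half_turn b a \<epsilon>)"
proof -
  have near: "near_segment r p q (half_turn p q \<epsilon> t)" if "\<epsilon> * dist p q \<le> 2 * r" for p q t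
  proof -
    let ?c = "(1 - cos (pi * t)) / 2"
    have "(p + q) / 2 + (p - q) / 2 * of_real (cos (pi * t)) = (1 - ?c) *\<^sub>R p + ?c *\<^sub>R q"
      by (simp add: scaleR_conv_of_real field_simps)
    moreover have "(1 - ?c) *\<^sub>R p + ?c *\<^sub>R q \<in> closed_segment p q"
      unfolding closed_segment_def using cos_le_one[of "pi * t"] cos_ge_minus_one[of "pi * t"]
      by (auto intro!: exI[of _ ?c])
    moreover have "dist ((p + q) / 2 + (p - q) / 2 * of_real (cos (pi * t))) (half_turn p q \<epsilon> t)
      = \<epsilon> * dist p q / 2 * \<bar>sin (pi * t)\<bar>"
      using assms(2) by (simp add: half_turn_def dist_norm norm_mult norm_divide)
    moreover have "\<epsilon> * dist p q / 2 * \<bar>sin (pi * t)\<bar> \<le> r * 1"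
    proof (rule mult_mono)
      have "0 \<le> \<epsilon> * dist p q" using assms(2) by simp
      then show "0 \<le> r" using that by linarith
    qed (use that abs_sin_le_one in auto)
    ultimately show ?thesis unfolding near_segment_def by force
  qed
  have "(half_turn a b \<epsilon> t - half_turn b a \<epsilon> t) = (a - b) * (of_real (cos (pi * t)) + \<i> * of_real (\<epsilon> * sin (pi * t)))" for t
    by (simp add: half_turn_def field_simps)
  then have Im: "Im ((half_turn a b \<epsilon> t - half_turn b a \<epsilon> t) / (a - b)) = \<epsilon> * sin (pi * t)" for t
    using assms(1) by simp
  have "near_segment r a b (half_turn b a \<epsilon> t)" for t
    using near[of b a t] assms(3) by (simp add: near_segment_def closed_segment_commute dist_commute)
  moreover have "continuous_on {0..1} (half_turn p q \<epsilon>)" for p q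
    unfolding half_turn_def by (intro continuous_intros)
  moreover have "half_turn p q \<epsilon> 0 = p" "half_turn p q \<epsilon> 1 = q" for p q
    by (simp_all add: half_turn_def field_simps)
  ultimately show ?thesis
    unfolding twisting_def Im using near[of a b] assms by (auto intro!: mult_pos_pos sin_gt_zero)
qed

abbreviation braid_class :: "complex set \<Rightarrow> (real \<Rightarrow> complex set) \<Rightarrow> braid" where
  "braid_class x p \<equiv> loop_class (configurations (card x)) x p"

text \<open>This replaces the description in \<open>half_twist\<close> by a usable criterion: any
  \<open>twisting\<close> motion within a clear tube represents the half twist. The loops of the
  definition lie in its class once \<open>\<epsilon> * dist a b <= 2 * r\<close>, and classes with a
  common member are equal.\<close>

lemma half_twist_eq:
  assumes x: "finite x" and ab: "non_obstructing_pair x a b" and r: "r > 0" "clear_segment r x a b"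
    and tw: "twisting r a b A B"
  shows "pair_motion x a b A B \<in> loops_at (configurations (card x)) x"
    and "half_twist x a b = braid_class x (pair_motion x a b A B)"
proof -
  have ab': "a \<in> x" "b \<in> x" "a \<noteq> b" using ab by (auto simp: non_obstructing_pair_def)
  let ?c = "braid_class x (pair_motion x a b A B)"
  have "half_twist_loop x a b \<epsilon> \<in> ?c" if "0 < \<epsilon>" "\<epsilon> * dist a b \<le> 2 * r" for \<epsilon>
  proof -
    have "half_twist_loop x a b \<epsilon> = pair_motion x a b (half_turn a b \<epsilon>) (half_turn b a \<epsilon>)"
      by (simp add: fun_eq_iff half_twist_loop_def pair_motion_def)
    then show ?thesis
      using twisting_homotopic[OF x ab' r(2) tw half_turn_twisting[OF ab'(3) that]] by simp
  qed
  moreover have "\<forall>\<^sub>F \<epsilon> in at_right 0. 0 < \<epsilon> \<and> \<epsilon> * dist a b \<le> 2 * r"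
    unfolding eventually_at_right_field
    using r ab'(3) by (intro exI[of _ "2 * r / dist a b"]) (auto simp: field_simps)
  ultimately have ev: "\<forall>\<^sub>F \<epsilon> in at_right 0. half_twist_loop x a b \<epsilon> \<in> ?c"
    by (auto elim: eventually_mono)
  show loop: "pair_motion x a b A B \<in> loops_at (configurations (card x)) x"
    using loop_homotopy_loops[OF twisting_homotopic[OF x ab' r(2) tw tw]] by simp
  show "half_twist x a b = ?c"
    unfolding half_twist_def
  proof (rule the_equality)
    show "?c \<in> carrier (braid_group x) \<and> (\<forall>\<^sub>F \<epsilon> in at_right 0. half_twist_loop x a b \<epsilon> \<in> ?c)"
      unfolding braid_group_def using loop_class_in[OF loop] ev by blast
    fix c assume c: "c \<in> carrier (braid_group x) \<and> (\<forall>\<^sub>F \<epsilon> in at_right 0. half_twist_loop x a b \<epsilon> \<in> c)"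
    then have "\<forall>\<^sub>F \<epsilon> in at_right (0::real). half_twist_loop x a b \<epsilon> \<in> c \<and> half_twist_loop x a b \<epsilon> \<in> ?c"
      using ev eventually_conj by blast
    then obtain \<epsilon> where e: "half_twist_loop x a b \<epsilon> \<in> c" "half_twist_loop x a b \<epsilon> \<in> ?c"
      using eventually_happens[of _ "at_right (0::real)"] by auto
    obtain p where "p \<in> loops_at (configurations (card x)) x" "c = braid_class x p"
      using c fundamental_group_elem unfolding braid_group_def by metis
    then show "c = ?c"
      using e loop_class_eqI by (metis Image_singleton_iff)
  qed
qed

lemma half_twist_class:
  assumes "finite x" "non_obstructing_pair x a b"
  obtains r where "r > 0" "\<And>A B. twisting r a b A B \<Longrightarrow>
    pair_motion x a b A B \<in> loops_at (configurations (card x)) x \<and>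
    half_twist x a b = braid_class x (pair_motion x a b A B)"
proof -
  obtain r where r: "r > 0" "clear_segment r x a b" using clear_segment_exists[OF assms] .
  show thesis using that[OF r(1)] half_twist_eq[OF assms r] by blast
qed

lemma half_twist_loop_class:
  assumes "finite x" "non_obstructing_pair x a b"
  obtains \<epsilon>0 where "\<epsilon>0 > 0" "\<And>\<epsilon>. 0 < \<epsilon> \<Longrightarrow> \<epsilon> < \<epsilon>0 \<Longrightarrow>
    half_twist_loop x a b \<epsilon> \<in> loops_at (configurations (card x)) x \<and>
    half_twist x a b = braid_class x (half_twist_loop x a b \<epsilon>)"
proof -
  obtain r where r: "r > 0" "\<And>A B. twisting r a b A B \<Longrightarrow>
    pair_motion x a b A B \<in> loops_at (configurations (card x)) x \<and>
    half_twist x a b = braid_class x (pair_motion x a b A B)" by (rule half_twist_class[OF assms]) blast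
  have ab: "a \<noteq> b" using assms by (auto simp: non_obstructing_pair_def)
  have *: "half_twist_loop x a b \<epsilon> = pair_motion x a b (half_turn a b \<epsilon>) (half_turn b a \<epsilon>)" for \<epsilon>
    by (simp add: fun_eq_iff half_twist_loop_def pair_motion_def)
  show thesis
  proof (rule that)
    show "2 * r / dist a b > 0" using r(1) ab by simp
    fix \<epsilon> assume "0 < \<epsilon>" "\<epsilon> < 2 * r / dist a b"
    then have "twisting r a b (half_turn a b \<epsilon>) (half_turn b a \<epsilon>)"
      using ab by (intro half_turn_twisting) (auto simp: field_simps)
    then show "half_twist_loop x a b \<epsilon> \<in> loops_at (configurations (card x)) x \<and>
      half_twist x a b = braid_class x (half_twist_loop x a b \<epsilon>)"
      unfolding * by (rule r(2))
  qed
qed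

lemma half_twist_in:
  assumes "finite x" "non_obstructing_pair x a b"
  shows "half_twist x a b \<in> carrier (braid_group x)"
proof -
  obtain \<epsilon>0 where e: "\<epsilon>0 > 0" "\<And>\<epsilon>. 0 < \<epsilon> \<Longrightarrow> \<epsilon> < \<epsilon>0 \<Longrightarrow>
    half_twist_loop x a b \<epsilon> \<in> loops_at (configurations (card x)) x \<and>
    half_twist x a b = braid_class x (half_twist_loop x a b \<epsilon>)"
    by (rule half_twist_loop_class[OF assms]) blast
  from e(2)[of "\<epsilon>0 / 2"] e(1) show ?thesis
    unfolding braid_group_def using loop_class_in by (metis field_sum_of_halves half_gt_zero less_add_same_cancel1)
qed

lemma half_twist_commute: "half_twist x a b = half_twist x b a"
proof -
  have "half_twist_loop x a b = half_twist_loop x b a"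
    by (intro ext) (simp add: half_twist_loop_def insert_commute)
  then show ?thesis by (simp add: half_twist_def)
qed

lemma braid_group_mult:
  assumes "p \<in> loops_at (configurations (card x)) x" "q \<in> loops_at (configurations (card x)) x"
  shows "braid_class x p \<otimes>\<^bsub>braid_group x\<^esub> braid_class x q = braid_class x (join_loops p q)"
  unfolding braid_group_def by (rule fundamental_group_mult[OF assms])

lemma monoid_braid_group: "finite x \<Longrightarrow> monoid (braid_group x)"
  unfolding braid_group_def
  by (rule monoid_fundamental_group) (simp add: topspace_configurations)

section \<open>Relations between half twists\<close>

lemma near_segments_disjoint:
  assumes "closed_segment a b \<inter> closed_segment c d = {}"
  obtains r where "r > 0" "\<And>p. near_segment r a b p \<Longrightarrow> \<not> near_segment r c d p"
proof -
  obtain e where e: "e > 0" "\<And>p q. p \<in> closed_segment a b \<Longrightarrow> q \<in> closed_segment c d \<Longrightarrow> e \<le> dist p q"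
    using separate_compact_closed[of "closed_segment a b" "closed_segment c d"] assms by auto
  show thesis
  proof (rule that)
    show "e / 3 > 0" using e by simp
    fix p assume "near_segment (e / 3) a b p"
    then obtain q where q: "q \<in> closed_segment a b" "dist q p \<le> e / 3" by (auto simp: near_segment_def)
    show "\<not> near_segment (e / 3) c d p"
    proof
      assume "near_segment (e / 3) c d p"
      then obtain q' where "q' \<in> closed_segment c d" "dist q' p \<le> e / 3" by (auto simp: near_segment_def)
      then show False using e(1) e(2)[OF q(1)] q(2) dist_triangle2[of q q' p] by fastforce
    qed
  qed
qed

text \<open>Both products are images of paths with the same ends in the square whose sides
  parametrize the two half turns.\<close>

lemma half_twist_disjoint:
  assumes x: "finite x" and ab: "non_obstructing_pair x a b" and cd: "non_obstructing_pair x c d"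
    and disj: "closed_segment a b \<inter> closed_segment c d = {}"
  shows "half_twist x a b \<otimes>\<^bsub>braid_group x\<^esub> half_twist x c d = half_twist x c d \<otimes>\<^bsub>braid_group x\<^esub> half_twist x a b"
proof -
  have in_x: "a \<in> x" "b \<in> x" "c \<in> x" "d \<in> x" "a \<noteq> b" "c \<noteq> d"
    using ab cd by (auto simp: non_obstructing_pair_def)
  have "{a, b} \<inter> {c, d} = {}" using disj by auto
  then have ne: "a \<noteq> c" "a \<noteq> d" "b \<noteq> c" "b \<noteq> d" by auto
  obtain r1 where r1: "r1 > 0" "clear_segment r1 x a b" using clear_segment_exists[OF x ab] .
  obtain r2 where r2: "r2 > 0" "clear_segment r2 x c d" using clear_segment_exists[OF x cd] .
  obtain r3 where r3: "r3 > 0" "\<And>p. near_segment r3 a b p \<Longrightarrow> \<not> near_segment r3 c d p"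
    using near_segments_disjoint[OF disj] by blast
  define r where "r = Min {r1, r2, r3}"
  have r: "r > 0" "r \<le> r1" "r \<le> r2" "r \<le> r3" using r1 r2 r3 by (auto simp: r_def)
  have clear: "clear_segment r x a b" "clear_segment r x c d"
    using r r1 r2 clear_segment_mono by blast+
  have near: "\<not> near_segment r c d p" if "near_segment r a b p" for p
    using r3(2)[of p] that r(4) unfolding near_segment_def by (meson order_trans)
  obtain A B where A: "twisting r a b A B"
    using half_turn_twisting[of a b "2 * r / dist a b" r] r in_x by auto
  obtain C D where C: "twisting r c d C D"
    using half_turn_twisting[of c d "2 * r / dist c d" r] r in_x by auto
  note defs = A[unfolded twisting_def] C[unfolded twisting_def]
  let ?\<gamma> = "\<lambda>z st. if z = a then A (fst st) else if z = b then B (fst st)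
     else if z = c then C (snd st) else if z = d then D (snd st) else z"
  let ?\<Psi> = "\<lambda>st. (\<lambda>z. ?\<gamma> z st) ` x"
  have \<Psi>: "continuous_map (top_of_set ({0..1} \<times> {0..1})) (configurations (card x)) ?\<Psi>"
  proof (rule continuous_map_configurations[OF x])
    show "continuous_on ({0..1} \<times> {0..1}) (?\<gamma> z)" for z
    proof -
      have "continuous_on ({0..1} \<times> {0..1}) (\<lambda>st. F (fst st))"
        "continuous_on ({0..1} \<times> {0..1}) (\<lambda>st. F (snd st))"
        if "continuous_on {0..1} F" for F :: "real \<Rightarrow> complex"
        by (rule continuous_on_compose2[OF that]; auto intro!: continuous_intros)+
      then have "continuous_on ({0..1} \<times> {0..1}) (\<lambda>st. A (fst st))"
        "continuous_on ({0..1} \<times> {0..1}) (\<lambda>st. B (fst st))"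
        "continuous_on ({0..1} \<times> {0..1}) (\<lambda>st. C (snd st))"
        "continuous_on ({0..1} \<times> {0..1}) (\<lambda>st. D (snd st))"
        using defs by blast+
      then show ?thesis
        by (cases "z = a"; cases "z = b"; cases "z = c"; cases "z = d"; simp)
    qed
    fix st :: "real \<times> real" assume st: "st \<in> {0..1} \<times> {0..1}"
    then have n: "near_segment r a b (A (fst st))" "near_segment r a b (B (fst st))"
      "near_segment r c d (C (snd st))" "near_segment r c d (D (snd st))"
      using defs by auto
    have d: "A (fst st) \<noteq> B (fst st)" "C (snd st) \<noteq> D (snd st)"
      using twisting_distinct[OF A] twisting_distinct[OF C] in_x st by auto
    have o: "\<not> near_segment r a b z" "\<not> near_segment r c d z" if "z \<in> x" "z \<notin> {a, b, c, d}" for z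
      using clear that by (auto simp: clear_segment_def)
    have "A (fst st) \<noteq> C (snd st)" "A (fst st) \<noteq> D (snd st)" "B (fst st) \<noteq> C (snd st)" "B (fst st) \<noteq> D (snd st)"
      using n near by metis+
    moreover have "z \<notin> {A (fst st), B (fst st), C (snd st), D (snd st)}" if "z \<in> x" "z \<notin> {a, b, c, d}" for z
      using n o[OF that] by blast
    ultimately show "inj_on (\<lambda>z. ?\<gamma> z st) x"
      using d ne in_x(5,6) unfolding inj_on_def by (auto split: if_splits)
  qed
  have img: "?\<Psi> st = (x - {a, b, c, d}) \<union> {A (fst st), B (fst st), C (snd st), D (snd st)}" for st
  proof -
    have "x = (x - {a, b, c, d}) \<union> {a, b, c, d}" using in_x by blast
    then have "?\<Psi> st = (\<lambda>z. ?\<gamma> z st) ` (x - {a, b, c, d}) \<union> (\<lambda>z. ?\<gamma> z st) ` {a, b, c, d}"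
      by (metis image_Un)
    moreover have "(\<lambda>z. ?\<gamma> z st) ` (x - {a, b, c, d}) = x - {a, b, c, d}" by auto
    moreover have "(\<lambda>z. ?\<gamma> z st) ` {a, b, c, d} = {A (fst st), B (fst st), C (snd st), D (snd st)}"
      using ne in_x(5,6) by (simp add: insert_commute)
    ultimately show ?thesis by (simp only:)
  qed
  define \<Psi> where "\<Psi> st = (x - {a, b, c, d}) \<union> {A (fst st), B (fst st), C (snd st), D (snd st)}" for st
  have "\<Psi> (s, 0) = pair_motion x a b A B s" "\<Psi> (0, s) = pair_motion x c d C D s"
    "\<Psi> (s, 1) = pair_motion x a b A B s" "\<Psi> (1, s) = pair_motion x c d C D s" for s
    using defs in_x ne by (auto simp: \<Psi>_def pair_motion_def)
  then have join: "join_loops (pair_motion x a b A B) (pair_motion x c d C D) t = \<Psi> (min 1 (2 * t), max 0 (2 * t - 1))"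
      "join_loops (pair_motion x c d C D) (pair_motion x a b A B) t = \<Psi> (max 0 (2 * t - 1), min 1 (2 * t))" for t
    by (simp_all add: join_loops_def join_parameters)
  have "(\<lambda>t. \<Psi> (min 1 (2 * t), max 0 (2 * t - 1)), \<lambda>t. \<Psi> (max 0 (2 * t - 1), min 1 (2 * t)))
    \<in> loop_homotopy (configurations (card x)) x"
  proof (rule loop_homotopy_convex)
    show "continuous_map (top_of_set ({0..1} \<times> {0..1})) (configurations (card x)) \<Psi>"
      using \<Psi> unfolding img \<Psi>_def .
    show "\<Psi> (min 1 (2 * 0), max 0 (2 * 0 - 1)) = x" "\<Psi> (min 1 (2 * 1), max 0 (2 * 1 - 1)) = x"
      using defs in_x by (auto simp: \<Psi>_def)
  qed (auto intro!: continuous_intros convex_Times)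
  then have "(join_loops (pair_motion x a b A B) (pair_motion x c d C D),
      join_loops (pair_motion x c d C D) (pair_motion x a b A B)) \<in> loop_homotopy (configurations (card x)) x"
    by (simp only: join flip: join)
  then show ?thesis
    using half_twist_eq[OF x ab r(1) clear(1) A] half_twist_eq[OF x cd r(1) clear(2) C]
    by (simp add: braid_group_mult loop_class_eqI)
qed

text \<open>The determinant of \<open>u\<close> and \<open>v\<close>, so that
  \<open>cross (b - a) (c - a)\<close> is twice the signed area of the triangle \<open>a\<close>,
  \<open>b\<close>, \<open>c\<close>, negative if it is run through clockwise.\<close>

abbreviation cross :: "complex \<Rightarrow> complex \<Rightarrow> real" where
  "cross u v \<equiv> Im (cnj u * v)"

lemma Im_divide_pos: "v \<noteq> 0 \<Longrightarrow> 0 < cross v u \<Longrightarrow> 0 < Im (u / v)"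
proof -
  assume *: "v \<noteq> 0" "0 < cross v u"
  have "Im (u / v) = cross v u / ((Re v)\<^sup>2 + (Im v)\<^sup>2)"
    by (simp add: Im_divide algebra_simps)
  moreover have "0 < (Re v)\<^sup>2 + (Im v)\<^sup>2"
    using *(1) by (auto simp: sum_power2_gt_zero_iff complex_eq_iff)
  ultimately show ?thesis using *(2) by (simp only: divide_pos_pos)
qed

text \<open>A twisting in which only the string from \<open>a\<close> leaves the segment, with a
  bulge along any \<open>v\<close> on the correct side. The freedom in \<open>v\<close> is used to
  keep a motion inside a triangle, and later to control when two points share a vertical
  line.\<close>

lemma arc_twisting:
  assumes "a \<noteq> b" "0 < cross (a - b) v" "norm v \<le> r"
  shows "twisting r a b (\<lambda>t. (1 - t) *\<^sub>R a + t *\<^sub>R b + (t * (1 - t)) *\<^sub>R v) (\<lambda>t. (1 - t) *\<^sub>R b + t *\<^sub>R a)"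
proof -
  let ?A = "\<lambda>t. (1 - t) *\<^sub>R a + t *\<^sub>R b + (t * (1 - t)) *\<^sub>R v" and ?B = "\<lambda>t. (1 - t) *\<^sub>R b + t *\<^sub>R a"
  have "near_segment r a b (?A t)" "near_segment r a b (?B t)" if t: "t \<in> {0..1}" for t :: real
  proof -
    have seg: "(1 - u) *\<^sub>R p + u *\<^sub>R q \<in> closed_segment p q" if "u \<in> {0..1}" for u and p q :: complex
      unfolding closed_segment_def using that by auto
    have seg: "(1 - t) *\<^sub>R a + t *\<^sub>R b \<in> closed_segment a b" "?B t \<in> closed_segment a b"
      using seg[OF t, of a b] seg[OF t, of b a] by (simp_all add: closed_segment_commute)
    have "0 \<le> t * (1 - t)" using t by simp
    moreover have "t * (1 - t) \<le> 1 * 1" using t by (intro mult_mono) auto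
    ultimately have "norm ((t * (1 - t)) *\<^sub>R v) \<le> norm v"
      using mult_right_mono[of "t * (1 - t)" 1 "norm v"] by simp
    then show "near_segment r a b (?A t)"
      unfolding near_segment_def using seg(1) assms(3) by (intro bexI[OF _ seg(1)]) (simp add: dist_norm)
    show "near_segment r a b (?B t)"
      unfolding near_segment_def using seg(2) order_trans[OF norm_ge_zero assms(3)] by (intro bexI[OF _ seg(2)]) simp
  qed
  moreover have "0 < Im ((?A t - ?B t) / (a - b))" if "0 < t" "t < 1" for t :: real
  proof -
    have eq: "?A t - ?B t = of_real (1 - 2 * t) * (a - b) + of_real (t * (1 - t)) * v"
      by (simp add: scaleR_conv_of_real algebra_simps)
    have "(?A t - ?B t) / (a - b) = of_real (1 - 2 * t) + (t * (1 - t)) *\<^sub>R (v / (a - b))"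
      unfolding eq add_divide_distrib using assms(1) by (simp add: scaleR_conv_of_real)
    then have "Im ((?A t - ?B t) / (a - b)) = t * (1 - t) * Im (v / (a - b))" by simp
    moreover have "0 < Im (v / (a - b))" using assms by (intro Im_divide_pos) auto
    ultimately show ?thesis using that by simp
  qed
  ultimately show ?thesis
    unfolding twisting_def by (auto intro!: continuous_intros)
qed

text \<open>The point with barycentric weights \<open>\<alpha>\<close> at \<open>a\<close> and
  \<open>\<gamma>\<close> at \<open>c\<close>, the rest being at \<open>b\<close>.\<close>

definition bary :: "complex \<Rightarrow> complex \<Rightarrow> complex \<Rightarrow> real \<Rightarrow> real \<Rightarrow> complex" where
  "bary a b c \<alpha> \<gamma> = b + \<alpha> *\<^sub>R (a - b) + \<gamma> *\<^sub>R (c - b)"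

lemma bary_eq_iff:
  assumes "cross (b - a) (c - a) \<noteq> 0"
  shows "bary a b c \<alpha> \<gamma> = bary a b c \<alpha>' \<gamma>' \<longleftrightarrow> \<alpha> = \<alpha>' \<and> \<gamma> = \<gamma>'"
proof
  assume "bary a b c \<alpha> \<gamma> = bary a b c \<alpha>' \<gamma>'"
  then have *: "(\<alpha> - \<alpha>') *\<^sub>R (a - b) + (\<gamma> - \<gamma>') *\<^sub>R (c - b) = 0"
    by (simp add: bary_def algebra_simps)
  have "cross (b - a) ((\<alpha> - \<alpha>') *\<^sub>R (a - b) + (\<gamma> - \<gamma>') *\<^sub>R (c - b)) = (\<gamma> - \<gamma>') * cross (b - a) (c - a)"
    by (simp add: algebra_simps)
  moreover have "cross (c - b) ((\<alpha> - \<alpha>') *\<^sub>R (a - b) + (\<gamma> - \<gamma>') *\<^sub>R (c - b)) = (\<alpha> - \<alpha>') * cross (b - a) (c - a)"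
    by (simp add: algebra_simps)
  ultimately show "\<alpha> = \<alpha>' \<and> \<gamma> = \<gamma>'" using assms unfolding * by simp
qed simp

lemma bary_in_hull:
  assumes "0 \<le> \<alpha>" "0 \<le> \<gamma>" "\<alpha> + \<gamma> \<le> 1"
  shows "bary a b c \<alpha> \<gamma> \<in> convex hull {a, b, c}"
proof -
  have "bary a b c \<alpha> \<gamma> = \<alpha> *\<^sub>R a + (1 - \<alpha> - \<gamma>) *\<^sub>R b + \<gamma> *\<^sub>R c"
    by (simp add: bary_def algebra_simps)
  then show ?thesis
    unfolding convex_hull_3 mem_Collect_eq using assms
    by (intro exI[of _ \<alpha>] exI[of _ "1 - \<alpha> - \<gamma>"] exI[of _ \<gamma>]) simp
qed

lemma bary_convex:
  "(1 - s) *\<^sub>R bary a b c \<alpha> \<gamma> + s *\<^sub>R bary a b c \<alpha>' \<gamma>' = bary a b c ((1 - s) * \<alpha> + s * \<alpha>') ((1 - s) * \<gamma> + s * \<gamma>')"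
  by (simp add: bary_def algebra_simps)

definition triangle_rotation :: "complex set \<Rightarrow> complex \<Rightarrow> complex \<Rightarrow> complex \<Rightarrow> real \<Rightarrow> complex set" where
  "triangle_rotation x a b c t =
     (x - {a, b, c}) \<union> {(1 - t) *\<^sub>R a + t *\<^sub>R c, (1 - t) *\<^sub>R b + t *\<^sub>R a, (1 - t) *\<^sub>R c + t *\<^sub>R b}"

text \<open>After the bulges of the two half turns have been pushed into the triangle, the product
  moves \<open>a\<close> to \<open>c\<close> along a curve inside the triangle passing through \<open>b\<close>, while the other two
  points move along edges. A straight homotopy replaces that curve by the edge from \<open>a\<close> to \<open>c\<close>.\<close>

lemma half_twist_triangle:
  assumes x: "finite x" "a \<in> x" "b \<in> x" "c \<in> x" and cw: "cross (b - a) (c - a) < 0"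
    and ab: "non_obstructing_pair x a b" and bc: "non_obstructing_pair x b c"
    and out: "\<And>w. w \<in> x - {a, b, c} \<Longrightarrow> w \<notin> convex hull {a, b, c}"
  shows "half_twist x a b \<otimes>\<^bsub>braid_group x\<^esub> half_twist x b c = braid_class x (triangle_rotation x a b c)"
proof -
  have ne: "a \<noteq> b" "b \<noteq> c" "a \<noteq> c" using cw by (auto simp: algebra_simps)
  obtain r1 where r1: "r1 > 0" "clear_segment r1 x a b" using clear_segment_exists[OF x(1) ab] .
  obtain r2 where r2: "r2 > 0" "clear_segment r2 x b c" using clear_segment_exists[OF x(1) bc] .
  \<comment> \<open>The bulges along \<open>c - a\<close> and \<open>a - b\<close> point into the
    triangle. The factor \<open>\<eta>\<close> shrinks them into the tubes of radius
    \<open>r1\<close> and \<open>r2\<close>, and \<open>\<eta> < 1\<close> keeps the weights below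
    nonnegative.\<close>
  define m where "m = norm (c - a) + norm (a - b)"
  have m: "m > 0" using ne by (simp add: m_def add_pos_pos)
  define \<eta> where "\<eta> = Min {1/2, r1 / m, r2 / m}"
  have \<eta>: "0 < \<eta>" "\<eta> < 1" "\<eta> \<le> r1 / m" "\<eta> \<le> r2 / m" using r1 r2 m by (auto simp: \<eta>_def min_less_iff_disj)
  have "\<eta> * m \<le> r1" "\<eta> * m \<le> r2" using \<eta> m by (simp_all add: pos_le_divide_eq)
  moreover have "\<eta> * norm (c - a) \<le> \<eta> * m" "\<eta> * norm (a - b) \<le> \<eta> * m"
    using \<eta> by (auto simp: m_def intro!: mult_left_mono)
  ultimately have small: "norm (\<eta> *\<^sub>R (c - a)) \<le> r1" "norm (\<eta> *\<^sub>R (a - b)) \<le> r2"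
    using \<eta> by (simp_all only: norm_scaleR abs_of_pos)
  let ?p = "bary a b c"
  let ?A1 = "\<lambda>t. (1 - t) *\<^sub>R a + t *\<^sub>R b + (t * (1 - t)) *\<^sub>R (\<eta> *\<^sub>R (c - a))" and ?B1 = "\<lambda>t. (1 - t) *\<^sub>R b + t *\<^sub>R a"
  let ?A2 = "\<lambda>t. (1 - t) *\<^sub>R b + t *\<^sub>R c + (t * (1 - t)) *\<^sub>R (\<eta> *\<^sub>R (a - b))" and ?C2 = "\<lambda>t. (1 - t) *\<^sub>R c + t *\<^sub>R b"
  have tw1: "twisting r1 a b ?A1 ?B1"
  proof (rule arc_twisting[OF ne(1) _ small(1)])
    have "cross (a - b) (\<eta> *\<^sub>R (c - a)) = - (\<eta> * cross (b - a) (c - a))" by (simp add: algebra_simps)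
    then show "0 < cross (a - b) (\<eta> *\<^sub>R (c - a))" using cw \<eta>(1) by (simp add: mult_pos_neg)
  qed
  have tw2: "twisting r2 b c ?A2 ?C2"
  proof (rule arc_twisting[OF ne(2) _ small(2)])
    have "cross (b - c) (\<eta> *\<^sub>R (a - b)) = - (\<eta> * cross (b - a) (c - a))" by (simp add: algebra_simps)
    then show "0 < cross (b - c) (\<eta> *\<^sub>R (a - b))" using cw \<eta>(1) by (simp add: mult_pos_neg)
  qed
  note loop1 = half_twist_eq[OF x(1) ab r1 tw1] and loop2 = half_twist_eq[OF x(1) bc r2 tw2]
  \<comment> \<open>The clocks of the two half turns; each stands still while the other
    runs.\<close>
  define \<tau>1 where "\<tau>1 t = min 1 (2 * t)" for t :: real
  define \<tau>2 where "\<tau>2 t = max 0 (2 * t - 1)" for t :: real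
  \<comment> \<open>The weights of the string from \<open>a\<close>, in one formula for both halves:
    for \<open>\<tau>2 t = 0\<close> it is the arc from \<open>a\<close> to \<open>b\<close>, for
    \<open>\<tau>1 t = 1\<close> the arc from \<open>b\<close> to \<open>c\<close>.\<close>
  define wa where "wa t = (1 - \<tau>1 t) * (1 - \<eta> * \<tau>1 t) + \<eta> * \<tau>2 t * (1 - \<tau>2 t)" for t
  define wc where "wc t = \<eta> * \<tau>1 t * (1 - \<tau>1 t) + \<tau>2 t" for t
  let ?\<gamma> = "\<lambda>z t. if z = a then ?p (wa t) (wc t) else if z = b then ?p (\<tau>1 t) 0 else if z = c then ?p 0 (1 - \<tau>2 t) else z"
  let ?\<rho> = "\<lambda>z t. if z = a then ?p (1 - t) t else if z = b then ?p t 0 else if z = c then ?p 0 (1 - t) else z"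
  have img: "(\<lambda>z. if z = a then P else if z = b then Q else if z = c then R else z) ` x = (x - {a, b, c}) \<union> {P, Q, R}" for P Q R
    using ne x by (auto simp: image_iff)
  have 1: "join_loops (pair_motion x a b ?A1 ?B1) (pair_motion x b c ?A2 ?C2) t = (\<lambda>z. ?\<gamma> z t) ` x" for t
  proof (cases "t \<le> 1/2")
    case True
    then have "\<tau>1 t = 2 * t" "\<tau>2 t = 0" by (auto simp: \<tau>1_def \<tau>2_def join_parameters)
    moreover have "?A1 (2 * t) = ?p ((1 - 2 * t) * (1 - \<eta> * (2 * t))) (\<eta> * (2 * t) * (1 - 2 * t))" "?B1 (2 * t) = ?p (2 * t) 0" "c = ?p 0 1"
      by (simp_all add: bary_def algebra_simps)
    moreover have "pair_motion x a b ?A1 ?B1 (2 * t) = (x - {a, b, c}) \<union> {?A1 (2 * t), ?B1 (2 * t), c}"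
      using x ne by (auto simp: pair_motion_def)
    ultimately show ?thesis using True unfolding img by (simp add: join_loops_def wa_def wc_def)
  next
    case False
    then have "\<tau>1 t = 1" "\<tau>2 t = 2 * t - 1" by (auto simp: \<tau>1_def \<tau>2_def join_parameters)
    moreover have "?A2 s = ?p (\<eta> * s * (1 - s)) s \<and> ?C2 s = ?p 0 (1 - s) \<and> a = ?p 1 0" for s
      by (simp add: bary_def algebra_simps)
    note this[of "2 * t - 1"]
    moreover have "pair_motion x b c ?A2 ?C2 (2 * t - 1) = (x - {a, b, c}) \<union> {?A2 (2 * t - 1), a, ?C2 (2 * t - 1)}"
      using x ne by (auto simp: pair_motion_def)
    ultimately show ?thesis using False unfolding img by (simp add: join_loops_def wa_def wc_def)
  qed
  have 2: "triangle_rotation x a b c t = (\<lambda>z. ?\<rho> z t) ` x" for t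
    unfolding img triangle_rotation_def by (simp add: bary_def algebra_simps)
  have "(\<lambda>t. (\<lambda>z. ?\<gamma> z t) ` x, \<lambda>t. (\<lambda>z. ?\<rho> z t) ` x) \<in> loop_homotopy (configurations (card x)) x"
  proof (rule strings_homotopic[OF x(1)])
    have cont: "continuous_on {0..1} (\<lambda>t. ?p (f t) (g t))"
      if "continuous_on {0..1} f" "continuous_on {0..1} g" for f g :: "real \<Rightarrow> real"
      unfolding bary_def by (intro continuous_intros that)
    have "continuous_on {0..1} \<tau>1" "continuous_on {0..1} \<tau>2"
      unfolding \<tau>1_def \<tau>2_def by (intro continuous_intros)+
    then have "continuous_on {0..1} wa" "continuous_on {0..1} wc" "continuous_on {0..1} (\<lambda>t. 1 - \<tau>2 t)" "continuous_on {0..1} \<tau>1"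
      unfolding wa_def wc_def by (auto intro!: continuous_intros)
    then show "continuous_on {0..1} (?\<gamma> z)" for z
      using ne by (cases "z = a"; cases "z = b"; cases "z = c"; simp add: cont)
    show "continuous_on {0..1} (?\<rho> z)" for z
      using ne by (cases "z = a"; cases "z = b"; cases "z = c"; simp add: cont continuous_intros)
    have ends: "\<tau>1 0 = 0" "\<tau>2 0 = 0" "\<tau>1 1 = 1" "\<tau>2 1 = 1" by (auto simp: \<tau>1_def \<tau>2_def)
    show "?\<gamma> z 0 = ?\<rho> z 0" "?\<gamma> z 1 = ?\<rho> z 1" for z by (simp_all add: ends wa_def wc_def)
    show "(\<lambda>z. ?\<gamma> z 0) ` x = x" "(\<lambda>z. ?\<gamma> z 1) ` x = x"
      unfolding img using x by (auto simp: ends wa_def wc_def bary_def)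
    fix s t :: real assume st: "s \<in> {0..1}" "t \<in> {0..1}"
    define \<alpha> where "\<alpha> = (1 - s) * wa t + s * (1 - t)"
    define \<gamma> where "\<gamma> = (1 - s) * wc t + s * t"
    define \<beta> where "\<beta> = (1 - s) * \<tau>1 t + s * t"
    define \<kappa> where "\<kappa> = (1 - s) * (1 - \<tau>2 t) + s * (1 - t)"
    have \<tau>: "0 \<le> \<tau>1 t" "\<tau>1 t \<le> 1" "0 \<le> \<tau>2 t" "\<tau>2 t \<le> 1" using st by (auto simp: \<tau>1_def \<tau>2_def)
    have half: "t \<le> 1/2 \<Longrightarrow> \<tau>1 t = 2 * t \<and> \<tau>2 t = 0" "\<not> t \<le> 1/2 \<Longrightarrow> \<tau>1 t = 1 \<and> \<tau>2 t = 2 * t - 1"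
      by (auto simp: \<tau>1_def \<tau>2_def join_parameters)
    have \<eta>\<tau>: "\<eta> * u < 1" if "u \<le> 1" "0 \<le> u" for u
      using mult_left_le[OF that(1), of \<eta>] \<eta>(1,2) by linarith
    have w: "0 \<le> wa t" "0 \<le> wc t" "wa t + wc t \<le> 1"
    proof -
      show "0 \<le> wa t" "0 \<le> wc t"
        using \<tau> \<eta> \<eta>\<tau>[of "\<tau>1 t"] by (simp_all add: wa_def wc_def)
      show "wa t + wc t \<le> 1"
      proof (cases "t \<le> 1/2")
        case True
        then have "wa t + wc t = 1 - \<tau>1 t" using half(1) by (simp add: wa_def wc_def algebra_simps)
        then show ?thesis using \<tau> by simp
      next
        case False
        then have "wa t + wc t = 1 - (1 - \<tau>2 t) * (1 - \<eta> * \<tau>2 t)" using half(2) by (simp add: wa_def wc_def algebra_simps)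
        then show ?thesis using \<tau> \<eta>\<tau>[of "\<tau>2 t"] by simp
      qed
    qed
    have wa_pos: "0 < wa t" if "t \<noteq> 1/2" "t < 1"
    proof (cases "t \<le> 1/2")
      case True
      then show ?thesis using half(1) that st \<eta>\<tau>[of "2 * t"] by (simp add: wa_def)
    next
      case False
      then show ?thesis using half(2) that \<eta> by (simp add: wa_def)
    qed
    have wc_pos: "0 < wc t" if "t \<noteq> 1/2" "0 < t"
    proof (cases "t \<le> 1/2")
      case True
      then show ?thesis using half(1) that \<eta> by (simp add: wc_def)
    next
      case False
      then show ?thesis using half(2) by (simp add: wc_def)
    qed
    have mid: "t = 1/2 \<Longrightarrow> wa t = 0 \<and> wc t = 0 \<and> \<tau>1 t = 1 \<and> \<tau>2 t = 0"
      using half(1) by (simp add: wa_def wc_def)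
    have start: "t = 0 \<Longrightarrow> wa t = 1 \<and> wc t = 0 \<and> \<tau>1 t = 0 \<and> \<tau>2 t = 0"
      and finish: "t = 1 \<Longrightarrow> wa t = 0 \<and> wc t = 1 \<and> \<tau>1 t = 1 \<and> \<tau>2 t = 1"
      using half by (simp_all add: wa_def wc_def)
    \<comment> \<open>The strings from \<open>b\<close> and \<open>c\<close> run on the edges
      \<open>\<gamma> = 0\<close> and \<open>\<alpha> = 0\<close>, which meet only in the vertex
      \<open>b\<close>. For \<open>0 < t < 1\<close> the string from \<open>a\<close> is off both
      edges, unless \<open>s = 0\<close> and \<open>t = 1/2\<close>, when it is at \<open>b\<close>
      and the others are at \<open>a\<close> and \<open>c\<close>.\<close>
    consider "t = 0" | "t = 1" | "s = 0" "t = 1/2" | "s = 0" "0 < t" "t < 1" "t \<noteq> 1/2" | "0 < s" "0 < t" "t < 1"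
      using st by fastforce
    then have dist: "\<not> (\<alpha> = \<beta> \<and> \<gamma> = 0) \<and> \<not> (\<alpha> = 0 \<and> \<gamma> = \<kappa>) \<and> \<not> (\<beta> = 0 \<and> \<kappa> = 0)"
    proof cases
      case 5
      then have "0 < s * t" "0 < s * (1 - t)" by simp_all
      moreover have "0 \<le> (1 - s) * wa t" "0 \<le> (1 - s) * wc t" "0 \<le> (1 - s) * \<tau>1 t" using w \<tau> st by simp_all
      ultimately have "0 < \<alpha>" "0 < \<gamma>" "0 < \<beta>" by (simp_all add: \<alpha>_def \<gamma>_def \<beta>_def)
      then show ?thesis by auto
    next
      case 4
      then have "0 < wa t" "0 < wc t" "0 < \<tau>1 t" using wa_pos wc_pos by (auto simp: \<tau>1_def)
      then show ?thesis
        using 4 by (auto simp: \<alpha>_def \<gamma>_def \<beta>_def)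
    qed (use start finish mid in \<open>auto simp: \<alpha>_def \<gamma>_def \<beta>_def \<kappa>_def\<close>)
    have cc: "(1 - s) * u + s * u' \<le> 1" if "u \<le> 1" "u' \<le> 1" for u u'
      using st that convex_bound_le[of u 1 u' "1 - s" s] by simp
    have bounds: "0 \<le> \<alpha>" "0 \<le> \<gamma>" "\<alpha> + \<gamma> \<le> 1" "0 \<le> \<beta>" "\<beta> \<le> 1" "0 \<le> \<kappa>" "\<kappa> \<le> 1"
    proof -
      show "0 \<le> \<alpha>" "0 \<le> \<gamma>" "0 \<le> \<beta>" "0 \<le> \<kappa>"
        using w \<tau> st by (simp_all add: \<alpha>_def \<gamma>_def \<beta>_def \<kappa>_def)
      show "\<beta> \<le> 1" "\<kappa> \<le> 1" unfolding \<beta>_def \<kappa>_def using \<tau> st by (intro cc; simp)+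
      have "\<alpha> + \<gamma> = (1 - s) * (wa t + wc t) + s * 1" by (simp add: \<alpha>_def \<gamma>_def algebra_simps)
      then show "\<alpha> + \<gamma> \<le> 1" using cc[OF w(3), of 1] by simp
    qed
    have "?p \<alpha> \<gamma> \<noteq> ?p \<beta> 0" "?p \<alpha> \<gamma> \<noteq> ?p 0 \<kappa>" "?p \<beta> 0 \<noteq> ?p 0 \<kappa>"
      using dist cw by (auto simp: bary_eq_iff)
    moreover have "z \<notin> {?p \<alpha> \<gamma>, ?p \<beta> 0, ?p 0 \<kappa>}" if "z \<in> x - {a, b, c}" for z
      using out[OF that] bary_in_hull[of \<alpha> \<gamma> a b c] bary_in_hull[of \<beta> 0 a b c] bary_in_hull[of 0 \<kappa> a b c] bounds by auto
    ultimately have "inj_on (\<lambda>z. if z = a then ?p \<alpha> \<gamma> else if z = b then ?p \<beta> 0 else if z = c then ?p 0 \<kappa> else z) x"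
      unfolding inj_on_def by auto
    moreover have "(1 - s) *\<^sub>R ?\<gamma> z t + s *\<^sub>R ?\<rho> z t
      = (if z = a then ?p \<alpha> \<gamma> else if z = b then ?p \<beta> 0 else if z = c then ?p 0 \<kappa> else z)" for z
      by (auto simp: bary_convex \<alpha>_def \<gamma>_def \<beta>_def \<kappa>_def simp flip: scaleR_add_left)
    ultimately show "inj_on (\<lambda>z. (1 - s) *\<^sub>R ?\<gamma> z t + s *\<^sub>R ?\<rho> z t) x" by (simp only:)
  qed
  then have "(join_loops (pair_motion x a b ?A1 ?B1) (pair_motion x b c ?A2 ?C2), triangle_rotation x a b c)
      \<in> loop_homotopy (configurations (card x)) x"
    by (simp only: 1[symmetric] 2[symmetric])
  then show ?thesis
    unfolding loop1(2) loop2(2) braid_group_mult[OF loop1(1) loop2(1)] by (rule loop_class_eqI)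
qed

text \<open>This symmetry is the source of the triangle relations: the product of the twists along
  two successive sides does not depend on the vertex at which one starts.\<close>

lemma triangle_rotation_rotate: "triangle_rotation x a b c = triangle_rotation x b c a"
  by (auto simp: triangle_rotation_def fun_eq_iff insert_commute)

section \<open>Parallel transport in a group-valued local system\<close>

text \<open>A local system over \<open>E\<close> is given by transition elements \<open>g a b\<close>, meaningful for \<open>b\<close> close
  to \<open>a\<close>, which satisfy the cocycle condition for \<open>b'\<close> close to \<open>b\<close>.\<close>

definition parallel :: "('g, 'm) monoid_scheme \<Rightarrow> 'p::topological_space set \<Rightarrow> ('p \<Rightarrow> 'p \<Rightarrow> 'g) \<Rightarrow> ('p \<Rightarrow> 'g) \<Rightarrow> bool" where
  "parallel G E g h \<longleftrightarrow> (\<forall>a\<in>E. h a \<in> carrier G \<and>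
     (\<forall>\<^sub>F b in at a within E. h b = h a \<otimes>\<^bsub>G\<^esub> g a b))"

definition cocycle :: "('g, 'm) monoid_scheme \<Rightarrow> 'p::topological_space set \<Rightarrow> ('p \<Rightarrow> 'p \<Rightarrow> 'g) \<Rightarrow> bool" where
  "cocycle G E g \<longleftrightarrow> (\<forall>a\<in>E. g a a = \<one>\<^bsub>G\<^esub> \<and> (\<forall>b\<in>E. g a b \<in> carrier G) \<and>
     (\<forall>\<^sub>F b in at a within E. \<forall>\<^sub>F b' in at b within E. g a b' = g a b \<otimes>\<^bsub>G\<^esub> g b b'))"

lemma parallel_cong:
  assumes "parallel G E g h" "\<And>a. a \<in> E \<Longrightarrow> h a = h' a"
    and "\<And>a b. a \<in> E \<Longrightarrow> b \<in> E \<Longrightarrow> g a b = g' a b"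
  shows "parallel G E g' h'"
  unfolding parallel_def
proof (intro ballI conjI)
  fix a assume a: "a \<in> E"
  then show "h' a \<in> carrier G" using assms by (auto simp: parallel_def)
  have "\<forall>\<^sub>F b in at a within E. h b = h a \<otimes>\<^bsub>G\<^esub> g a b" using assms(1) a by (auto simp: parallel_def)
  moreover have "\<forall>\<^sub>F b in at a within E. b \<in> E" by (simp add: eventually_at_filter)
  ultimately show "\<forall>\<^sub>F b in at a within E. h' b = h' a \<otimes>\<^bsub>G\<^esub> g' a b"
    by eventually_elim (use assms(2,3) a in auto)
qed

lemma parallel_subset: "parallel G E g h \<Longrightarrow> E' \<subseteq> E \<Longrightarrow> parallel G E' g h"
  unfolding parallel_def using at_le[of E' E] by (auto intro: filter_leD)

text \<open>The assumption \<open>refl\<close> supplies the value at the point itself, absent from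
  the punctured neighbourhoods in \<open>parallel\<close>: arbitrarily close to \<open>a\<close>,
  the function \<open>f\<close> may take the value \<open>f a\<close> again.\<close>

lemma parallel_pullback:
  assumes par: "parallel G D g h" and f: "continuous_on E f" "f \<in> E \<rightarrow> D"
    and G: "monoid G" and refl: "\<And>a. a \<in> D \<Longrightarrow> g a a = \<one>\<^bsub>G\<^esub>"
  shows "parallel G E (\<lambda>s t. g (f s) (f t)) (\<lambda>t. h (f t))"
  unfolding parallel_def
proof (intro ballI conjI)
  fix a assume a: "a \<in> E"
  then have fa: "f a \<in> D" using f(2) by auto
  then show h: "h (f a) \<in> carrier G" using par by (auto simp: parallel_def)
  have "\<forall>\<^sub>F b in at (f a) within D. h b = h (f a) \<otimes>\<^bsub>G\<^esub> g (f a) b"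
    using par fa by (auto simp: parallel_def)
  then obtain S where S: "open S" "f a \<in> S" "\<And>b. b \<in> S \<Longrightarrow> b \<noteq> f a \<Longrightarrow> b \<in> D \<Longrightarrow> h b = h (f a) \<otimes>\<^bsub>G\<^esub> g (f a) b"
    by (auto simp: eventually_at_topological)
  have S': "h b = h (f a) \<otimes>\<^bsub>G\<^esub> g (f a) b" if "b \<in> S" "b \<in> D" for b
    using S(3)[of b] that refl[OF fa] monoid.r_one[OF G h] by (cases "b = f a") auto
  have "(f \<longlongrightarrow> f a) (at a within E)" using f(1) a by (simp add: continuous_on_def)
  then have "\<forall>\<^sub>F b in at a within E. f b \<in> S" by (rule topological_tendstoD[OF _ S(1,2)])
  moreover have "\<forall>\<^sub>F b in at a within E. b \<in> E" by (simp add: eventually_at_filter)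
  ultimately show "\<forall>\<^sub>F b in at a within E. h (f b) = h (f a) \<otimes>\<^bsub>G\<^esub> g (f a) (f b)"
    by eventually_elim (use S' f(2) in auto)
qed

context group begin

lemma parallel_translate:
  assumes "parallel G E g h" "k \<in> carrier G" "\<And>a b. a \<in> E \<Longrightarrow> b \<in> E \<Longrightarrow> g a b \<in> carrier G"
  shows "parallel G E g (\<lambda>a. k \<otimes> h a)"
  unfolding parallel_def
proof (intro ballI conjI)
  fix a assume a: "a \<in> E"
  then have ha: "h a \<in> carrier G" using assms by (auto simp: parallel_def)
  then show "k \<otimes> h a \<in> carrier G" using assms by simp
  have "\<forall>\<^sub>F b in at a within E. h b = h a \<otimes> g a b" using assms(1) a by (auto simp: parallel_def)
  moreover have "\<forall>\<^sub>F b in at a within E. b \<in> E" by (simp add: eventually_at_filter)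
  ultimately show "\<forall>\<^sub>F b in at a within E. k \<otimes> h b = k \<otimes> h a \<otimes> g a b"
    by eventually_elim (use assms(2,3) a ha in \<open>simp add: m_assoc\<close>)
qed

text \<open>The transition element cancels in the left quotient of two sections, which is therefore
  locally constant. Sections are unique up to a constant left factor.\<close>

lemma parallel_unique:
  assumes h: "parallel G E g h" and h': "parallel G E g h'"
    and g: "\<And>a b. a \<in> E \<Longrightarrow> b \<in> E \<Longrightarrow> g a b \<in> carrier G"
    and E: "connected E" "a \<in> E" "b \<in> E"
  shows "h a \<otimes> inv (h' a) = h b \<otimes> inv (h' b)"
proof (rule connected_local_const[OF E], intro ballI)
  fix a assume a: "a \<in> E"
  have in_G: "h a \<in> carrier G" "h' a \<in> carrier G" using h h' a by (auto simp: parallel_def)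
  have "\<forall>\<^sub>F b in at a within E. h b = h a \<otimes> g a b" "\<forall>\<^sub>F b in at a within E. h' b = h' a \<otimes> g a b"
    using h h' a by (auto simp: parallel_def)
  moreover have "\<forall>\<^sub>F b in at a within E. b \<in> E" by (simp add: eventually_at_filter)
  ultimately show "\<forall>\<^sub>F b in at a within E. h a \<otimes> inv (h' a) = h b \<otimes> inv (h' b)"
  proof eventually_elim
    case (elim b)
    have "g a b \<otimes> (inv (g a b) \<otimes> inv (h' a)) = inv (h' a)"
      using in_G g[OF a elim(3)] by (simp flip: m_assoc)
    then show ?case
      using elim in_G g[OF a elim(3)] by (simp add: inv_mult_group m_assoc)
  qed
qed

text \<open>On the connected overlap the two sections differ by a constant left factor
  \<open>k\<close>, which is absorbed into the second one.\<close>

lemma parallel_glue: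
  assumes h1: "parallel G E1 g h1" and h2: "parallel G E2 g h2"
    and g: "\<And>a b. a \<in> E1 \<union> E2 \<Longrightarrow> b \<in> E1 \<union> E2 \<Longrightarrow> g a b \<in> carrier G"
    and E: "closed E1" "closed E2" "connected (E1 \<inter> E2)"
  shows "\<exists>h. parallel G (E1 \<union> E2) g h"
proof -
  obtain k where k: "k \<in> carrier G" "\<And>a. a \<in> E1 \<inter> E2 \<Longrightarrow> h1 a = k \<otimes> h2 a"
  proof (cases "E1 \<inter> E2 = {}")
    case True
    then show thesis using that[of \<one>] by auto
  next
    case False
    then obtain e where e: "e \<in> E1 \<inter> E2" by blast
    have in_G: "h1 a \<in> carrier G" "h2 a \<in> carrier G" if "a \<in> E1 \<inter> E2" for a
      using h1 h2 that by (auto simp: parallel_def)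
    show thesis
    proof (rule that)
      show "h1 e \<otimes> inv (h2 e) \<in> carrier G" using in_G[OF e] by simp
      fix a assume a: "a \<in> E1 \<inter> E2"
      have "h1 a \<otimes> inv (h2 a) = h1 e \<otimes> inv (h2 e)"
        by (rule parallel_unique[OF parallel_subset[OF h1] parallel_subset[OF h2] g E(3) a e]) auto
      then show "h1 a = h1 e \<otimes> inv (h2 e) \<otimes> h2 a"
        using in_G[OF a] by (metis inv_closed l_inv m_assoc r_one)
    qed
  qed
  define h where "h a = (if a \<in> E1 then h1 a else k \<otimes> h2 a)" for a
  have 1: "parallel G E1 g h" by (rule parallel_cong[OF h1]) (simp_all add: h_def)
  have 2: "parallel G E2 g h"
    by (rule parallel_cong[OF parallel_translate[OF h2 k(1)]]) (use g k(2) in \<open>auto simp: h_def\<close>)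
  have "\<forall>\<^sub>F b in at a within E. h b = h a \<otimes> g a b" if "parallel G E g h" "closed E" for a E
  proof (cases "a \<in> E")
    case False
    \<comment> \<open>A closed piece does not accumulate at a point outside it, so it imposes no
      condition there.\<close>
    then have "at a within E = bot" using that(2) by (simp add: at_within_eq_bot_iff)
    then show ?thesis by simp
  qed (use that in \<open>auto simp: parallel_def\<close>)
  then have "\<forall>\<^sub>F b in at a within E1 \<union> E2. h b = h a \<otimes> g a b" for a
    unfolding at_within_union using 1 2 E by (simp add: eventually_sup)
  then have "parallel G (E1 \<union> E2) g h" using 1 2 by (auto simp: parallel_def)
  then show ?thesis by blast
qed

text \<open>Read as a statement about the function \<open>g a\<close>, the cocycle condition says
  that it is a section near \<open>a\<close>.\<close>

lemma parallel_locally: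
  assumes "cocycle G D g" "a \<in> D"
  obtains N where "open N" "a \<in> N" "parallel G (D \<inter> N) g (g a)"
proof -
  from assms have ga: "g a a = \<one>" "\<And>b. b \<in> D \<Longrightarrow> g a b \<in> carrier G"
    and ev: "\<forall>\<^sub>F b in at a within D. \<forall>\<^sub>F b' in at b within D. g a b' = g a b \<otimes> g b b'"
    by (auto simp: cocycle_def)
  then obtain N where N: "open N" "a \<in> N"
    "\<And>b. b \<in> N \<Longrightarrow> b \<noteq> a \<Longrightarrow> b \<in> D \<Longrightarrow> \<forall>\<^sub>F b' in at b within D. g a b' = g a b \<otimes> g b b'"
    by (auto simp: eventually_at_topological)
  have "parallel G (D \<inter> N) g (g a)"
    unfolding parallel_def
  proof (intro ballI conjI)
    fix b assume b: "b \<in> D \<inter> N"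
    then show "g a b \<in> carrier G" using ga by simp
    have "\<forall>\<^sub>F b' in at b within D. g a b' = g a b \<otimes> g b b'"
    proof (cases "b = a")
      case True
      have "\<forall>\<^sub>F b' in at b within D. b' \<in> D" by (simp add: eventually_at_filter)
      then show ?thesis by eventually_elim (use ga True in simp)
    qed (use N(3) b in blast)
    then show "\<forall>\<^sub>F b' in at b within D \<inter> N. g a b' = g a b \<otimes> g b b'"
      by (rule filter_leD[OF at_le[OF Int_lower1]])
  qed
  then show thesis using that N by blast
qed

text \<open>There is no monodromy on a square: sections exist over small rectangles and glue along
  common edges. Bisection, in the form of \<open>Bolzano\<close>, extends them first to horizontal
  strips and then to the square.\<close>

proposition parallel_square:
  fixes g :: "real \<times> real \<Rightarrow> real \<times> real \<Rightarrow> 'a"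
  assumes coc: "cocycle G ({0..1} \<times> {0..1}) g"
  shows "\<exists>h. parallel G ({0..1} \<times> {0..1}) g h"
proof -
  let ?D = "{0..1} \<times> {0..1} :: (real \<times> real) set"
  have g: "g a b \<in> carrier G" if "a \<in> ?D" "b \<in> ?D" for a b
    using coc that unfolding cocycle_def by blast
  have glue: "\<exists>h. parallel G (E1 \<union> E2) g h"
    if ex: "\<exists>h. parallel G E1 g h" "\<exists>h. parallel G E2 g h" and "E1 \<union> E2 \<subseteq> ?D" "closed E1" "closed E2" "convex E1" "convex E2" for E1 E2
  proof -
    obtain h1 h2 where "parallel G E1 g h1" "parallel G E2 g h2" using ex by blast
    then show ?thesis
    proof (rule parallel_glue)
      show "g a b \<in> carrier G" if "a \<in> E1 \<union> E2" "b \<in> E1 \<union> E2" for a b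
        using \<open>E1 \<union> E2 \<subseteq> ?D\<close> that by (intro g) blast+
    qed (use that in \<open>auto intro: convex_connected convex_Int\<close>)
  qed
  \<comment> \<open>Rectangles are cut down to the square, since the bisection principle speaks of
    all short intervals around a point, including those that stick out of
    \<open>{0..1}\<close>.\<close>
  define P where "P a b c d \<longleftrightarrow> (\<exists>h. parallel G (?D \<inter> ({a..b} \<times> {c..d})) g h)" for a b c d
  have shape: "closed (?D \<inter> ({a..b} \<times> {c..d}))" "convex (?D \<inter> ({a..b} \<times> {c..d}))" for a b c d :: real
    by (intro closed_Int closed_Times closed_atLeastAtMost convex_Int convex_Times convex_real_interval)+
  have P_horizontal: "P a b' c d" if "P a b c d" "P b b' c d" "a \<le> b" "b \<le> b'" for a b b' c d
  proof -
    have "?D \<inter> ({a..b'} \<times> {c..d}) = (?D \<inter> ({a..b} \<times> {c..d})) \<union> (?D \<inter> ({b..b'} \<times> {c..d}))"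
      using that(3,4) by auto
    then show ?thesis using that(1,2) unfolding P_def by (simp only:) (intro glue shape; auto)
  qed
  have P_vertical: "P a b c d'" if "P a b c d" "P a b d d'" "c \<le> d" "d \<le> d'" for a b c d d'
  proof -
    have "?D \<inter> ({a..b} \<times> {c..d'}) = (?D \<inter> ({a..b} \<times> {c..d})) \<union> (?D \<inter> ({a..b} \<times> {d..d'}))"
      using that(3,4) by auto
    then show ?thesis using that(1,2) unfolding P_def by (simp only:) (intro glue shape; auto)
  qed
  have P_small: "\<exists>e>0. \<forall>a b c d. a \<le> x \<and> x \<le> b \<and> b - a < e \<and> c \<le> y \<and> y \<le> d \<and> d - c < e \<longrightarrow> P a b c d"
    if xy: "(x, y) \<in> ?D" for x y
  proof -
    obtain N h where N: "open N" "(x, y) \<in> N" "parallel G (?D \<inter> N) g h"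
      using parallel_locally[OF coc xy] by blast
    then obtain r where r: "r > 0" "ball (x, y) r \<subseteq> N" using open_contains_ball by blast
    have "P a b c d" if "a \<le> x" "x \<le> b" "b - a < r / 2" "c \<le> y" "y \<le> d" "d - c < r / 2" for a b c d
    proof -
      have "{a..b} \<times> {c..d} \<subseteq> ball (x, y) r"
      proof
        fix p assume p: "p \<in> {a..b} \<times> {c..d}"
        then have "dist x (fst p) < r / 2" "dist y (snd p) < r / 2" using that by (auto simp: dist_real_def abs_if)
        then have "dist (x, y) p < r"
          using sqrt_sum_squares_le_sum_abs[of "dist x (fst p)" "dist y (snd p)"] by (simp add: dist_prod_def)
        then show "p \<in> ball (x, y) r" by simp
      qed
      then have "?D \<inter> ({a..b} \<times> {c..d}) \<subseteq> ?D \<inter> N" using r(2) by blast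
      then show ?thesis unfolding P_def using parallel_subset[OF N(3)] by blast
    qed
    then show ?thesis using r(1) by (intro exI[of _ "r / 2"]) auto
  qed
  \<comment> \<open>The height \<open>e\<close> may shrink at each gluing; making its existence part
    of the property under bisection lets it depend on the interval.\<close>
  have strip: "\<exists>e>0. \<forall>c d. c \<le> y \<and> y \<le> d \<and> d - c < e \<longrightarrow> P 0 1 c d" if y: "y \<in> {0..1}" for y
  proof (rule Bolzano[of 0 1 "\<lambda>a b. \<exists>e>0. \<forall>c d. c \<le> y \<and> y \<le> d \<and> d - c < e \<longrightarrow> P a b c d"])
    show "\<exists>e>0. \<forall>c d. c \<le> y \<and> y \<le> d \<and> d - c < e \<longrightarrow> P a b' c d"
      if ex: "\<exists>e>0. \<forall>c d. c \<le> y \<and> y \<le> d \<and> d - c < e \<longrightarrow> P a b c d"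
        "\<exists>e>0. \<forall>c d. c \<le> y \<and> y \<le> d \<and> d - c < e \<longrightarrow> P b b' c d" and ab: "a \<le> b" "b \<le> b'" for a b b'
    proof -
      obtain e1 e2 where e: "e1 > 0" "e2 > 0" "\<And>c d. c \<le> y \<and> y \<le> d \<and> d - c < e1 \<Longrightarrow> P a b c d"
        "\<And>c d. c \<le> y \<and> y \<le> d \<and> d - c < e2 \<Longrightarrow> P b b' c d" using ex by blast
      have "P a b' c d" if "c \<le> y" "y \<le> d" "d - c < min e1 e2" for c d
        by (rule P_horizontal[OF e(3) e(4) ab]) (use that in auto)
      then show ?thesis using e(1,2) by (intro exI[of _ "min e1 e2"]) simp
    qed
    show "\<exists>e>0. \<forall>a b. a \<le> x \<and> x \<le> b \<and> b - a < e \<longrightarrow> (\<exists>e>0. \<forall>c d. c \<le> y \<and> y \<le> d \<and> d - c < e \<longrightarrow> P a b c d)"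
      if x: "0 \<le> x" "x \<le> 1" for x
    proof -
      obtain e where "e > 0" "\<And>a b c d. a \<le> x \<and> x \<le> b \<and> b - a < e \<and> c \<le> y \<and> y \<le> d \<and> d - c < e \<Longrightarrow> P a b c d"
        using P_small[of x y] x y by auto
      then show ?thesis by (intro exI[of _ e]) auto
    qed
  qed simp
  have "P 0 1 0 1"
  proof (rule Bolzano[of 0 1 "P 0 1"])
    show "\<exists>e>0. \<forall>c d. c \<le> y \<and> y \<le> d \<and> d - c < e \<longrightarrow> P 0 1 c d" if "0 \<le> y" "y \<le> 1" for y
      using strip[of y] that by auto
  qed (use P_vertical in auto)
  then show ?thesis by (simp add: P_def)
qed

end

section \<open>The local system on the space of configurations\<close>

text \<open>Points are ordered lexicographically after the rotation by \<open>u\<close>. A configuration close to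
  \<open>x\<close> orders its points as \<open>x\<close> does, except that points on a common vertical line of \<open>x\<close> may be
  exchanged; each such exchange turns the pair counterclockwise, so that the positive
  lift of the permutation is the right transition element.\<close>

definition lexless :: "complex \<Rightarrow> complex \<Rightarrow> complex \<Rightarrow> bool" where
  "lexless u z w \<longleftrightarrow> Re (u * z) < Re (u * w) \<or> Re (u * z) = Re (u * w) \<and> Im (u * z) < Im (u * w)"

definition rank_in :: "complex \<Rightarrow> complex set \<Rightarrow> complex \<Rightarrow> nat" where
  "rank_in u x z = card {w \<in> x. lexless u w z}"

definition nth_point :: "complex \<Rightarrow> complex set \<Rightarrow> nat \<Rightarrow> complex" where
  "nth_point u x = inv_into x (rank_in u x)"

text \<open>Points that move by less than \<open>\<rho>\<close> stay in disjoint discs. They keep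
  their order if their real parts differed, by the margin \<open>2 * \<rho>\<close>; on a common
  vertical line the first margin settles which one is above.\<close>

definition separation :: "complex \<Rightarrow> complex set \<Rightarrow> real \<Rightarrow> bool" where
  "separation u x \<rho> \<longleftrightarrow> 0 < \<rho> \<and> (\<forall>z\<in>x. \<forall>w\<in>x. z \<noteq> w \<longrightarrow> 4 * \<rho> < dist z w) \<and>
     (\<forall>z\<in>x. \<forall>w\<in>x. Re (u * z) < Re (u * w) \<longrightarrow> Re (u * z) + 2 * \<rho> < Re (u * w))"

text \<open>One radius is fixed for each configuration, so that \<open>transition\<close> depends on
  \<open>x\<close> and \<open>y\<close> alone.\<close>

definition radius :: "complex \<Rightarrow> complex set \<Rightarrow> real" where
  "radius u x = (SOME \<rho>. separation u x \<rho>)"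

definition near_conf :: "real \<Rightarrow> complex set \<Rightarrow> complex set \<Rightarrow> bool" where
  "near_conf \<rho> x y \<longleftrightarrow> (\<forall>z\<in>x. \<exists>w\<in>y. dist w z < \<rho>)"

definition close_point :: "complex \<Rightarrow> complex set \<Rightarrow> complex \<Rightarrow> complex" where
  "close_point u x w = (THE z. z \<in> x \<and> dist w z < radius u x)"

text \<open>Ranks in \<open>y\<close> are sent to ranks in \<open>x\<close>, so that transitions
  compose in the order of the path. The value \<open>i\<close> outside the range makes this a
  permutation in the sense of \<open>permutes\<close> when \<open>y\<close> is near
  \<open>x\<close>.\<close>

definition transition :: "complex \<Rightarrow> complex set \<Rightarrow> complex set \<Rightarrow> nat \<Rightarrow> nat" where
  "transition u x y i = (if i < card x then rank_in u x (close_point u x (nth_point u y i)) else i)"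

lemma lexless_total: "u \<noteq> 0 \<Longrightarrow> z \<noteq> w \<Longrightarrow> lexless u z w \<or> lexless u w z"
proof -
  assume "u \<noteq> 0" "z \<noteq> w"
  then have "u * z \<noteq> u * w" by simp
  then show ?thesis unfolding lexless_def complex_eq_iff by linarith
qed

lemma rank_in_mono:
  assumes "finite x" "z \<in> x" "lexless u z w" shows "rank_in u x z < rank_in u x w"
  unfolding rank_in_def
proof (rule psubset_card_mono)
  show "finite {v \<in> x. lexless u v w}" using assms by simp
  show "{v \<in> x. lexless u v z} \<subset> {v \<in> x. lexless u v w}"
    using assms by (auto simp: lexless_def)
qed

lemma rank_in_less_iff:
  assumes "finite x" "u \<noteq> 0" "z \<in> x" "w \<in> x"
  shows "rank_in u x z < rank_in u x w \<longleftrightarrow> lexless u z w"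
  using rank_in_mono[OF assms(1)] lexless_total[OF assms(2), of z w] assms by (metis less_asym less_irrefl)

lemma rank_in_less_card: "finite x \<Longrightarrow> z \<in> x \<Longrightarrow> rank_in u x z < card x"
  unfolding rank_in_def by (rule psubset_card_mono) (auto simp: lexless_def)

lemma bij_rank_in:
  assumes "finite x" "u \<noteq> 0" shows "bij_betw (rank_in u x) x {..<card x}"
proof -
  have inj: "inj_on (rank_in u x) x"
    using rank_in_mono[OF assms(1)] lexless_total[OF assms(2)] by (intro inj_onI) (metis less_irrefl)
  moreover have "rank_in u x ` x \<subseteq> {..<card x}" using rank_in_less_card[OF assms(1)] by auto
  ultimately show ?thesis
    by (simp add: bij_betw_def card_subset_eq card_image)
qed

lemma nth_point:
  assumes "finite x" "u \<noteq> 0"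
  shows "i < card x \<Longrightarrow> nth_point u x i \<in> x" "i < card x \<Longrightarrow> rank_in u x (nth_point u x i) = i"
    "z \<in> x \<Longrightarrow> nth_point u x (rank_in u x z) = z" "bij_betw (nth_point u x) {..<card x} x"
proof -
  note b = bij_rank_in[OF assms]
  then have "rank_in u x ` x = {..<card x}" "inj_on (rank_in u x) x" by (auto simp: bij_betw_def)
  then show "i < card x \<Longrightarrow> nth_point u x i \<in> x" "i < card x \<Longrightarrow> rank_in u x (nth_point u x i) = i"
    "z \<in> x \<Longrightarrow> nth_point u x (rank_in u x z) = z"
    unfolding nth_point_def by (auto intro: inv_into_into f_inv_into_f)
  show "bij_betw (nth_point u x) {..<card x} x"
    unfolding nth_point_def by (rule bij_betw_inv_into[OF b])
qed

lemma eventually_small: "0 < (e::real) \<Longrightarrow> \<forall>\<^sub>F \<rho> in at_right 0. \<rho> < e"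
  by (auto simp: eventually_at_right_field)

lemma separation_radius:
  assumes "finite x" shows "separation u x (radius u x)"
proof -
  have "\<forall>\<^sub>F \<rho> in at_right 0. (0::real) < \<rho>" by (simp add: eventually_at_right_less)
  moreover have "\<forall>\<^sub>F \<rho> in at_right 0. \<forall>z\<in>x. \<forall>w\<in>x. z \<noteq> w \<longrightarrow> 4 * \<rho> < dist z w"
  proof (intro eventually_ball_finite assms ballI)
    fix z w show "\<forall>\<^sub>F \<rho> in at_right 0. z \<noteq> w \<longrightarrow> 4 * \<rho> < dist z w"
      using eventually_small[of "dist z w / 4"] by (cases "z = w") (auto elim: eventually_mono)
  qed
  moreover have "\<forall>\<^sub>F \<rho> in at_right 0. \<forall>z\<in>x. \<forall>w\<in>x. Re (u * z) < Re (u * w) \<longrightarrow> Re (u * z) + 2 * \<rho> < Re (u * w)"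
  proof (intro eventually_ball_finite assms ballI)
    fix z w show "\<forall>\<^sub>F \<rho> in at_right 0. Re (u * z) < Re (u * w) \<longrightarrow> Re (u * z) + 2 * \<rho> < Re (u * w)"
    proof (cases "Re (u * z) < Re (u * w)")
      case True
      then show ?thesis
        using eventually_small[of "(Re (u * w) - Re (u * z)) / 2"] by (auto elim!: eventually_mono)
    qed auto
  qed
  ultimately have "\<forall>\<^sub>F \<rho> in at_right 0. separation u x \<rho>"
    unfolding separation_def by eventually_elim simp
  then have "\<exists>\<rho>. separation u x \<rho>" by (auto dest: eventually_happens)
  then show ?thesis unfolding radius_def by (rule someI_ex)
qed

lemma radius_pos: "finite x \<Longrightarrow> 0 < radius u x"
  using separation_radius by (simp add: separation_def)

lemma close_point_eq:
  assumes "finite x" "z \<in> x" "dist w z < radius u x" shows "close_point u x w = z"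
  unfolding close_point_def
proof (rule the_equality)
  fix z' assume z': "z' \<in> x \<and> dist w z' < radius u x"
  show "z' = z"
  proof (rule ccontr)
    assume "z' \<noteq> z"
    then have "4 * radius u x < dist z' z"
      using separation_radius[OF assms(1)] z' assms(2) by (simp add: separation_def)
    then show False using dist_triangle3[of z' z w] zero_le_dist[of w z] z' assms(3) by linarith
  qed
qed (use assms in simp)

text \<open>\<open>near_conf\<close> only provides a point of \<open>y\<close> near each point of
  \<open>x\<close>. These points are distinct because the discs are disjoint, and as the
  cardinalities agree they exhaust \<open>y\<close>.\<close>

lemma near_conf_surj:
  assumes fin: "finite x" "finite y" "card y = card x" and near: "near_conf \<rho> x y" and \<rho>: "\<rho> \<le> radius u x"
    and w: "w \<in> y"
  shows "\<exists>z\<in>x. dist w z < \<rho>"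
proof -
  obtain f where f: "\<And>z. z \<in> x \<Longrightarrow> f z \<in> y \<and> dist (f z) z < \<rho>"
    using near unfolding near_conf_def by metis
  have "inj_on f x"
  proof (rule inj_onI)
    fix z z' assume "z \<in> x" "z' \<in> x" "f z = f z'"
    then show "z = z'"
      using close_point_eq[OF fin(1), of z "f z" u] close_point_eq[OF fin(1), of z' "f z" u] f \<rho> by fastforce
  qed
  then have "f ` x = y" using f fin by (intro card_subset_eq) (auto simp: card_image)
  then show ?thesis using w f by blast
qed

lemma close_point:
  assumes "finite x" "finite y" "card y = card x" "near_conf (radius u x) x y"
  shows "w \<in> y \<Longrightarrow> close_point u x w \<in> x \<and> dist w (close_point u x w) < radius u x"
    "bij_betw (close_point u x) y x"
proof -
  show *: "close_point u x w \<in> x \<and> dist w (close_point u x w) < radius u x" if w: "w \<in> y" for w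
    using near_conf_surj[OF assms order_refl w] close_point_eq[OF assms(1)] by metis
  have "x \<subseteq> close_point u x ` y"
    using assms(4) close_point_eq[OF assms(1)] unfolding near_conf_def by (metis image_eqI subsetI)
  then have "close_point u x ` y = x" using * by auto
  then show "bij_betw (close_point u x) y x"
    using assms by (simp add: bij_betw_def eq_card_imp_inj_on)
qed

lemma transition_permutes:
  assumes "finite x" "finite y" "card y = card x" "near_conf (radius u x) x y" "u \<noteq> 0"
  shows "transition u x y permutes {..<card x}"
proof (rule bij_imp_permutes)
  have "bij_betw (rank_in u x \<circ> (close_point u x \<circ> nth_point u y)) {..<card x} {..<card x}"
    using bij_betw_trans[OF bij_betw_trans[OF nth_point(4)[OF assms(2,5)] close_point(2)[OF assms(1-4)]] bij_rank_in[OF assms(1,5)]]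
    by (simp add: assms(3))
  then show "bij_betw (transition u x y) {..<card x} {..<card x}"
    by (rule bij_betw_cong[THEN iffD1, rotated]) (simp add: transition_def)
qed (simp add: transition_def)

lemma transition_refl: "finite x \<Longrightarrow> u \<noteq> 0 \<Longrightarrow> transition u x x = id"
proof
  fix i assume *: "finite x" "u \<noteq> 0"
  show "transition u x x i = id i"
  proof (cases "i < card x")
    case True
    then have "close_point u x (nth_point u x i) = nth_point u x i"
      using * by (intro close_point_eq) (auto intro: nth_point radius_pos)
    then show ?thesis using True * by (simp add: transition_def nth_point)
  qed (simp add: transition_def)
qed

text \<open>The number \<open>\<delta>\<close> is the room that the points of \<open>y\<close> have
  inside the discs of \<open>x\<close>: points of \<open>z\<close> that close to \<open>y\<close>
  remain in them, whence the composition. The last clause is the hypothesis of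
  \<open>lift_comp\<close>. An inversion from \<open>z\<close> to \<open>y\<close> concerns two
  points on one vertical line of \<open>y\<close>, and the points of \<open>x\<close> near them are
  ordered as these two are.\<close>

lemma transition_cocycle:
  assumes u: "norm u = 1" and fin: "finite x" "finite y" "card y = card x" and xy: "near_conf (radius u x) x y"
  obtains \<delta> where "0 < \<delta>" "\<And>z. finite z \<Longrightarrow> card z = card x \<Longrightarrow> near_conf \<delta> y z \<Longrightarrow>
    near_conf (radius u y) y z \<and> transition u x z = transition u x y \<circ> transition u y z \<and>
    (\<forall>k l. k < l \<longrightarrow> l < card x \<longrightarrow> transition u y z l < transition u y z k \<longrightarrow>
       transition u x z l < transition u x z k)"
proof -
  have u0: "u \<noteq> 0" using u by auto
  note cl = close_point(1)[OF fin xy]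
  have "\<forall>\<^sub>F \<delta> in at_right 0. (0::real) < \<delta>" by (simp add: eventually_at_right_less)
  moreover have "\<forall>\<^sub>F \<delta> in at_right 0. \<delta> < radius u y" by (intro eventually_small radius_pos fin)
  moreover have "\<forall>\<^sub>F \<delta> in at_right 0. \<forall>w\<in>y. \<delta> < radius u x - dist w (close_point u x w)"
    using cl by (intro eventually_ball_finite fin ballI eventually_small) auto
  ultimately have ev: "\<forall>\<^sub>F \<delta> in at_right 0. 0 < \<delta> \<and> \<delta> < radius u y \<and> (\<forall>w\<in>y. \<delta> < radius u x - dist w (close_point u x w))"
    by eventually_elim simp
  obtain \<delta> where \<delta>: "0 < \<delta>" "\<delta> < radius u y" "\<And>w. w \<in> y \<Longrightarrow> \<delta> < radius u x - dist w (close_point u x w)"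
    using eventually_happens'[OF trivial_limit_at_right_real ev] by blast
  show thesis
  proof (rule that[OF \<delta>(1)])
    fix z assume z: "finite z" "card z = card x" "near_conf \<delta> y z"
    then have yz: "near_conf (radius u y) y z" using \<delta>(2) unfolding near_conf_def by (meson less_trans)
    have card: "card z = card y" using z fin by simp
    note cl' = close_point(1)[OF fin(2) z(1) card yz]
    have comp: "close_point u x v = close_point u x (close_point u y v) \<and> dist v (close_point u x v) < radius u x"
      if v: "v \<in> z" for v
    proof -
      obtain w where w: "w \<in> y" "dist v w < \<delta>"
        using near_conf_surj[OF fin(2) z(1) card z(3) less_imp_le[OF \<delta>(2)] v] by blast
      then have 1: "close_point u y v = w" using \<delta>(2) by (intro close_point_eq fin) auto
      have "dist v (close_point u x w) < radius u x"
        using dist_triangle[of v "close_point u x w" w] w \<delta>(3)[OF w(1)] by simp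
      then show ?thesis using 1 close_point_eq[OF fin(1), of "close_point u x w" v u] cl[OF w(1)] by simp
    qed
    have nth: "nth_point u z i \<in> z" "close_point u y (nth_point u z i) \<in> y"
      "nth_point u y (transition u y z i) = close_point u y (nth_point u z i)" if "i < card x" for i
      using nth_point(1)[OF z(1) u0] cl' that z fin nth_point(3)[OF fin(2) u0] by (simp_all add: transition_def)
    have tyz: "transition u y z i < card x" if "i < card x" for i
      using that nth(2) rank_in_less_card[OF fin(2)] fin(3) by (simp add: transition_def)
    have eq: "transition u x z = transition u x y \<circ> transition u y z"
    proof
      fix i show "transition u x z i = (transition u x y \<circ> transition u y z) i"
        using comp nth[of i] tyz[of i] fin(3) by (cases "i < card x") (simp_all add: transition_def[of u x] transition_def[of u y z i])
    qed
    have re: "Re (u * a) - Re (u * b) < r" "Re (u * b) - Re (u * a) < r" "Im (u * a) - Im (u * b) < r" "Im (u * b) - Im (u * a) < r"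
      if "dist a b < r" for a b r
    proof -
      have "norm (u * a - u * b) < r" using that u by (simp add: dist_norm norm_mult flip: right_diff_distrib)
      then show "Re (u * a) - Re (u * b) < r" "Re (u * b) - Re (u * a) < r" "Im (u * a) - Im (u * b) < r" "Im (u * b) - Im (u * a) < r"
        using abs_Re_le_cmod[of "u * a - u * b"] abs_Im_le_cmod[of "u * a - u * b"] by auto
    qed
    have "transition u x z l < transition u x z k"
      if kl: "k < l" "l < card x" "transition u y z l < transition u y z k" for k l
    proof -
      define vk vl where "vk = nth_point u z k" and "vl = nth_point u z l"
      define wk wl where "wk = close_point u y vk" and "wl = close_point u y vl"
      define pk pl where "pk = close_point u x vk" and "pl = close_point u x vl"
      have k: "k < card x" using kl by simp
      have v: "vk \<in> z" "vl \<in> z" "rank_in u z vk = k" "rank_in u z vl = l"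
        using nth(1) k kl(2) nth_point(2)[OF z(1) u0] z(2) by (simp_all add: vk_def vl_def)
      have w: "wk \<in> y" "wl \<in> y" "dist vk wk < radius u y" "dist vl wl < radius u y"
        using cl' v by (simp_all add: wk_def wl_def)
      have p: "pk \<in> x" "pl \<in> x" "dist wk pk < radius u x" "dist wl pl < radius u x"
        "dist vk pk < radius u x" "dist vl pl < radius u x"
        using comp[OF v(1)] comp[OF v(2)] cl w by (auto simp: pk_def pl_def wk_def wl_def)
      have vless: "lexless u vk vl" using rank_in_less_iff[OF z(1) u0 v(1,2)] kl(1) v by simp
      have "rank_in u y wl < rank_in u y wk"
        using kl k fin(3) by (simp add: transition_def wk_def wl_def vk_def vl_def)
      then have wless: "lexless u wl wk" using rank_in_less_iff[OF fin(2) u0 w(2,1)] by simp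
      have "\<not> Re (u * wl) < Re (u * wk)"
      proof
        assume "Re (u * wl) < Re (u * wk)"
        then have "Re (u * wl) + 2 * radius u y < Re (u * wk)"
          using separation_radius[OF fin(2)] w by (simp add: separation_def)
        then have "Re (u * vl) < Re (u * vk)" using re(2)[OF w(3)] re(1)[OF w(4)] by simp
        then show False using vless by (simp add: lexless_def)
      qed
      then have wre: "Re (u * wl) = Re (u * wk)" "Im (u * wl) < Im (u * wk)"
        using wless by (auto simp: lexless_def)
      have sep: "Re (u * a) + 2 * radius u x < Re (u * b)" if "a \<in> x" "b \<in> x" "Re (u * a) < Re (u * b)" for a b
        using separation_radius[OF fin(1), of u] that by (simp add: separation_def)
      have "\<not> Re (u * pk) < Re (u * pl)"
        using sep[OF p(1,2)] re(1)[OF p(3)] re(2)[OF p(4)] wre by auto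
      moreover have "Im (u * pl) < Im (u * pk)" if eq: "Re (u * pk) = Re (u * pl)"
      proof (rule ccontr)
        assume n: "\<not> Im (u * pl) < Im (u * pk)"
        have "pk \<noteq> pl"
          using bij_betw_imp_inj_on[OF close_point(2)[OF fin xy]] w comp[OF v(1)] comp[OF v(2)] wre
          unfolding pk_def pl_def wk_def wl_def by (metis inj_onD less_irrefl)
        then have "4 * radius u x < dist pk pl"
          using separation_radius[OF fin(1)] p by (simp add: separation_def)
        also have "dist pk pl = norm (u * pk - u * pl)"
          using u by (simp add: dist_norm norm_mult flip: right_diff_distrib)
        also have "\<dots> = \<bar>Im (u * pk) - Im (u * pl)\<bar>"
          using eq by (simp add: cmod_def)
        finally show False using n wre(2) re(3)[OF p(3)] re(4)[OF p(4)] by simp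
      qed
      ultimately have "lexless u pl pk" by (auto simp: lexless_def)
      then have "rank_in u x pl < rank_in u x pk" using rank_in_less_iff[OF fin(1) u0 p(2,1)] by simp
      then show ?thesis using kl k by (simp add: transition_def pk_def pl_def vk_def vl_def)
    qed
    then show "near_conf (radius u y) y z \<and> transition u x z = transition u x y \<circ> transition u y z \<and>
      (\<forall>k l. k < l \<longrightarrow> l < card x \<longrightarrow> transition u y z l < transition u y z k \<longrightarrow>
         transition u x z l < transition u x z k)"
      using yz eq by blast
  qed
qed

lemma openin_near_conf:
  assumes "finite x"
  shows "openin (configurations n) {y \<in> topspace (configurations n). near_conf \<delta> x y}"
proof -
  let ?U = "{y \<in> topspace (configurations n). near_conf \<delta> x y}"
  let ?X = "ordered_configurations n"
  have top: "topspace (configurations n) = (\<lambda>z. z ` {..<n}) ` topspace ?X"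
    by (simp add: configurations_def topspace_quotient_topology)
  have "{f \<in> topspace ?X. f ` {..<n} \<in> ?U} = {f \<in> topspace ?X. \<forall>z\<in>x. f \<in> (\<Union>i<n. {f \<in> topspace ?X. f i \<in> ball z \<delta>})}"
    unfolding top near_conf_def by (auto simp: dist_commute)
  also have "\<dots> = (\<Inter>z\<in>x. \<Union>i<n. {f \<in> topspace ?X. f i \<in> ball z \<delta>}) \<inter> topspace ?X"
    by auto
  also have "openin ?X \<dots>"
  proof (rule openin_INT[OF assms])
    fix z
    have "openin ?X {f \<in> topspace ?X. f i \<in> ball z \<delta>}" if "i < n" for i
    proof (rule openin_continuous_map_preimage)
      show "continuous_map ?X euclidean (\<lambda>f. f i)"
        unfolding ordered_configurations_def
        using that by (intro continuous_map_from_subtopology continuous_map_product_projection) simp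
    qed simp
    then show "openin ?X (\<Union>i<n. {f \<in> topspace ?X. f i \<in> ball z \<delta>})" by blast
  qed
  finally have "openin ?X {f \<in> topspace ?X. f ` {..<n} \<in> ?U}" .
  moreover have "?U \<subseteq> (\<lambda>z. z ` {..<n}) ` topspace ?X" unfolding top by blast
  ultimately show ?thesis
    unfolding configurations_def openin_quotient_topology by blast
qed

lemma near_conf_eventually:
  assumes c: "continuous_map (top_of_set D) (configurations n) c" and a: "a \<in> D" and "0 < \<delta>"
  shows "\<forall>\<^sub>F b in at a within D. near_conf \<delta> (c a) (c b)"
proof -
  have ca: "c a \<in> topspace (configurations n)" using c a by (auto simp: continuous_map_def)
  then have "openin (configurations n) {y \<in> topspace (configurations n). near_conf \<delta> (c a) y}"
    by (intro openin_near_conf) (simp add: topspace_configurations)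
  from openin_continuous_map_preimage[OF c this]
  have "openin (top_of_set D) {b \<in> D. near_conf \<delta> (c a) (c b)}"
    using c by (simp add: continuous_map_def Pi_iff cong: conj_cong)
  then obtain T where T: "open T" "{b \<in> D. near_conf \<delta> (c a) (c b)} = D \<inter> T"
    by (auto simp: openin_open)
  have "near_conf \<delta> (c a) (c a)" using \<open>0 < \<delta>\<close> unfolding near_conf_def by (metis dist_self)
  then have "a \<in> T" using T(2) a by blast
  then show ?thesis using T by (auto simp: eventually_at_topological)
qed

lemma config_in: "continuous_map (top_of_set D) (configurations n) c \<Longrightarrow> a \<in> D \<Longrightarrow> finite (c a) \<and> card (c a) = n"
  using topspace_configurations[of n] by (auto simp: continuous_map_def)

context braid_relations begin

lemma cocycle_configurations:
  assumes u: "norm u = 1" and c: "continuous_map (top_of_set D) (configurations n) c"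
  shows "cocycle G D (\<lambda>a b. lift (transition u (c a) (c b)))"
  unfolding cocycle_def
proof (intro ballI conjI)
  have u0: "u \<noteq> 0" using u by auto
  fix a assume a: "a \<in> D"
  note ca = config_in[OF c a]
  show "lift (transition u (c a) (c a)) = \<one>" using ca u0 by (simp add: transition_refl)
  show "lift (transition u (c a) (c b)) \<in> carrier G" for b by simp
  have "\<forall>\<^sub>F b in at a within D. near_conf (radius u (c a)) (c a) (c b)"
    using near_conf_eventually[OF c a] radius_pos ca by blast
  moreover have "\<forall>\<^sub>F b in at a within D. b \<in> D" by (simp add: eventually_at_filter)
  ultimately show "\<forall>\<^sub>F b in at a within D. \<forall>\<^sub>F b' in at b within D.
    lift (transition u (c a) (c b')) = lift (transition u (c a) (c b)) \<otimes> lift (transition u (c b) (c b'))"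
  proof eventually_elim
    case (elim b)
    note cb = config_in[OF c elim(2)]
    obtain \<delta> where \<delta>: "0 < \<delta>" "\<And>z. finite z \<Longrightarrow> card z = card (c a) \<Longrightarrow> near_conf \<delta> (c b) z \<Longrightarrow>
      near_conf (radius u (c b)) (c b) z \<and>
      transition u (c a) z = transition u (c a) (c b) \<circ> transition u (c b) z \<and>
      (\<forall>k l. k < l \<longrightarrow> l < card (c a) \<longrightarrow> transition u (c b) z l < transition u (c b) z k \<longrightarrow>
       transition u (c a) z l < transition u (c a) z k)"
      using transition_cocycle[OF u, of "c a" "c b"] ca cb elim(1) by auto
    have "\<forall>\<^sub>F b' in at b within D. near_conf \<delta> (c b) (c b')"
      using near_conf_eventually[OF c elim(2) \<delta>(1)] .
    moreover have "\<forall>\<^sub>F b' in at b within D. b' \<in> D" by (simp add: eventually_at_filter)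
    ultimately show ?case
    proof eventually_elim
      case (elim b')
      note cb' = config_in[OF c elim(2)]
      have 1: "near_conf (radius u (c b)) (c b) (c b')"
        and 2: "transition u (c a) (c b') = transition u (c a) (c b) \<circ> transition u (c b) (c b')"
        and 3: "\<And>k l. k < l \<Longrightarrow> l < n \<Longrightarrow> transition u (c b) (c b') l < transition u (c b) (c b') k \<Longrightarrow>
          transition u (c a) (c b') l < transition u (c a) (c b') k"
        using \<delta>(2)[of "c b'"] ca cb' elim(1) by auto
      have p: "transition u (c b) (c b') permutes {..<n}"
        using transition_permutes[of "c b" "c b'" u] cb cb' 1 u0 by simp
      show ?case
        unfolding 2 by (rule lift_comp[OF p]) (use 3 in \<open>simp add: 2\<close>)
    qed
  qed
qed

section \<open>Holonomy along loops of configurations\<close>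

definition path_transition :: "complex \<Rightarrow> (real \<Rightarrow> complex set) \<Rightarrow> real \<Rightarrow> real \<Rightarrow> 'a" where
  "path_transition u p s t = lift (transition u (p s) (p t))"

text \<open>Sections differ by a constant left factor, which cancels in
  \<open>inv (h 0) \<otimes> h 1\<close>; so the choice does not matter.\<close>

definition holonomy :: "complex \<Rightarrow> (real \<Rightarrow> complex set) \<Rightarrow> 'a" where
  "holonomy u p = (SOME g. \<exists>h. parallel G {0..1} (path_transition u p) h \<and> g = inv (h 0) \<otimes> h 1)"

lemma parallel_square_configurations:
  assumes u: "norm u = 1" and c: "continuous_map (top_of_set ({0..1::real} \<times> {0..1::real})) (configurations n) c"
  obtains h where "parallel G ({0..1::real} \<times> {0..1::real}) (\<lambda>a b. lift (transition u (c a) (c b))) h"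
  using parallel_square[OF cocycle_configurations[OF u c]] by blast

lemma parallel_slice:
  assumes u: "norm u = 1" and c: "continuous_map (top_of_set D) (configurations n) c"
    and h: "parallel G D (\<lambda>a b. lift (transition u (c a) (c b))) h"
    and f: "continuous_on {0..1} f" "f \<in> {0..1::real} \<rightarrow> D"
  shows "parallel G {0..1} (path_transition u (\<lambda>t. c (f t))) (\<lambda>t. h (f t))"
proof -
  have "u \<noteq> 0" using u by auto
  then have "lift (transition u (c a) (c a)) = \<one>" if "a \<in> D" for a
    using config_in[OF c that] by (simp add: transition_refl)
  from parallel_pullback[OF h f monoid_axioms this] show ?thesis
    unfolding path_transition_def .
qed

text \<open>The path is spread out constantly over the square, so that the existence of sections
  there covers paths as well.\<close>

lemma parallel_path:
  assumes u: "norm u = 1" and p: "continuous_map (top_of_set {0..1}) (configurations n) p"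
  obtains h where "parallel G {0..1} (path_transition u p) h"
proof -
  have c: "continuous_map (top_of_set ({0..1::real} \<times> {0..1::real})) (configurations n) (\<lambda>st. p (snd st))"
    by (intro continuous_map_eu_compose[OF p] continuous_intros) auto
  obtain h where h: "parallel G ({0..1::real} \<times> {0..1::real}) (\<lambda>a b. lift (transition u (p (snd a)) (p (snd b)))) h"
    using parallel_square_configurations[OF u c] .
  have "parallel G {0..1} (path_transition u (\<lambda>t. p (snd (0::real, t)))) (\<lambda>t. h (0, t))"
    by (rule parallel_slice[OF u c h]) (auto intro!: continuous_intros)
  then show thesis using that by simp
qed

lemma path_transition_in: "path_transition u p s t \<in> carrier G"
  by (simp add: path_transition_def)

lemma parallel_in: "parallel G E g h \<Longrightarrow> a \<in> E \<Longrightarrow> h a \<in> carrier G"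
  by (auto simp: parallel_def)

lemma holonomy_eq:
  assumes "parallel G {0..1} (path_transition u p) h"
  shows "holonomy u p = inv (h 0) \<otimes> h 1"
  unfolding holonomy_def
proof (rule some_equality)
  fix g assume "\<exists>h. parallel G {0..1} (path_transition u p) h \<and> g = inv (h 0) \<otimes> h 1"
  then obtain k where k: "parallel G {0..1} (path_transition u p) k" "g = inv (k 0) \<otimes> k 1" by blast
  have "k 0 \<otimes> inv (h 0) = k 1 \<otimes> inv (h 1)"
    by (rule parallel_unique[OF k(1) assms path_transition_in]) auto
  moreover have "h 0 \<in> carrier G" "h 1 \<in> carrier G" "k 0 \<in> carrier G" "k 1 \<in> carrier G"
    using parallel_in[OF assms] parallel_in[OF k(1)] by auto
  ultimately show "g = inv (h 0) \<otimes> h 1"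
    unfolding k(2) by (metis inv_closed inv_solve_left inv_solve_right m_assoc m_closed)
qed (use assms in blast)

lemma holonomy_in:
  assumes "norm u = 1" "continuous_map (top_of_set {0..1}) (configurations n) p"
  shows "holonomy u p \<in> carrier G"
proof -
  obtain h where h: "parallel G {0..1} (path_transition u p) h" using parallel_path[OF assms] .
  show ?thesis unfolding holonomy_eq[OF h] using parallel_in[OF h] by simp
qed

lemma parallel_const:
  assumes "norm u = 1" "finite x" "parallel G {0..1} (path_transition u p) h" "\<And>t. t \<in> {0..1} \<Longrightarrow> p t = x"
  shows "h 0 = h 1"
proof -
  have "u \<noteq> 0" using assms(1) by auto
  then have "path_transition u p s t = \<one>" if "s \<in> {0..1}" "t \<in> {0..1}" for s t
    using assms(2,4) that by (simp add: path_transition_def transition_refl)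
  then have "parallel G {0..1} (path_transition u p) (\<lambda>_. \<one>)"
    unfolding parallel_def by (auto simp: eventually_at_filter)
  from parallel_unique[OF assms(3) this path_transition_in, of 0 1]
  show ?thesis using parallel_in[OF assms(3)] by simp
qed

text \<open>A section over the whole homotopy restricts to sections along \<open>p\<close> and
  \<open>q\<close>, and has equal values at the ends of each of the two sides on which the
  configuration rests at \<open>x\<close>.\<close>

lemma holonomy_homotopic:
  assumes u: "norm u = 1" and pq: "(p, q) \<in> loop_homotopy (configurations n) x"
  shows "holonomy u p = holonomy u q"
proof -
  from pq obtain H where H1: "continuous_map (top_of_set ({0..1} \<times> {0..1})) (configurations n) H"
    and H2: "\<forall>t\<in>{0..1}. H (0, t) = p t \<and> H (1, t) = q t \<and> H (t, 0) = x \<and> H (t, 1) = x"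
    unfolding loop_homotopy_iff by (elim conjE exE)
  note H = H1 bspec[OF H2]
  have "H (0, 0) = x" using H(2)[of 0] by auto
  then have x: "finite x" using config_in[OF H(1), of "(0, 0)"] by auto
  obtain h where h: "parallel G ({0..1} \<times> {0..1}) (\<lambda>a b. lift (transition u (H a) (H b))) h"
    using parallel_square_configurations[OF u H(1)] .
  note slice = parallel_slice[OF u H(1) h]
  have 1: "parallel G {0..1} (path_transition u (\<lambda>t. H (s, t))) (\<lambda>t. h (s, t))"
    "parallel G {0..1} (path_transition u (\<lambda>t. H (t, s))) (\<lambda>t. h (t, s))" if "s \<in> {0..1}" for s
    using that by (auto intro!: slice continuous_intros)
  have p: "parallel G {0..1} (path_transition u p) (\<lambda>t. h (0, t))"
    using 1(1)[of 0] by (rule parallel_cong) (use H(2) in \<open>auto simp: path_transition_def\<close>)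
  have q: "parallel G {0..1} (path_transition u q) (\<lambda>t. h (1, t))"
    using 1(1)[of 1] by (rule parallel_cong) (use H(2) in \<open>auto simp: path_transition_def\<close>)
  have "h (0, 0) = h (1, 0)" "h (0, 1) = h (1, 1)"
    by (rule parallel_const[OF u x 1(2)]; use H(2) in auto)+
  then show ?thesis by (simp add: holonomy_eq[OF p] holonomy_eq[OF q])
qed

text \<open>A section along the joined loop restricts to sections along both parts, and its value at
  \<open>1/2\<close> cancels.\<close>

lemma holonomy_join:
  assumes u: "norm u = 1" and p: "p \<in> loops_at (configurations n) x" and q: "q \<in> loops_at (configurations n) x"
  shows "holonomy u (join_loops p q) = holonomy u p \<otimes> holonomy u q"
proof -
  have c: "continuous_map (top_of_set {0..1}) (configurations n) (join_loops p q)"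
    using join_loops_in[OF p q] by (simp add: loops_at_iff)
  obtain h where h: "parallel G {0..1} (path_transition u (join_loops p q)) h"
    using parallel_path[OF u c] .
  note slice = parallel_slice[OF u c h[unfolded path_transition_def]]
  have "parallel G {0..1} (path_transition u (\<lambda>t. join_loops p q (t / 2))) (\<lambda>t. h (t / 2))"
    by (rule slice) (auto intro!: continuous_intros)
  then have 1: "parallel G {0..1} (path_transition u p) (\<lambda>t. h (t / 2))"
    by (rule parallel_cong) (auto simp: path_transition_def join_loops_def)
  have eq: "join_loops p q ((t + 1) / 2) = q t" if "t \<in> {0..1}" for t
    using p q that by (cases "t = 0") (auto simp: join_loops_def loops_at_iff field_simps)
  have "parallel G {0..1} (path_transition u (\<lambda>t. join_loops p q ((t + 1) / 2))) (\<lambda>t. h ((t + 1) / 2))"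
    by (rule slice) (auto intro!: continuous_intros)
  then have 2: "parallel G {0..1} (path_transition u q) (\<lambda>t. h ((t + 1) / 2))"
    by (rule parallel_cong) (simp_all only: path_transition_def eq)
  have "h 0 \<in> carrier G" "h (1/2) \<in> carrier G" "h 1 \<in> carrier G"
    using parallel_in[OF h] by auto
  then show ?thesis
    unfolding holonomy_eq[OF h] holonomy_eq[OF 1] holonomy_eq[OF 2]
    by (simp add: m_assoc[symmetric]) (simp add: m_assoc)
qed

end

lemma transition_strings:
  assumes x: "finite x" and u: "u \<noteq> 0" and inj: "inj_on \<gamma> x" "inj_on \<gamma>' x"
    and near: "\<And>w. w \<in> x \<Longrightarrow> dist (\<gamma>' w) (\<gamma> w) < radius u (\<gamma> ` x)" and w: "w \<in> x"
  shows "transition u (\<gamma> ` x) (\<gamma>' ` x) (rank_in u (\<gamma>' ` x) (\<gamma>' w)) = rank_in u (\<gamma> ` x) (\<gamma> w)"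
proof -
  have "rank_in u (\<gamma>' ` x) (\<gamma>' w) < card (\<gamma> ` x)"
    using rank_in_less_card[of "\<gamma>' ` x" "\<gamma>' w" u] x w inj by (simp add: card_image)
  moreover have "nth_point u (\<gamma>' ` x) (rank_in u (\<gamma>' ` x) (\<gamma>' w)) = \<gamma>' w"
    using x u w by (intro nth_point) auto
  moreover have "close_point u (\<gamma> ` x) (\<gamma>' w) = \<gamma> w"
    using x w near by (intro close_point_eq) auto
  ultimately show ?thesis by (simp add: transition_def)
qed

lemma rank_in_strings:
  assumes "inj_on \<gamma> x" "w \<in> x"
  shows "rank_in u (\<gamma> ` x) (\<gamma> w) = card {v \<in> x. lexless u (\<gamma> v) (\<gamma> w)}"
proof -
  have "{v \<in> \<gamma> ` x. lexless u v (\<gamma> w)} = \<gamma> ` {v \<in> x. lexless u (\<gamma> v) (\<gamma> w)}" by auto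
  moreover have "inj_on \<gamma> {v \<in> x. lexless u (\<gamma> v) (\<gamma> w)}"
    using assms(1) by (rule inj_on_subset) auto
  ultimately show ?thesis unfolding rank_in_def by (simp add: card_image)
qed

section \<open>The holonomy of a half twist between neighbours\<close>

context braid_relations begin

text \<open>We choose the half turn so that the two points lie on a common vertical line, after the
  rotation by \<open>u\<close>, at time \<open>1/2\<close> only.\<close>

lemma holonomy_half_twist:
  assumes u: "norm u = 1" and x: "finite x" "card x = n" and gen: "inj_on (\<lambda>z. Re (u * z)) x"
    and ab: "a \<in> x" "b \<in> x" "rank_in u x b = Suc (rank_in u x a)" and no: "non_obstructing_pair x a b"
  obtains p where "p \<in> loops_at (configurations n) x" "half_twist x a b = loop_class (configurations n) x p"
    "holonomy u p = \<sigma> (rank_in u x a)"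
proof -
  have u0: "u \<noteq> 0" using u by auto
  define i where "i = rank_in u x a"
  have i: "Suc i < n" using rank_in_less_card[OF x(1) ab(2), of u] ab(3) x by (simp add: i_def)
  have lex: "lexless u z w \<longleftrightarrow> Re (u * z) < Re (u * w)" if "z \<in> x" "w \<in> x" for z w
    using gen that unfolding lexless_def by (auto dest: inj_onD)
  note rank = rank_in_less_iff[OF x(1) u0]
  have ne: "a \<noteq> b" using ab(3) by auto
  have less: "Re (u * a) < Re (u * b)" using rank[OF ab(1,2)] lex[OF ab(1,2)] ab(3) by simp
  have rank_inj: "z = w" if "rank_in u x z = rank_in u x w" "z \<in> x" "w \<in> x" for z w
    using bij_betw_imp_inj_on[OF bij_rank_in[OF x(1) u0]] that by (rule inj_onD)
  have others: "Re (u * w) < Re (u * a) \<or> Re (u * b) < Re (u * w)" if w: "w \<in> x" "w \<noteq> a" "w \<noteq> b" for w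
  proof -
    have "rank_in u x w \<noteq> rank_in u x a" "rank_in u x w \<noteq> rank_in u x b"
      using rank_inj w ab(1,2) by blast+
    then have "rank_in u x w < rank_in u x a \<or> rank_in u x b < rank_in u x w" using ab(3) by linarith
    then show ?thesis
      using rank[OF w(1) ab(1)] rank[OF ab(2) w(1)] lex[OF w(1) ab(1)] lex[OF ab(2) w(1)] by blast
  qed
  obtain r where r: "r > 0" "\<And>A B. twisting r a b A B \<Longrightarrow>
    pair_motion x a b A B \<in> loops_at (configurations (card x)) x \<and>
    half_twist x a b = braid_class x (pair_motion x a b A B)"
    by (rule half_twist_class[OF x(1) no]) blast
  \<comment> \<open>Chosen with \<open>u * v = - \<i> * of_real r\<close>: after the rotation the
    string from \<open>a\<close> bulges straight down. Both real parts are then affine in time and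
    agree only at \<open>1/2\<close>, when the string from \<open>a\<close> is the lower
    one.\<close>
  define v where "v = cnj u * (- \<i> * of_real r)"
  have uu: "u * cnj u = 1" using u by (simp add: complex_norm_square[symmetric])
  have uv: "u * v = - \<i> * of_real r" unfolding v_def using uu by (simp flip: mult.assoc)
  let ?A = "\<lambda>t. (1 - t) *\<^sub>R a + t *\<^sub>R b + (t * (1 - t)) *\<^sub>R v" and ?B = "\<lambda>t. (1 - t) *\<^sub>R b + t *\<^sub>R a"
  have tw: "twisting r a b ?A ?B"
  proof (rule arc_twisting[OF ne])
    have "cross (a - b) v = r * (Re (u * b) - Re (u * a))" by (simp add: v_def algebra_simps)
    then show "0 < cross (a - b) v" using r(1) less by simp
    show "norm v \<le> r" using r(1) u by (simp add: v_def norm_mult)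
  qed
  define p where "p = pair_motion x a b ?A ?B"
  have p: "p \<in> loops_at (configurations n) x" "half_twist x a b = loop_class (configurations n) x p"
    using r(2)[OF tw] x(2) by (auto simp: p_def)
  let ?\<gamma> = "\<lambda>t w. if w = a then ?A t else if w = b then ?B t else w"
  have img: "p t = ?\<gamma> t ` x" for t
    unfolding p_def by (rule pair_strings_image[OF ab(1,2) ne, symmetric])
  have inj: "inj_on (?\<gamma> t) x" if "t \<in> {0..1}" for t
  proof (rule eq_card_imp_inj_on[OF x(1)])
    have "continuous_map (top_of_set {0..1}) (configurations n) p" using p(1) by (simp add: loops_at_iff)
    from config_in[OF this that] show "card (?\<gamma> t ` x) = card x" using x by (simp only: img)
  qed
  have reA: "Re (u * ?A t) = (1 - t) * Re (u * a) + t * Re (u * b)"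
    and reB: "Re (u * ?B t) = (1 - t) * Re (u * b) + t * Re (u * a)" for t
  proof -
    have "u * ?A t = (1 - t) *\<^sub>R (u * a) + t *\<^sub>R (u * b) + (t * (1 - t)) *\<^sub>R (u * v)"
      "u * ?B t = (1 - t) *\<^sub>R (u * b) + t *\<^sub>R (u * a)"
      by (simp_all add: algebra_simps)
    then show "Re (u * ?A t) = (1 - t) * Re (u * a) + t * Re (u * b)"
      "Re (u * ?B t) = (1 - t) * Re (u * b) + t * Re (u * a)" by (simp_all add: uv)
  qed
  have between: "Re (u * a) \<le> Re (u * ?A t)" "Re (u * ?A t) \<le> Re (u * b)"
      "Re (u * a) \<le> Re (u * ?B t)" "Re (u * ?B t) \<le> Re (u * b)" if "t \<in> {0..1}" for t
  proof -
    have "0 \<le> t * (Re (u * b) - Re (u * a))" "0 \<le> (1 - t) * (Re (u * b) - Re (u * a))" using less that by auto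
    then show "Re (u * a) \<le> Re (u * ?A t)" "Re (u * ?A t) \<le> Re (u * b)"
      "Re (u * a) \<le> Re (u * ?B t)" "Re (u * ?B t) \<le> Re (u * b)"
      unfolding reA reB by (simp_all add: algebra_simps)
  qed
  have AB: "lexless u (?A t) (?B t)" if "t \<le> 1/2" for t
  proof (cases "t = 1/2")
    case True
    have "?B t - ?A t = - ((1 / 4) *\<^sub>R v)"
      unfolding True by (simp add: scaleR_conv_of_real field_simps)
    then have "u * ?B t - u * ?A t = - ((1 / 4) *\<^sub>R (u * v))"
      by (simp flip: right_diff_distrib)
    then have "u * ?B t - u * ?A t = of_real (r / 4) * \<i>"
      by (simp add: uv scaleR_conv_of_real)
    then have "Re (u * ?B t) - Re (u * ?A t) = 0" "Im (u * ?B t) - Im (u * ?A t) = r / 4"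
      by (simp_all only: minus_complex.sel[symmetric]) simp_all
    then show ?thesis using r(1) by (simp add: lexless_def)
  next
    case False
    then have "0 < (1 - 2 * t) * (Re (u * b) - Re (u * a))" using that less by simp
    then have "Re (u * ?A t) < Re (u * ?B t)" unfolding reA reB by (simp add: algebra_simps)
    then show ?thesis by (simp add: lexless_def)
  qed
  have BA: "lexless u (?B t) (?A t)" if "1/2 < t" for t
  proof -
    have "0 < (2 * t - 1) * (Re (u * b) - Re (u * a))" using that less by simp
    then have "Re (u * ?B t) < Re (u * ?A t)" unfolding reA reB by (simp add: algebra_simps)
    then show ?thesis by (simp add: lexless_def)
  qed
  have asym: "\<not> lexless u w z" if "lexless u z w" for z w using that by (auto simp: lexless_def)
  have other_left: "lexless u w (?\<gamma> t y) \<longleftrightarrow> Re (u * w) < Re (u * a)" "lexless u w y \<longleftrightarrow> Re (u * w) < Re (u * a)"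
    and other_right: "lexless u (?\<gamma> t y) w \<longleftrightarrow> Re (u * b) < Re (u * w)" "lexless u y w \<longleftrightarrow> Re (u * b) < Re (u * w)"
    if "w \<in> x" "w \<noteq> a" "w \<noteq> b" "y = a \<or> y = b" "t \<in> {0..1}" for w y t
    using others[OF that(1-3)] between[OF that(5)] that(4) ne less by (auto simp: lexless_def)
  have irrefl: "\<not> lexless u z z" for z by (simp add: lexless_def)
  have ab_less: "lexless u a b" using less by (simp add: lexless_def)
  have rank_early: "rank_in u (p t) (?\<gamma> t w) = rank_in u x w" if t: "0 \<le> t" "t \<le> 1/2" and w: "w \<in> x" for t w
  proof -
    have t': "t \<in> {0..1}" using t by auto
    have cmp: "lexless u (?\<gamma> t v) (?\<gamma> t w) \<longleftrightarrow> lexless u v w" if v: "v \<in> x" for v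
    proof -
      consider "v = a" "w = a" | "v = a" "w = b" | "v = b" "w = a" | "v = b" "w = b"
        | "v \<noteq> a" "v \<noteq> b" "w = a \<or> w = b" | "w \<noteq> a" "w \<noteq> b" "v = a \<or> v = b"
        | "v \<noteq> a" "v \<noteq> b" "w \<noteq> a" "w \<noteq> b" by blast
      then show ?thesis
      proof cases
        case 5
        then show ?thesis using other_left[OF v 5 t'] by (simp only: if_False simp_thms)
      next
        case 6
        then show ?thesis using other_right[OF w 6 t'] by (simp only: if_False simp_thms)
      qed (use AB[OF t(2)] asym irrefl ab_less ne in simp_all)
    qed
    have "{v \<in> x. lexless u (?\<gamma> t v) (?\<gamma> t w)} = {v \<in> x. lexless u v w}"
      by (rule Collect_cong, rule conj_cong[OF HOL.refl], rule cmp)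
    then show ?thesis
      unfolding img rank_in_strings[OF inj[OF t'] w] by (simp only: rank_in_def)
  qed
  have rank_late: "rank_in u (p t) (?\<gamma> t w) = adj i (rank_in u x w)" if t: "1/2 < t" "t \<le> 1" and w: "w \<in> x" for t w
  proof -
    have t': "t \<in> {0..1}" using t by auto
    \<comment> \<open>Past time \<open>1/2\<close> the strings from \<open>a\<close> and
      \<open>b\<close> have exchanged their places in the order, so the order is that of
      \<open>x\<close> relabelled by this transposition.\<close>
    let ?s = "Transposition.transpose a b"
    have sx: "?s w \<in> x" using w ab by (auto simp: Transposition.transpose_def)
    have cmp: "lexless u (?\<gamma> t v) (?\<gamma> t w) \<longleftrightarrow> lexless u (?s v) (?s w)" if v: "v \<in> x" for v
    proof -
      consider "v = a" "w = a" | "v = a" "w = b" | "v = b" "w = a" | "v = b" "w = b"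
        | "v \<noteq> a" "v \<noteq> b" "w = a \<or> w = b" | "w \<noteq> a" "w \<noteq> b" "v = a \<or> v = b"
        | "v \<noteq> a" "v \<noteq> b" "w \<noteq> a" "w \<noteq> b" by blast
      then show ?thesis
      proof cases
        case 5
        then have s: "?s v = v" "?s w = a \<or> ?s w = b" by auto
        show ?thesis unfolding s(1) using 5 other_left(1)[OF v 5 t'] other_left(2)[OF v 5(1,2) s(2) t'] by (simp only: if_False simp_thms)
      next
        case 6
        then have s: "?s w = w" "?s v = a \<or> ?s v = b" by auto
        show ?thesis unfolding s(1) using 6 other_right(1)[OF w 6 t'] other_right(2)[OF w 6(1,2) s(2) t'] by (simp only: if_False simp_thms)
      qed (use BA[OF t(1)] asym irrefl ab_less ne in simp_all)
    qed
    have "{v \<in> x. lexless u (?\<gamma> t v) (?\<gamma> t w)} = {v \<in> x. lexless u (?s v) (?s w)}"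
      by (rule Collect_cong, rule conj_cong[OF HOL.refl], rule cmp)
    then have "rank_in u (p t) (?\<gamma> t w) = card {v \<in> x. lexless u (?s v) (?s w)}"
      unfolding img rank_in_strings[OF inj[OF t'] w] by (simp only:)
    also have "\<dots> = card (?s ` {v \<in> x. lexless u (?s v) (?s w)})"
      by (intro card_image[symmetric] inj_on_subset[OF inj_transpose]) auto
    also have "?s ` {v \<in> x. lexless u (?s v) (?s w)} = {v \<in> x. lexless u v (?s w)}"
    proof -
      have sx': "?s v \<in> x \<longleftrightarrow> v \<in> x" for v using ab by (auto simp: Transposition.transpose_def)
      have "y \<in> ?s ` {v \<in> x. lexless u (?s v) (?s w)}" if "y \<in> {v \<in> x. lexless u v (?s w)}" for y
      proof -
        have "?s y \<in> {v \<in> x. lexless u (?s v) (?s w)}" using that sx' by simp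
        then have "?s (?s y) \<in> ?s ` {v \<in> x. lexless u (?s v) (?s w)}" by (rule imageI)
        then show ?thesis by simp
      qed
      then show ?thesis using sx' by auto
    qed
    also have "card \<dots> = rank_in u x (?s w)" by (simp add: rank_in_def)
    also have "\<dots> = adj i (rank_in u x w)"
    proof -
      have "rank_in u x w \<noteq> rank_in u x a" if "w \<noteq> a"
        using rank_inj that w ab(1,2) by blast
      moreover have "rank_in u x w \<noteq> rank_in u x b" if "w \<noteq> b"
        using rank_inj that w ab(1,2) by blast
      ultimately show ?thesis using ab(3) by (auto simp: Transposition.transpose_def i_def)
    qed
    finally show ?thesis .
  qed
  \<comment> \<open>Up to and including time \<open>1/2\<close> the order is that of
    \<open>x\<close>, afterwards two neighbours are exchanged. The section is therefore constant
    apart from one jump by \<open>\<sigma> i\<close>.\<close>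
  define h where "h t = (if t \<le> 1/2 then \<one> else \<sigma> i)" for t :: real
  have "parallel G {0..1} (path_transition u p) h"
    unfolding parallel_def
  proof (intro ballI conjI)
    fix s :: real assume s: "s \<in> {0..1}"
    show "h s \<in> carrier G" using i by (simp add: h_def)
    have fin: "finite (p s)" unfolding img using x by simp
    have "continuous_on {0..1} (\<lambda>t. ?\<gamma> t w)" for w
      by (cases "w = a"; cases "w = b"; simp add: continuous_intros)
    then have tend: "((\<lambda>t. ?\<gamma> t w) \<longlongrightarrow> ?\<gamma> s w) (at s within {0..1})" for w
      using s by (simp add: continuous_on_def)
    have "\<forall>\<^sub>F t in at s within {0..1}. \<forall>w\<in>x. dist (?\<gamma> t w) (?\<gamma> s w) < radius u (p s)"
      by (intro eventually_ball_finite x ballI tendstoD[OF tend] radius_pos fin)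
    moreover have "\<forall>\<^sub>F t in at s within {0..1}. 1/2 < s \<longrightarrow> 1/2 < t"
    proof (cases "1/2 < s")
      case True
      have "((\<lambda>t. t) \<longlongrightarrow> s) (at s within {0..1})" by (rule tendsto_ident_at)
      from order_tendstoD(1)[OF this True] show ?thesis by (auto elim: eventually_mono)
    qed simp
    moreover have "\<forall>\<^sub>F t in at s within {0..1}. t \<in> {0..1}" by (simp add: eventually_at_filter)
    ultimately show "\<forall>\<^sub>F t in at s within {0..1}. h t = h s \<otimes> path_transition u p s t"
    proof eventually_elim
      case (elim t)
      have card: "card (p s) = n" unfolding img using card_image[OF inj[OF s]] x by simp
      have trans: "transition u (p s) (p t) (rank_in u (p t) (?\<gamma> t w)) = rank_in u (p s) (?\<gamma> s w)" if "w \<in> x" for w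
        unfolding img by (rule transition_strings[OF x(1) u0 inj[OF s] inj[OF elim(3)] _ that]) (use elim(1) in \<open>simp only: img\<close>)
      have surj: "\<exists>w\<in>x. k = rank_in u x w" if "k < n" for k
        using bij_betw_imp_surj_on[OF bij_rank_in[OF x(1) u0]] that x(2) by (metis imageE lessThan_iff)
      show ?case
      proof (cases "s \<le> 1/2 \<longleftrightarrow> t \<le> 1/2")
        case True
        have "transition u (p s) (p t) = id"
        proof
          fix k
          show "transition u (p s) (p t) k = id k"
          proof (cases "k < n")
            case k: True
            show ?thesis
            proof (cases "t \<le> 1/2")
              case early: True
              obtain w where "w \<in> x" "k = rank_in u x w" using surj[OF k] by blast
              then show ?thesis using trans[of w] rank_early early True s elim(3) by simp
            next
              case late: False
              have "adj i k < n" using adj_less[OF i k] .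
              then obtain w where w: "w \<in> x" "adj i k = rank_in u x w" using surj by blast
              then have "k = adj i (rank_in u x w)" by (metis transpose_involutory)
              then show ?thesis using trans[of w] w(1) rank_late late True s elim(3) by simp
            qed
          qed (simp add: transition_def card)
        qed
        then have "path_transition u p s t = \<one>" by (simp add: path_transition_def)
        then show ?thesis using True i by (auto simp: h_def)
      next
        case False
        \<comment> \<open>For \<open>s\<close> beyond \<open>1/2\<close> all nearby \<open>t\<close>
          are beyond it too, so only the passage from the early to the late order is left; its
          transition is \<open>adj i\<close> and not an inverse.\<close>
        then have st: "s \<le> 1/2" "1/2 < t" using elim(2) by auto
        have "transition u (p s) (p t) = adj i"
        proof
          fix k
          show "transition u (p s) (p t) k = adj i k"
          proof (cases "k < n")
            case k: True
            have "adj i k < n" using adj_less[OF i k] .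
            then obtain w where w: "w \<in> x" "adj i k = rank_in u x w" using surj by blast
            then have "k = adj i (rank_in u x w)" by (metis transpose_involutory)
            then show ?thesis using trans[of w] w rank_late[of t w] rank_early[of s w] st s elim(3) by simp
          next
            case False
            then show ?thesis using i by (simp add: transition_def card Transposition.transpose_def)
          qed
        qed
        then have "path_transition u p s t = \<sigma> i" using i by (simp add: path_transition_def lift_adj)
        then show ?thesis using st i by (simp add: h_def)
      qed
    qed
  qed
  from holonomy_eq[OF this] have "holonomy u p = \<sigma> i" using i by (simp add: h_def)
  then show thesis using that p by (simp add: i_def)
qed

theorem holonomy_morphism:
  assumes u: "norm u = 1" and x: "finite x" "card x = n" and gen: "inj_on (\<lambda>z. Re (u * z)) x"
  obtains \<Phi> where "\<Phi> \<in> hom (braid_group x) G"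
    "\<And>a b. a \<in> x \<Longrightarrow> b \<in> x \<Longrightarrow> rank_in u x b = Suc (rank_in u x a) \<Longrightarrow> non_obstructing_pair x a b \<Longrightarrow>
       \<Phi> (half_twist x a b) = \<sigma> (rank_in u x a)"
proof
  define \<Phi> where "\<Phi> b = holonomy u (SOME p. p \<in> b)" for b :: braid
  have Phi_class: "\<Phi> (loop_class (configurations n) x p) = holonomy u p" if p: "p \<in> loops_at (configurations n) x" for p
  proof -
    have "p \<in> loop_class (configurations n) x p"
      using equiv_class_self[OF equiv_loop_homotopy p] .
    then have "(SOME q. q \<in> loop_class (configurations n) x p) \<in> loop_class (configurations n) x p" unfolding some_in_eq by blast
    then have "(p, SOME q. q \<in> loop_class (configurations n) x p) \<in> loop_homotopy (configurations n) x" by simp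
    from holonomy_homotopic[OF u this] show ?thesis by (simp add: \<Phi>_def)
  qed
  have G: "braid_group x = fundamental_group (configurations n) x" by (simp add: braid_group_def x)
  show "\<Phi> \<in> hom (braid_group x) G"
    unfolding G
  proof (rule homI)
    fix b assume "b \<in> carrier (fundamental_group (configurations n) x)"
    then obtain p where p: "p \<in> loops_at (configurations n) x" "b = loop_class (configurations n) x p"
      by (rule fundamental_group_elem)
    show "\<Phi> b \<in> carrier G" unfolding p(2) Phi_class[OF p(1)] using p(1) by (intro holonomy_in[OF u]) (simp add: loops_at_iff)
    fix c assume "c \<in> carrier (fundamental_group (configurations n) x)"
    then obtain q where q: "q \<in> loops_at (configurations n) x" "c = loop_class (configurations n) x q"
      by (rule fundamental_group_elem)
    show "\<Phi> (b \<otimes>\<^bsub>fundamental_group (configurations n) x\<^esub> c) = \<Phi> b \<otimes> \<Phi> c"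
      unfolding p(2) q(2) fundamental_group_mult[OF p(1) q(1)] Phi_class[OF p(1)] Phi_class[OF q(1)] Phi_class[OF join_loops_in[OF p(1) q(1)]]
      by (rule holonomy_join[OF u p(1) q(1)])
  qed
  show "\<Phi> (half_twist x a b) = \<sigma> (rank_in u x a)"
    if ab: "a \<in> x" "b \<in> x" "rank_in u x b = Suc (rank_in u x a)" "non_obstructing_pair x a b" for a b
  proof -
    obtain p where p: "p \<in> loops_at (configurations n) x" "half_twist x a b = loop_class (configurations n) x p"
      "holonomy u p = \<sigma> (rank_in u x a)"
      using holonomy_half_twist[OF u x gen ab] .
    show ?thesis unfolding p(2) Phi_class[OF p(1)] by (rule p(3))
  qed
qed

end

section \<open>Configurations on the unit circle\<close>

text \<open>The disc is strictly convex: a point of an open segment is closer to the centre than one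
  of the ends.\<close>

lemma circle_extreme_point:
  fixes w :: complex
  assumes "norm w = 1" "S \<subseteq> sphere 0 1" "w \<in> convex hull S"
  shows "w extreme_point_of (convex hull S)"
proof -
  have "S \<subseteq> cball 0 1" using assms(2) by auto
  then have hull: "convex hull S \<subseteq> cball 0 1" by (rule hull_minimal) (rule convex_cball)
  have "w \<notin> open_segment a b" if "a \<in> convex hull S" "b \<in> convex hull S" for a b
  proof
    assume "w \<in> open_segment a b"
    then have "dist 0 w < dist 0 a \<or> dist 0 w < dist 0 b" by (rule dist_decreases_open_segment)
    then show False using that hull assms(1) by auto
  qed
  then show ?thesis using assms(3) by (simp add: extreme_point_of_def)
qed

lemma circle_hull_mem:
  fixes w :: complex
  assumes "norm w = 1" "S \<subseteq> sphere 0 1" "w \<in> convex hull S" shows "w \<in> S"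
  using extreme_point_of_convex_hull[OF circle_extreme_point[OF assms]] .

lemma circle_not_collinear:
  assumes "{a, b, c} \<subseteq> sphere 0 (1::real)" "a \<noteq> b" "b \<noteq> c" "a \<noteq> c"
  shows "\<not> collinear {a, b, c :: complex}"
proof -
  have "\<not> between (p, q) w" if "norm p = 1" "norm q = 1" "norm w = 1" "w \<noteq> p" "w \<noteq> q" for p q w :: complex
    using circle_hull_mem[of w "{p, q}"] that by (auto simp: between_mem_segment segment_convex_hull)
  then show ?thesis using assms unfolding collinear_between_cases by auto
qed

lemma circle_convex_part:
  assumes "finite v" "v \<noteq> {}" "v \<subseteq> sphere 0 1" shows "convex_part v"
proof -
  have "v = {z. z extreme_point_of (convex hull v)}"
  proof (intro equalityI subsetI)
    fix z assume "z \<in> v"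
    then have "norm z = 1" "z \<in> convex hull v" using assms(3) hull_subset[of v convex] by auto
    then show "z \<in> {z. z extreme_point_of (convex hull v)}" using circle_extreme_point[OF _ assms(3)] by simp
  qed (use extreme_point_of_convex_hull in blast)
  moreover have "\<not> collinear {a, b, c}" if "a \<in> v" "b \<in> v" "c \<in> v" "a \<noteq> b" "b \<noteq> c" "a \<noteq> c" for a b c
    using that assms(3) by (intro circle_not_collinear) auto
  moreover have "card v \<noteq> 0" using assms by simp
  ultimately show ?thesis unfolding convex_part_def by (cases "card v = 1"; cases "card v = 2") auto
qed

lemma circle_non_obstructing_pair:
  assumes "x \<subseteq> sphere 0 1" "a \<in> x" "b \<in> x" "a \<noteq> b" shows "non_obstructing_pair x a b"
proof -
  have "w \<in> {a, b}" if "w \<in> closed_segment a b" "w \<in> x" for w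
  proof (rule circle_hull_mem)
    show "norm w = 1" "{a, b} \<subseteq> sphere 0 1" using that assms by auto
    show "w \<in> convex hull {a, b}" using that(1) unfolding segment_convex_hull .
  qed
  then show ?thesis using assms by (auto simp: non_obstructing_pair_def)
qed

section \<open>Products along lists and clockwise lists\<close>

lemma list_product_Nil [simp]: "list_product H [] = \<one>\<^bsub>H\<^esub>"
  and list_product_Cons [simp]: "list_product H (a # w) = a \<otimes>\<^bsub>H\<^esub> list_product H w"
  by (simp_all add: list_product_def)

lemma (in monoid) list_product_in: "set w \<subseteq> carrier G \<Longrightarrow> list_product G w \<in> carrier G"
  by (induction w) auto

lemma (in monoid) list_product_append:
  "set u \<subseteq> carrier G \<Longrightarrow> set w \<subseteq> carrier G \<Longrightarrow> list_product G (u @ w) = list_product G u \<otimes> list_product G w"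
  by (induction u) (auto simp: m_assoc list_product_in)

text \<open>The recursive form of \<open>clockwise_enumeration\<close>, suited to induction: the
  rest of the list is in clockwise order as seen from its head.\<close>

fun clockwise_list :: "complex list \<Rightarrow> bool" where
  "clockwise_list [] \<longleftrightarrow> True"
| "clockwise_list (z # zs) \<longleftrightarrow> z \<notin> set zs \<and> sorted_wrt (\<lambda>a b. cross (a - z) (b - z) < 0) zs \<and> clockwise_list zs"

lemma clockwise_enumeration_Cons:
  "clockwise_enumeration (set (z # zs)) (z # zs) \<longleftrightarrow>
     z \<notin> set zs \<and> sorted_wrt (\<lambda>a b. cross (a - z) (b - z) < 0) zs \<and> clockwise_enumeration (set zs) zs"
proof -
  have "(\<forall>i j l. i < j \<and> j < l \<and> l < length (z # zs) \<longrightarrow> cross ((z # zs) ! j - (z # zs) ! i) ((z # zs) ! l - (z # zs) ! i) < 0)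
    \<longleftrightarrow> (\<forall>j l. j < l \<and> l < length zs \<longrightarrow> cross (zs ! j - z) (zs ! l - z) < 0) \<and>
      (\<forall>i j l. i < j \<and> j < l \<and> l < length zs \<longrightarrow> cross (zs ! j - zs ! i) (zs ! l - zs ! i) < 0)" (is "?L \<longleftrightarrow> ?R")
  proof
    assume L: ?L
    show ?R
    proof (intro conjI allI impI)
      fix j l assume "j < l \<and> l < length zs"
      then show "cross (zs ! j - z) (zs ! l - z) < 0" using L[rule_format, of 0 "Suc j" "Suc l"] by simp
    next
      fix i j l assume "i < j \<and> j < l \<and> l < length zs"
      then show "cross (zs ! j - zs ! i) (zs ! l - zs ! i) < 0" using L[rule_format, of "Suc i" "Suc j" "Suc l"] by simp
    qed
  next
    assume R: ?R
    show ?L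
    proof (intro allI impI)
      fix i j l assume "i < j \<and> j < l \<and> l < length (z # zs)"
      then obtain j' l' where "j = Suc j'" "l = Suc l'" "i < Suc j'" "j' < l'" "l' < length zs"
        by (cases j; cases l) auto
      then show "cross ((z # zs) ! j - (z # zs) ! i) ((z # zs) ! l - (z # zs) ! i) < 0"
        using R by (cases i) auto
    qed
  qed
  then show ?thesis
    unfolding clockwise_enumeration_def sorted_wrt_iff_nth_less by auto
qed

lemma clockwise_enumeration_iff: "clockwise_enumeration v zs \<longleftrightarrow> set zs = v \<and> clockwise_list zs"
proof -
  have "clockwise_enumeration (set zs) zs \<longleftrightarrow> clockwise_list zs"
  proof (induction zs)
    case (Cons z zs)
    then show ?case using clockwise_enumeration_Cons[of z zs] by simp
  qed (simp add: clockwise_enumeration_def)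
  then show ?thesis by (auto simp: clockwise_enumeration_def)
qed

lemma clockwise_list_appendD: "clockwise_list (xs @ ys) \<Longrightarrow> clockwise_list xs \<and> clockwise_list ys"
  by (induction xs) (auto simp: sorted_wrt_append)

lemma cross_rotate: "cross (b - a) (c - a) = cross (c - b) (a - b)"
  by (simp add: algebra_simps)

lemma cross_swap: "cross (b - a) (c - a) = - cross (c - a) (b - a)"
  by (simp add: algebra_simps)

text \<open>A list may as well be judged from its last element, since the orientation of a triple is
  invariant under cyclic rotation. Invariance under rotation of the list follows.\<close>

lemma clockwise_list_snoc:
  "clockwise_list (zs @ [z]) \<longleftrightarrow> z \<notin> set zs \<and> sorted_wrt (\<lambda>a b. cross (a - z) (b - z) < 0) zs \<and> clockwise_list zs"
proof (induction zs)
  case (Cons a zs)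
  have "cross (a - z) (c - z) < 0 \<longleftrightarrow> cross (c - a) (z - a) < 0" for c
    using cross_rotate[where a = z and b = a and c = c] by (simp only:)
  then show ?case
    using Cons by (auto simp: sorted_wrt_append simp del: times_complex.sel)
qed simp

lemma clockwise_list_rotate: "clockwise_list (xs @ ys) \<Longrightarrow> clockwise_list (ys @ xs)"
proof (induction xs arbitrary: ys)
  case (Cons z xs)
  then have "clockwise_list ((xs @ ys) @ [z])"
    unfolding clockwise_list_snoc by simp
  then show ?case using Cons.IH[of "ys @ [z]"] by simp
qed simp

lemma sorted_wrt_unique:
  assumes "sorted_wrt R xs" "sorted_wrt R ys" "set xs = set ys"
    and "\<And>a b. R a b \<Longrightarrow> \<not> R b a"
  shows "xs = ys"
  using assms(1-3)
proof (induction xs arbitrary: ys)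
  case (Cons z xs)
  then obtain y ys' where ys: "ys = y # ys'" by (cases ys) auto
  have "z = y"
  proof (rule ccontr)
    assume "z \<noteq> y"
    then have "z \<in> set ys'" "y \<in> set xs" using Cons.prems(3) ys by auto
    then show False using Cons.prems(1,2) ys assms(4) by auto
  qed
  moreover have "z \<notin> set xs" "y \<notin> set ys'" using Cons.prems(1,2) ys assms(4) by auto
  ultimately have "set xs = set ys'" using Cons.prems(3) ys by (simp add: insert_ident)
  then show ?case using Cons \<open>z = y\<close> ys by simp
qed simp

section \<open>Products of half twists along clockwise lists\<close>

locale circle_configuration =
  fixes x :: "complex set"
  assumes finite_x: "finite x" and on_circle: "x \<subseteq> sphere 0 1"
begin

abbreviation H :: "braid monoid" where "H \<equiv> braid_group x"

sublocale H: monoid H by (rule monoid_braid_group[OF finite_x])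

abbreviation ht :: "complex \<Rightarrow> complex \<Rightarrow> braid" where "ht \<equiv> half_twist x"

lemma norm_x: "z \<in> x \<Longrightarrow> norm z = 1"
  using on_circle by auto

lemma no_pair: "a \<in> x \<Longrightarrow> b \<in> x \<Longrightarrow> a \<noteq> b \<Longrightarrow> non_obstructing_pair x a b"
  by (rule circle_non_obstructing_pair[OF on_circle])

lemma ht_in: "a \<in> x \<Longrightarrow> b \<in> x \<Longrightarrow> a \<noteq> b \<Longrightarrow> ht a b \<in> carrier H"
  by (rule half_twist_in[OF finite_x no_pair])

lemma ht_triangle:
  assumes "a \<in> x" "b \<in> x" "c \<in> x" "cross (b - a) (c - a) < 0"
  shows "ht a b \<otimes>\<^bsub>H\<^esub> ht b c = ht b c \<otimes>\<^bsub>H\<^esub> ht c a"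
proof -
  have ne: "a \<noteq> b" "b \<noteq> c" "a \<noteq> c" using assms(4) by (auto simp: algebra_simps)
  have out: "w \<notin> convex hull {a, b, c}" if "w \<in> x - {a, b, c}" for w
    using circle_hull_mem[of w "{a, b, c}"] that assms(1-3) norm_x by auto
  have "ht a b \<otimes>\<^bsub>H\<^esub> ht b c = braid_class x (triangle_rotation x a b c)"
    by (rule half_twist_triangle[OF finite_x assms no_pair no_pair out]) (use assms ne in auto)
  also have "\<dots> = braid_class x (triangle_rotation x b c a)"
    by (simp only: triangle_rotation_rotate[of x a b c])
  also have "\<dots> = ht b c \<otimes>\<^bsub>H\<^esub> ht c a"
  proof (rule half_twist_triangle[OF finite_x assms(2,3,1), symmetric])
    show "cross (c - b) (a - b) < 0" using assms(4) unfolding cross_rotate[of b a c] .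
    show "w \<notin> convex hull {b, c, a}" if "w \<in> x - {b, c, a}" for w
    proof -
      have "{b, c, a} = {a, b, c}" by auto
      then show ?thesis using out[of w] that by simp
    qed
  qed (use assms ne no_pair in auto)
  finally show ?thesis .
qed

definition chain :: "complex list \<Rightarrow> braid" where
  "chain zs = list_product H (map2 ht zs (tl zs))"

lemma chain_simps [simp]:
  "chain [] = \<one>\<^bsub>H\<^esub>" "chain [z] = \<one>\<^bsub>H\<^esub>" "chain (z # w # zs) = ht z w \<otimes>\<^bsub>H\<^esub> chain (w # zs)"
  by (simp_all add: chain_def)

lemma chain_in: "set zs \<subseteq> x \<Longrightarrow> distinct zs \<Longrightarrow> chain zs \<in> carrier H"
  by (induction zs rule: induct_list012) (auto simp: ht_in)

lemma chain_append:
  "set (xs @ z # ys) \<subseteq> x \<Longrightarrow> distinct (xs @ z # ys) \<Longrightarrow> chain (xs @ z # ys) = chain (xs @ [z]) \<otimes>\<^bsub>H\<^esub> chain (z # ys)"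
  by (induction xs rule: induct_list012) (auto simp: ht_in chain_in H.m_assoc)

lemma clockwise_list_distinct: "clockwise_list zs \<Longrightarrow> distinct zs"
  by (induction zs) auto

text \<open>The first factor of the chain is pushed through to the end, one triangle at a time.\<close>

lemma chain_rotate1:
  assumes "clockwise_list (z # zs)" "set (z # zs) \<subseteq> x" shows "chain (z # zs) = chain (zs @ [z])"
proof -
  have push: "ht z w \<otimes>\<^bsub>H\<^esub> chain (w # ws) = chain (w # ws @ [z])"
    if "clockwise_list (z # w # ws)" "set (z # w # ws) \<subseteq> x" for w ws
    using that
  proof (induction ws arbitrary: w)
    case Nil
    then show ?case using ht_in half_twist_commute[of x z w] by simp
  next
    case (Cons v ws)
    then have in_x: "z \<in> x" "w \<in> x" "v \<in> x" and ne: "z \<noteq> w" "w \<noteq> v" "z \<noteq> v"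
      and cw: "cross (w - z) (v - z) < 0" by auto
    have ch: "chain (v # ws) \<in> carrier H" using Cons.prems clockwise_list_distinct by (intro chain_in) auto
    have "ht z w \<otimes>\<^bsub>H\<^esub> chain (w # v # ws) = ht z w \<otimes>\<^bsub>H\<^esub> ht w v \<otimes>\<^bsub>H\<^esub> chain (v # ws)"
      using in_x ne ch ht_in by (simp add: H.m_assoc)
    also have "\<dots> = ht w v \<otimes>\<^bsub>H\<^esub> (ht z v \<otimes>\<^bsub>H\<^esub> chain (v # ws))"
      using in_x ne ch ht_in ht_triangle[OF in_x cw] half_twist_commute[of x v z] by (simp add: H.m_assoc)
    also have "ht z v \<otimes>\<^bsub>H\<^esub> chain (v # ws) = chain (v # ws @ [z])"
      using Cons.prems by (intro Cons.IH) auto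
    finally show ?case by simp
  qed
  show ?thesis
  proof (cases zs)
    case (Cons w ws)
    then show ?thesis using push[of w ws] assms by simp
  qed simp
qed

lemma chain_rotate:
  assumes "clockwise_list (xs @ ys)" "set (xs @ ys) \<subseteq> x" shows "chain (xs @ ys) = chain (ys @ xs)"
  using assms
proof (induction xs arbitrary: ys)
  case (Cons z xs)
  have "chain ((z # xs) @ ys) = chain ((xs @ ys) @ [z])"
    using chain_rotate1[of z "xs @ ys"] Cons.prems by simp
  also have "\<dots> = chain ((ys @ [z]) @ xs)"
    using Cons.IH[of "ys @ [z]"] Cons.prems clockwise_list_rotate[of "[z]" "xs @ ys"] by simp
  finally show ?case by simp
qed simp

text \<open>Clockwise lists of the same set differ by a rotation: once both start at
  \<open>z\<close>, the order of the other points as seen from \<open>z\<close> determines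
  them.\<close>

lemma chain_unique:
  assumes "clockwise_list xs" "clockwise_list ys" "set xs = set ys" "set xs \<subseteq> x" shows "chain xs = chain ys"
proof (cases xs)
  case Nil
  then show ?thesis using assms by simp
next
  case (Cons z zs)
  then obtain p q where ys: "ys = p @ z # q" using assms(3) by (metis list.set_intros(1) split_list)
  have rot: "clockwise_list (z # q @ p)" using clockwise_list_rotate[of p "z # q"] assms(2) ys by simp
  have "set zs = set (q @ p)"
  proof -
    have "z \<notin> set zs" "z \<notin> set (q @ p)" using assms(1) Cons rot by auto
    moreover have "insert z (set zs) = insert z (set (q @ p))" using assms(3) Cons ys by auto
    ultimately show ?thesis by (metis insert_ident)
  qed
  moreover have "\<not> cross (b - z) (a - z) < 0" if "cross (a - z) (b - z) < 0" for a b
    using that cross_swap[of a z b] by linarith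
  ultimately have "zs = q @ p"
    using sorted_wrt_unique[of "\<lambda>a b. cross (a - z) (b - z) < 0" zs "q @ p"] assms(1) Cons rot by auto
  then show ?thesis using chain_rotate[of p "z # q"] assms(2-4) Cons ys by simp
qed

lemma part_braid_eq_chain:
  assumes "clockwise_list zs" "set zs = v" "v \<subseteq> x" shows "part_braid x v = chain zs"
proof -
  have "clockwise_enumeration v (SOME zs. clockwise_enumeration v zs)"
    by (rule someI[of _ zs]) (simp add: clockwise_enumeration_iff assms)
  then have "chain (SOME zs. clockwise_enumeration v zs) = chain zs"
    using assms by (intro chain_unique) (auto simp: clockwise_enumeration_iff)
  then show ?thesis by (simp add: part_braid_def chain_def Let_def)
qed

text \<open>A polygon is cut along the chord from \<open>a\<close> to \<open>b\<close>. The chain is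
  broken at \<open>b\<close>, and its first piece is rotated so as to start there; the first edge of
  that piece is then the chord.\<close>

lemma part_braid_split:
  assumes "clockwise_list ((a # as) @ (b # bs))" "set ((a # as) @ (b # bs)) \<subseteq> x"
  shows "part_braid x (set ((a # as) @ (b # bs)))
    = ht a b \<otimes>\<^bsub>H\<^esub> part_braid x (set (a # as)) \<otimes>\<^bsub>H\<^esub> part_braid x (set (b # bs))"
proof -
  note dist = clockwise_list_distinct[OF assms(1)]
  have cw: "clockwise_list (a # as)" "clockwise_list (b # bs)" using clockwise_list_appendD[OF assms(1)] by auto
  have cw': "clockwise_list (a # as @ [b])"
    using clockwise_list_appendD[of "a # as @ [b]" bs] assms(1) by simp
  have "part_braid x (set ((a # as) @ (b # bs))) = chain ((a # as) @ b # bs)"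
    by (rule part_braid_eq_chain[OF assms(1) HOL.refl assms(2)])
  also have "\<dots> = chain ((a # as) @ [b]) \<otimes>\<^bsub>H\<^esub> chain (b # bs)"
    using dist assms(2) by (intro chain_append) auto
  also have "chain ((a # as) @ [b]) = chain (b # a # as)"
    using chain_rotate[of "a # as" "[b]"] cw' assms(2) by simp
  also have "\<dots> = ht a b \<otimes>\<^bsub>H\<^esub> chain (a # as)" by (simp add: half_twist_commute)
  also have "chain (a # as) = part_braid x (set (a # as))"
    using assms(2) by (intro part_braid_eq_chain[OF cw(1), symmetric]) auto
  also have "chain (b # bs) = part_braid x (set (b # bs))"
    using assms(2) by (intro part_braid_eq_chain[OF cw(2), symmetric]) auto
  finally show ?thesis .
qed

end

section \<open>Noncrossing partitions of points on a circle\<close>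

lemma (in monoid) list_product_commute1:
  assumes "a \<in> carrier G" "set w \<subseteq> carrier G" "\<And>b. b \<in> set w \<Longrightarrow> a \<otimes> b = b \<otimes> a"
  shows "a \<otimes> list_product G w = list_product G w \<otimes> a"
  using assms(2,3)
proof (induction w)
  case (Cons b w)
  then have in_G: "b \<in> carrier G" "list_product G w \<in> carrier G" and ab: "a \<otimes> b = b \<otimes> a"
    using list_product_in[of w] by auto
  have "a \<otimes> list_product G (b # w) = a \<otimes> b \<otimes> list_product G w"
    using in_G assms(1) by (simp add: m_assoc)
  also have "\<dots> = b \<otimes> (a \<otimes> list_product G w)"
    using in_G assms(1) by (simp add: ab m_assoc)
  also have "a \<otimes> list_product G w = list_product G w \<otimes> a" using Cons by simp
  finally show ?case using in_G assms(1) by (simp add: m_assoc)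
qed (use assms in simp)

lemma (in monoid) list_product_commute:
  assumes "set u \<subseteq> carrier G" "set w \<subseteq> carrier G" "\<And>a b. a \<in> set u \<Longrightarrow> b \<in> set w \<Longrightarrow> a \<otimes> b = b \<otimes> a"
  shows "list_product G u \<otimes> list_product G w = list_product G w \<otimes> list_product G u"
  using assms(1,3)
proof (induction u)
  case (Cons a u)
  have in_G: "a \<in> carrier G" "list_product G u \<in> carrier G" "list_product G w \<in> carrier G"
    using Cons.prems(1) assms(2) list_product_in by auto
  have "list_product G u \<otimes> list_product G w = list_product G w \<otimes> list_product G u"
    using Cons.prems by (intro Cons.IH) auto
  then have "list_product G (a # u) \<otimes> list_product G w = a \<otimes> list_product G w \<otimes> list_product G u"
    using in_G by (simp add: m_assoc)
  also have "a \<otimes> list_product G w = list_product G w \<otimes> a"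
    using Cons.prems assms(2) by (intro list_product_commute1) auto
  finally show ?case using in_G by (simp add: m_assoc)
qed (use assms(2) list_product_in in simp)

text \<open>\<open>finprod\<close> folds left multiplications, and such a fold is well behaved as
  soon as these commute with one another, in a noncommutative monoid as well.\<close>

lemma (in monoid) finprod_commuting:
  assumes "finite A" "f ` A \<subseteq> carrier G" "\<And>a b. a \<in> A \<Longrightarrow> b \<in> A \<Longrightarrow> f a \<otimes> f b = f b \<otimes> f a"
  shows "finprod G f A \<in> carrier G"
    and "a \<in> A \<Longrightarrow> finprod G f A = f a \<otimes> finprod G f (A - {a})"
proof -
  have f: "f a \<in> carrier G" if "a \<in> A" for a using assms(2) that by blast
  interpret L: LCD A "carrier G" "(\<otimes>) \<circ> f"
  proof
    fix a b z assume "a \<in> A" "b \<in> A" "z \<in> carrier G"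
    then show "((\<otimes>) \<circ> f) a (((\<otimes>) \<circ> f) b z) = ((\<otimes>) \<circ> f) b (((\<otimes>) \<circ> f) a z)"
      using f assms(3)[of a b] by (simp flip: m_assoc)
  qed (use f in simp)
  show "finprod G f A \<in> carrier G" using assms(1) by (simp add: finprod_def)
  assume "a \<in> A"
  then show "finprod G f A = f a \<otimes> finprod G f (A - {a})"
    using L.foldD_insert[of "A - {a}" a \<one>] assms(1) by (simp add: finprod_def insert_absorb)
qed

lemma cross_inner: "cross u (p - q) = inner (\<i> * u) p - inner (\<i> * u) q"
  by (simp add: inner_complex_def algebra_simps)

lemma hulls_separated:
  assumes "\<And>p. p \<in> A \<Longrightarrow> 0 < cross u (p - q)" "\<And>p. p \<in> B \<Longrightarrow> cross u (p - q) \<le> 0"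
  shows "convex hull A \<inter> convex hull B = {}"
proof -
  have "convex hull A \<subseteq> {p. inner (\<i> * u) q < inner (\<i> * u) p}"
    using assms(1) by (intro hull_minimal convex_halfspace_gt) (auto simp: cross_inner simp del: times_complex.sel)
  moreover have "convex hull B \<subseteq> {p. inner (\<i> * u) p \<le> inner (\<i> * u) q}"
    using assms(2) by (intro hull_minimal convex_halfspace_le) (auto simp: cross_inner simp del: times_complex.sel)
  ultimately show ?thesis by force
qed

definition atom :: "nat \<Rightarrow> nat \<Rightarrow> nat \<Rightarrow> nat rel" where
  "atom n i j = Id_on {..<n} \<union> {(i, j), (j, i)}"

lemma atom_commute: "atom n i j = atom n j i"
  by (auto simp: atom_def)

lemma atom_in: "i < n \<Longrightarrow> j < n \<Longrightarrow> atom n i j \<in> noncrossing n"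
  by (rule noncrossingI) (auto simp: atom_def)

text \<open>The chord divides the inserted points into two blocks. As the point with index
  \<open>i\<close> is inserted after \<open>i\<close>, those on the inner side carry the indices
  from \<open>i\<close> to \<open>j - 1\<close>.\<close>

lemma kreweras_atom: "i < j \<Longrightarrow> kreweras n (atom n i j) = {(k, l). k < n \<and> l < n \<and> (k \<in> {i..<j} \<longleftrightarrow> l \<in> {i..<j})}"
proof -
  assume "i < j"
  have "(\<forall>a b. (a, b) \<in> atom n i j \<longrightarrow> (Q a \<longleftrightarrow> Q b)) \<longleftrightarrow> (Q i \<longleftrightarrow> Q j)" for Q
    by (auto simp: atom_def)
  moreover have "((i \<le> k \<longleftrightarrow> i \<le> l) \<longleftrightarrow> (j \<le> k \<longleftrightarrow> j \<le> l)) \<longleftrightarrow> (k \<in> {i..<j} \<longleftrightarrow> l \<in> {i..<j})" for k l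
    using \<open>i < j\<close> by (simp; linarith)
  ultimately show ?thesis unfolding kreweras_def by simp
qed

text \<open>The roots of unity enter the argument through these properties: they lie on the circle
  and can be numbered clockwise.\<close>

locale clockwise_circle =
  fixes n :: nat and \<omega> :: "nat \<Rightarrow> complex"
  assumes norm_omega: "k < n \<Longrightarrow> norm (\<omega> k) = 1" and inj_omega: "inj_on \<omega> {..<n}"
    and clockwise: "i < j \<Longrightarrow> j < k \<Longrightarrow> k < n \<Longrightarrow> cross (\<omega> j - \<omega> i) (\<omega> k - \<omega> i) < 0"
begin

definition x :: "complex set" where "x = \<omega> ` {..<n}"

sublocale circle_configuration x
  by standard (auto simp: x_def norm_omega)

lemma omega_in: "k < n \<Longrightarrow> \<omega> k \<in> x"
  by (simp add: x_def)

lemma omega_eq_iff: "i < n \<Longrightarrow> j < n \<Longrightarrow> \<omega> i = \<omega> j \<longleftrightarrow> i = j"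
  using inj_omega by (auto simp: inj_on_eq_iff)

lemma chord_sign:
  assumes "i < j" "j < n" "k < n"
  shows "i < k \<Longrightarrow> k < j \<Longrightarrow> 0 < cross (\<omega> j - \<omega> i) (\<omega> k - \<omega> i)"
    "k = i \<or> k = j \<Longrightarrow> cross (\<omega> j - \<omega> i) (\<omega> k - \<omega> i) = 0"
    "k < i \<or> j < k \<Longrightarrow> cross (\<omega> j - \<omega> i) (\<omega> k - \<omega> i) < 0"
proof -
  show "0 < cross (\<omega> j - \<omega> i) (\<omega> k - \<omega> i)" if "i < k" "k < j"
    using clockwise[OF that assms(2)] cross_swap[of "\<omega> j" "\<omega> i" "\<omega> k"] by linarith
  show "cross (\<omega> j - \<omega> i) (\<omega> k - \<omega> i) = 0" if "k = i \<or> k = j"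
    using that by (auto simp: algebra_simps)
  show "cross (\<omega> j - \<omega> i) (\<omega> k - \<omega> i) < 0" if "k < i \<or> j < k"
    using that
  proof
    assume "k < i"
    then show ?thesis using clockwise[OF _ assms(1,2)] cross_rotate[of "\<omega> i" "\<omega> k" "\<omega> j"] by metis
  qed (use clockwise assms in blast)
qed

text \<open>Four points of the plane satisfy an affine relation in which the coefficient of each is,
  up to sign, the area of the triangle of the other three. In convex position the signs alternate,
  so that after normalization the relation exhibits a common point of the diagonals.\<close>

lemma chords_cross:
  assumes "a < b" "b < c" "c < d" "d < n"
  shows "closed_segment (\<omega> a) (\<omega> c) \<inter> closed_segment (\<omega> b) (\<omega> d) \<noteq> {}"
proof -
  let ?o = "\<lambda>i j k. cross (\<omega> j - \<omega> i) (\<omega> k - \<omega> i)"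
  define A B C D where "A = - ?o b c d" and "B = - ?o a c d" and "C = - ?o a b d" and "D = - ?o a b c"
  have pos: "0 < A" "0 < B" "0 < C" "0 < D"
    using clockwise[of b c d] clockwise[of a c d] clockwise[of a b d] clockwise[of a b c] assms
    unfolding A_def B_def C_def D_def neg_0_less_iff_less by (meson less_trans)+
  have sum: "A + C = B + D"
    unfolding A_def B_def C_def D_def by (simp add: algebra_simps)
  have eq: "A *\<^sub>R \<omega> a + C *\<^sub>R \<omega> c = B *\<^sub>R \<omega> b + D *\<^sub>R \<omega> d"
    unfolding A_def B_def C_def D_def by (simp add: complex_eq_iff algebra_simps)
  have conv: "(1 / (p + q)) *\<^sub>R (p *\<^sub>R z + q *\<^sub>R w) \<in> closed_segment z w" if "0 < p" "0 < q" for p q and z w :: complex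
  proof -
    have "1 - q / (p + q) = p / (p + q)" using that by (simp add: field_simps)
    then have "(1 / (p + q)) *\<^sub>R (p *\<^sub>R z + q *\<^sub>R w) = (1 - q / (p + q)) *\<^sub>R z + (q / (p + q)) *\<^sub>R w"
      by (simp add: scaleR_add_right)
    then show ?thesis unfolding closed_segment_def using that by (auto intro!: exI[of _ "q / (p + q)"])
  qed
  from conv[OF pos(1,3), of "\<omega> a" "\<omega> c"] conv[OF pos(2,4), of "\<omega> b" "\<omega> d"] show ?thesis
    unfolding sum eq by blast
qed

lemma clockwise_list_sorted:
  "sorted_wrt (<) js \<Longrightarrow> set js \<subseteq> {..<n} \<Longrightarrow> clockwise_list (map \<omega> js)"
proof (induction js)
  case (Cons i js)
  have "sorted_wrt (\<lambda>j k. cross (\<omega> j - \<omega> i) (\<omega> k - \<omega> i) < 0) js"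
    by (rule sorted_wrt_mono_rel[of js "(<)"]) (use Cons.prems clockwise in auto)
  then show ?case using Cons omega_eq_iff by (auto simp: sorted_wrt_map)
qed simp

definition block_braid :: "nat set \<Rightarrow> braid" where
  "block_braid B = part_braid x (\<omega> ` B)"

lemma block_braid_eq:
  assumes "B \<subseteq> {..<n}"
  obtains zs where "set zs = \<omega> ` B" "distinct zs" "block_braid B = chain zs"
proof -
  have fin: "finite B" using assms finite_subset by blast
  let ?zs = "map \<omega> (sorted_list_of_set B)"
  have "clockwise_list ?zs" using assms fin by (intro clockwise_list_sorted) auto
  then show thesis
    using that[of ?zs] part_braid_eq_chain[of ?zs "\<omega> ` B"] assms fin clockwise_list_distinct
    by (auto simp: block_braid_def x_def)
qed

lemma set_map2_ht:
  "distinct zs \<Longrightarrow> set (map2 ht zs (tl zs)) \<subseteq> {ht p q | p q. p \<in> set zs \<and> q \<in> set zs \<and> p \<noteq> q}"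
proof (induction zs rule: induct_list012)
  case (3 a b zs)
  let ?S = "\<lambda>zs. {ht p q | p q. p \<in> set zs \<and> q \<in> set zs \<and> p \<noteq> q}"
  have "set (map2 ht (b # zs) (tl (b # zs))) \<subseteq> ?S (b # zs)" using 3 by simp
  also have "\<dots> \<subseteq> ?S (a # b # zs)" by (intro Collect_mono) auto
  finally have "set (map2 ht (b # zs) (tl (b # zs))) \<subseteq> ?S (a # b # zs)" .
  moreover have "ht a b \<in> ?S (a # b # zs)" using 3 by auto
  ultimately show ?case by simp
qed auto

lemma block_braid_in: "B \<subseteq> {..<n} \<Longrightarrow> block_braid B \<in> carrier H"
proof -
  assume B: "B \<subseteq> {..<n}"
  obtain zs where zs: "set zs = \<omega> ` B" "distinct zs" "block_braid B = chain zs" using block_braid_eq[OF B] .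
  then have "set zs \<subseteq> x" using B by (auto simp: x_def)
  then show ?thesis using zs chain_in by simp
qed

text \<open>Segments inside disjoint hulls are disjoint, so all factors of one product commute with
  all factors of the other.\<close>

lemma block_braid_commute:
  assumes "B \<subseteq> {..<n}" "C \<subseteq> {..<n}" "convex hull (\<omega> ` B) \<inter> convex hull (\<omega> ` C) = {}"
  shows "block_braid B \<otimes>\<^bsub>H\<^esub> block_braid C = block_braid C \<otimes>\<^bsub>H\<^esub> block_braid B"
proof -
  obtain zs where zs: "set zs = \<omega> ` B" "distinct zs" "block_braid B = chain zs" using block_braid_eq[OF assms(1)] .
  obtain ws where ws: "set ws = \<omega> ` C" "distinct ws" "block_braid C = chain ws" using block_braid_eq[OF assms(2)] .
  have in_x: "set zs \<subseteq> x" "set ws \<subseteq> x" using assms by (auto simp: zs ws x_def)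
  show ?thesis
    unfolding zs(3) ws(3) chain_def
  proof (rule H.list_product_commute)
    show "set (map2 ht zs (tl zs)) \<subseteq> carrier H"
      by (rule subset_trans[OF set_map2_ht[OF zs(2)]]) (use in_x in \<open>auto intro!: ht_in\<close>)
    show "set (map2 ht ws (tl ws)) \<subseteq> carrier H"
      by (rule subset_trans[OF set_map2_ht[OF ws(2)]]) (use in_x in \<open>auto intro!: ht_in\<close>)
    fix g h assume "g \<in> set (map2 ht zs (tl zs))" "h \<in> set (map2 ht ws (tl ws))"
    then have "g \<in> {ht p q | p q. p \<in> set zs \<and> q \<in> set zs \<and> p \<noteq> q}"
      "h \<in> {ht p q | p q. p \<in> set ws \<and> q \<in> set ws \<and> p \<noteq> q}"
      using subsetD[OF set_map2_ht[OF zs(2)]] subsetD[OF set_map2_ht[OF ws(2)]] by simp_all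
    then obtain p q p' q' where g: "g = ht p q" "p \<in> set zs" "q \<in> set zs" "p \<noteq> q"
      and h: "h = ht p' q'" "p' \<in> set ws" "q' \<in> set ws" "p' \<noteq> q'"
      by auto
    have "closed_segment p q \<subseteq> convex hull (\<omega> ` B)" "closed_segment p' q' \<subseteq> convex hull (\<omega> ` C)"
      unfolding segment_convex_hull using g h zs(1) ws(1) by (auto intro!: hull_mono)
    then have "closed_segment p q \<inter> closed_segment p' q' = {}" using assms(3) by blast
    then show "g \<otimes>\<^bsub>H\<^esub> h = h \<otimes>\<^bsub>H\<^esub> g"
      unfolding g(1) h(1) using g h in_x by (intro half_twist_disjoint finite_x no_pair) auto
  qed
qed

lemma block_braid_split:
  assumes B: "B \<subseteq> {..<n}" "i \<in> B" "j \<in> B" "i < j"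
  shows "block_braid B = ht (\<omega> i) (\<omega> j) \<otimes>\<^bsub>H\<^esub> block_braid (B \<inter> {i..<j}) \<otimes>\<^bsub>H\<^esub> block_braid (B - {i..<j})"
proof -
  have fin: "finite B" using B(1) finite_subset by blast
  let ?l = "sorted_list_of_set"
  \<comment> \<open>In order, \<open>B\<close> consists of the points before \<open>i\<close>, those
    from \<open>i\<close> up to \<open>j\<close>, and those from \<open>j\<close> on. Rotating the
    first group to the end turns the two sides of the chord into successive pieces that start with
    \<open>\<omega> i\<close> and \<open>\<omega> j\<close>.\<close>
  let ?e = "?l (B \<inter> {..<i})" and ?c = "?l (B \<inter> {i..<j} - {i})" and ?f = "?l (B \<inter> {j..} - {j})"
  have ic: "?l (B \<inter> {i..<j}) = i # ?c" "?l (B \<inter> {j..}) = j # ?f"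
  proof -
    have "Min (B \<inter> {i..<j}) = i" "Min (B \<inter> {j..}) = j" using B fin by (auto intro!: Min_eqI)
    moreover have "B \<inter> {i..<j} \<noteq> {}" "B \<inter> {j..} \<noteq> {}" using B by auto
    ultimately show "?l (B \<inter> {i..<j}) = i # ?c" "?l (B \<inter> {j..}) = j # ?f"
      using sorted_list_of_set_nonempty[of "B \<inter> {i..<j}"] sorted_list_of_set_nonempty[of "B \<inter> {j..}"] fin by simp_all
  qed
  have "sorted_wrt (<) (?e @ ?l (B \<inter> {i..<j}) @ ?l (B \<inter> {j..}))"
    using fin B(4) by (auto simp: sorted_wrt_append)
  then have "clockwise_list (map \<omega> (?e @ ?l (B \<inter> {i..<j}) @ ?l (B \<inter> {j..})))"
    using B(1) fin by (intro clockwise_list_sorted) auto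
  then have "clockwise_list (map \<omega> (?l (B \<inter> {i..<j}) @ ?l (B \<inter> {j..})) @ map \<omega> ?e)"
    using clockwise_list_rotate[of "map \<omega> ?e" "map \<omega> (?l (B \<inter> {i..<j}) @ ?l (B \<inter> {j..}))"] by simp
  then have cw: "clockwise_list ((\<omega> i # map \<omega> ?c) @ (\<omega> j # map \<omega> (?f @ ?e)))"
    unfolding ic by simp
  have l: "\<omega> i # map \<omega> ?c = map \<omega> (?l (B \<inter> {i..<j}))" "\<omega> j # map \<omega> (?f @ ?e) = map \<omega> (?l (B \<inter> {j..}) @ ?e)"
    by (simp_all add: ic)
  have set_l: "set (?l (B \<inter> {i..<j})) = B \<inter> {i..<j}" "set (?l (B \<inter> {j..})) = B \<inter> {j..}" "set ?e = B \<inter> {..<i}"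
    using fin by simp_all
  have sets: "set (\<omega> i # map \<omega> ?c) = \<omega> ` (B \<inter> {i..<j})"
    "set (\<omega> j # map \<omega> (?f @ ?e)) = \<omega> ` (B \<inter> {j..} \<union> B \<inter> {..<i})"
    unfolding l set_map set_append set_l by (rule HOL.refl)+
  have "B \<inter> {j..} \<union> B \<inter> {..<i} = B - {i..<j}" using B(4) by auto
  note sets = sets[unfolded this]
  have all: "set ((\<omega> i # map \<omega> ?c) @ (\<omega> j # map \<omega> (?f @ ?e))) = \<omega> ` B"
    unfolding set_append sets by auto
  show ?thesis
    unfolding block_braid_def
    using part_braid_split[OF cw] B(1) unfolding all sets by (auto simp: x_def)
qed

definition blocks :: "nat rel \<Rightarrow> complex set set" where
  "blocks s = (`) \<omega> ` ({..<n} // s)"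

lemma block_subset: "s \<in> noncrossing n \<Longrightarrow> B \<in> {..<n} // s \<Longrightarrow> B \<subseteq> {..<n}"
  using noncrossingD(4) by (fastforce elim: quotientE)

text \<open>A line through two points separates the hulls. Let \<open>B\<close> be the block that
  starts first. If it has a point beyond the first point of \<open>C\<close>, then \<open>C\<close>
  fits between two neighbouring points of \<open>B\<close>, and their chord separates. Otherwise
  \<open>B\<close> precedes \<open>C\<close>, and the chord from the first to the last point of
  \<open>B\<close> or of \<open>C\<close> does, unless both are single points.\<close>

lemma noncrossing_hulls_disjoint:
  assumes s: "s \<in> noncrossing n" and B: "B \<in> {..<n} // s" "C \<in> {..<n} // s" "B \<noteq> C"
  shows "convex hull (\<omega> ` B) \<inter> convex hull (\<omega> ` C) = {}"
proof -
  have e: "equiv {..<n} s" using s by (simp add: noncrossing_def)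
  have main: "convex hull (\<omega> ` B) \<inter> convex hull (\<omega> ` C) = {}"
    if B: "B \<in> {..<n} // s" "C \<in> {..<n} // s" "B \<noteq> C" and less: "Min B < Min C" for B C
  proof -
    have sub: "B \<subseteq> {..<n}" "C \<subseteq> {..<n}" using block_subset[OF s] B by auto
    have ne: "B \<noteq> {}" "C \<noteq> {}" using in_quotient_imp_non_empty[OF e] B by auto
    have fin: "finite B" "finite C" using sub finite_subset by blast+
    have disj: "B \<inter> C = {}" using quotient_disj[OF e B(1,2)] B(3) by blast
    have rel: "(a, b) \<in> s" if "a \<in> B" "b \<in> B" for a b using quotient_eq_iff[OF e B(1) B(1) that] by simp
    have rel': "(a, b) \<in> s" if "a \<in> C" "b \<in> C" for a b using quotient_eq_iff[OF e B(2) B(2) that] by simp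
    have nrel: "(a, b) \<notin> s" if "a \<in> B" "b \<in> C" for a b using quotient_eq_iff[OF e B(1) B(2) that] B(3) by simp
    define b0 c0 where "b0 = Min B" and "c0 = Min C"
    have b0: "b0 \<in> B" "\<And>b. b \<in> B \<Longrightarrow> b0 \<le> b" and c0: "c0 \<in> C" "\<And>c. c \<in> C \<Longrightarrow> c0 \<le> c" and bc: "b0 < c0"
      using fin ne less unfolding b0_def c0_def by auto
    show ?thesis
    proof (cases "\<exists>b\<in>B. c0 < b")
      case True
      define i where "i = Max (B \<inter> {..<c0})"
      define j where "j = Min (B \<inter> {c0<..})"
      have "B \<inter> {..<c0} \<noteq> {}" "B \<inter> {c0<..} \<noteq> {}" using b0 bc True by auto
      then have i: "i \<in> B" "i < c0" "\<And>b. b \<in> B \<Longrightarrow> b < c0 \<Longrightarrow> b \<le> i"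
        and j: "j \<in> B" "c0 < j" "\<And>b. b \<in> B \<Longrightarrow> c0 < b \<Longrightarrow> j \<le> b"
        using Max_in[of "B \<inter> {..<c0}"] Max_ge[of "B \<inter> {..<c0}"] Min_in[of "B \<inter> {c0<..}"] Min_le[of "B \<inter> {c0<..}"] fin
        unfolding i_def j_def by auto
      have ij: "i < j" "j < n" using i j sub by auto
      have inside: "i < c \<and> c < j" if c: "c \<in> C" for c
      proof -
        have "c \<noteq> j" using c j(1) disj by blast
        moreover have "\<not> j < c"
          using noncrossingD(5)[OF s rel[OF i(1) j(1)] rel'[OF c0(1) c]] i j nrel[OF i(1) c0(1)] by blast
        ultimately show ?thesis using c0(2)[OF c] i(2) by simp
      qed
      have outside: "b \<le> i \<or> j \<le> b" if b: "b \<in> B" for b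
        using i(3)[OF b] j(3)[OF b] b c0(1) disj by (cases b c0 rule: linorder_cases) auto
      have "convex hull (\<omega> ` C) \<inter> convex hull (\<omega> ` B) = {}"
      proof (rule hulls_separated)
        show "0 < cross (\<omega> j - \<omega> i) (p - \<omega> i)" if "p \<in> \<omega> ` C" for p
          using that chord_sign(1)[OF ij] inside sub by blast
        show "cross (\<omega> j - \<omega> i) (p - \<omega> i) \<le> 0" if p: "p \<in> \<omega> ` B" for p
        proof -
          obtain b where b: "p = \<omega> b" "b \<in> B" using p by blast
          then have "b < n" using sub by auto
          then show ?thesis
            using chord_sign(2,3)[OF ij, of b] outside[OF b(2)] unfolding b(1) by (metis le_less linorder_neqE_nat)
        qed
      qed
      then show ?thesis by blast
    next
      case False
      have before: "b < c" if "b \<in> B" "c \<in> C" for b c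
        using False that c0 disj by (metis disjoint_iff le_neq_implies_less less_le_trans not_less)
      define b1 c1 where "b1 = Max B" and "c1 = Max C"
      have b1: "b1 \<in> B" "\<And>b. b \<in> B \<Longrightarrow> b \<le> b1" and c1: "c1 \<in> C" "\<And>c. c \<in> C \<Longrightarrow> c \<le> c1"
        using fin ne unfolding b1_def c1_def by auto
      have neg: "cross (- u) v = - cross u v" for u v by simp
      consider "b0 < b1" | "c0 < c1" | "b0 = b1" "c0 = c1" using b0 b1 c0 c1 by force
      then show ?thesis
      proof cases
        case 1
        have n: "b1 < n" using b1 sub by auto
        have "convex hull (\<omega> ` C) \<inter> convex hull (\<omega> ` B) = {}"
        proof (rule hulls_separated)
          show "0 < cross (- (\<omega> b1 - \<omega> b0)) (p - \<omega> b0)" if p: "p \<in> \<omega> ` C" for p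
          proof -
            obtain c where c: "p = \<omega> c" "c \<in> C" using p by blast
            then show ?thesis
              using chord_sign(3)[OF 1 n, of c] before[OF b1(1) c(2)] subsetD[OF sub(2) c(2)] unfolding neg c(1) by simp
          qed
          show "cross (- (\<omega> b1 - \<omega> b0)) (p - \<omega> b0) \<le> 0" if p: "p \<in> \<omega> ` B" for p
          proof -
            obtain b where b: "p = \<omega> b" "b \<in> B" using p by blast
            have "b < n" "b0 \<le> b" "b \<le> b1" using b(2) sub b0 b1 by auto
            then show ?thesis using chord_sign(1,2)[OF 1 n \<open>b < n\<close>] unfolding neg b(1)
              by (cases "b = b0 \<or> b = b1") (auto simp: le_less simp del: times_complex.sel)
          qed
        qed
        then show ?thesis by blast
      next
        case 2
        have n: "c1 < n" using c1 sub by auto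
        show ?thesis
        proof (rule hulls_separated)
          show "0 < cross (- (\<omega> c1 - \<omega> c0)) (p - \<omega> c0)" if p: "p \<in> \<omega> ` B" for p
          proof -
            obtain b where b: "p = \<omega> b" "b \<in> B" using p by blast
            then show ?thesis
              using chord_sign(3)[OF 2 n, of b] before[OF b(2) c0(1)] subsetD[OF sub(1) b(2)] unfolding neg b(1) by simp
          qed
          show "cross (- (\<omega> c1 - \<omega> c0)) (p - \<omega> c0) \<le> 0" if p: "p \<in> \<omega> ` C" for p
          proof -
            obtain c where c: "p = \<omega> c" "c \<in> C" using p by blast
            have "c < n" "c0 \<le> c" "c \<le> c1" using c(2) sub c0 c1 by auto
            then show ?thesis using chord_sign(1,2)[OF 2 n \<open>c < n\<close>] unfolding neg c(1)
              by (cases "c = c0 \<or> c = c1") (auto simp: le_less simp del: times_complex.sel)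
          qed
        qed
      next
        case 3
        have "B = {b0}" "C = {c0}" using 3 b0 b1 c0 c1 by (auto intro: antisym)
        moreover have "\<omega> b0 \<noteq> \<omega> c0" using omega_eq_iff b0 c0 bc sub by blast
        ultimately show ?thesis by simp
      qed
    qed
  qed
  have "Min B \<noteq> Min C"
  proof
    assume "Min B = Min C"
    moreover have "finite B" "finite C" using block_subset[OF s] B finite_subset by blast+
    then have "Min B \<in> B" "Min C \<in> C" using in_quotient_imp_non_empty[OF e] B by auto
    ultimately show False using quotient_disj[OF e B(1,2)] B(3) by auto
  qed
  then show ?thesis using main[OF B] main[OF B(2,1)] B(3) by (metis Int_commute linorder_neqE_nat)
qed

end

lemma (in monoid) finprod_one:
  assumes "finite A" "\<And>a. a \<in> A \<Longrightarrow> f a = \<one>" shows "finprod G f A = \<one>"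
  using assms
proof (induction A)
  case (insert a A)
  then have "finprod G f (insert a A) = f a \<otimes> finprod G f (insert a A - {a})"
    by (intro finprod_commuting) auto
  then show ?case using insert by simp
qed (simp add: finprod_def)

section \<open>Braids of noncrossing partitions and their products\<close>

context clockwise_circle begin

sublocale germ: complement_germ "noncrossing n" "nc_join n" "kreweras n" "Id_on {..<n}" "{..<n} \<times> {..<n}"
  by (rule complement_germ_noncrossing)

definition nc_braid :: "nat rel \<Rightarrow> braid" where
  "nc_braid s = partition_braid x (blocks s)"

lemma image_omega_eq_iff: "B \<subseteq> {..<n} \<Longrightarrow> C \<subseteq> {..<n} \<Longrightarrow> \<omega> ` B = \<omega> ` C \<longleftrightarrow> B = C"
  using inj_omega by (rule inj_on_image_eq_iff)

lemma finite_blocks: "finite (blocks s)"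
  unfolding blocks_def by (simp add: quotient_def)

lemma blocks_carrier: "s \<in> noncrossing n \<Longrightarrow> part_braid x ` blocks s \<subseteq> carrier H"
  using block_braid_in[OF block_subset] by (auto simp: blocks_def block_braid_def)

lemma blocks_commute:
  assumes "s \<in> noncrossing n" "v \<in> blocks s" "w \<in> blocks s"
  shows "part_braid x v \<otimes>\<^bsub>H\<^esub> part_braid x w = part_braid x w \<otimes>\<^bsub>H\<^esub> part_braid x v"
proof -
  obtain B C where B: "B \<in> {..<n} // s" "C \<in> {..<n} // s" and vw: "v = \<omega> ` B" "w = \<omega> ` C"
    using assms(2,3) by (auto simp: blocks_def)
  show ?thesis
  proof (cases "B = C")
    case False
    then show ?thesis
      using block_braid_commute[OF block_subset[OF assms(1) B(1)] block_subset[OF assms(1) B(2)]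
          noncrossing_hulls_disjoint[OF assms(1) B False]] by (simp add: vw block_braid_def)
  qed (simp add: vw)
qed

lemma nc_braid_in: "s \<in> noncrossing n \<Longrightarrow> nc_braid s \<in> carrier H"
  unfolding nc_braid_def partition_braid_def
  by (intro H.finprod_commuting finite_blocks blocks_carrier blocks_commute)

lemma finprod_blocks_remove:
  assumes s: "s \<in> noncrossing n" and A: "A \<subseteq> blocks s" "\<omega> ` B \<in> A"
  shows "finprod H (part_braid x) A = block_braid B \<otimes>\<^bsub>H\<^esub> finprod H (part_braid x) (A - {\<omega> ` B})"
    and "finprod H (part_braid x) (A - {\<omega> ` B}) \<in> carrier H"
proof -
  have fin: "finite A" using A(1) finite_blocks finite_subset by blast
  have car: "part_braid x ` A \<subseteq> carrier H" using A(1) blocks_carrier[OF s] by blast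
  have com: "part_braid x v \<otimes>\<^bsub>H\<^esub> part_braid x w = part_braid x w \<otimes>\<^bsub>H\<^esub> part_braid x v" if "v \<in> A" "w \<in> A" for v w
    using blocks_commute[OF s] A(1) that by blast
  show "finprod H (part_braid x) A = block_braid B \<otimes>\<^bsub>H\<^esub> finprod H (part_braid x) (A - {\<omega> ` B})"
    unfolding block_braid_def by (rule H.finprod_commuting(2)[OF fin car com A(2)])
  show "finprod H (part_braid x) (A - {\<omega> ` B}) \<in> carrier H"
    by (rule H.finprod_commuting(1)) (use fin car com in auto)
qed

text \<open>Dividing by an atom cuts the block of \<open>i\<close> and \<open>j\<close> along the
  chord, with \<open>i\<close> going to the inner and \<open>j\<close> to the outer piece. Any other
  block lies on one side of the chord, as \<open>s\<close> is noncrossing, and stays as it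
  is.\<close>

lemma quotient_kreweras_atom:
  assumes s: "s \<in> noncrossing n" and ij: "(i, j) \<in> s" "i < j"
  defines "B \<equiv> s `` {i}" and "r \<equiv> kreweras n (atom n i j) \<inter> s"
  shows "{..<n} // r = insert (B \<inter> {i..<j}) (insert (B - {i..<j}) ({..<n} // s - {B}))"
proof -
  note D = noncrossingD[OF s]
  have e: "equiv {..<n} s" using s by (simp add: noncrossing_def)
  have n: "i < n" "j < n" using D(4)[OF ij(1)] by auto
  have r_iff: "(k, l) \<in> r \<longleftrightarrow> (k, l) \<in> s \<and> (k \<in> {i..<j} \<longleftrightarrow> l \<in> {i..<j})" for k l
    unfolding r_def kreweras_atom[OF ij(2)] using D(4) by blast
  have B_iff: "k \<in> B \<longleftrightarrow> (i, k) \<in> s" for k by (simp add: B_def)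
  have in_B: "r `` {k} = (if k \<in> {i..<j} then B \<inter> {i..<j} else B - {i..<j})" if "k \<in> B" for k
  proof -
    have "(k, l) \<in> s \<longleftrightarrow> l \<in> B" for l
      using that D(2,3) unfolding B_iff by blast
    then have "r `` {k} = {l. l \<in> B \<and> (k \<in> {i..<j} \<longleftrightarrow> l \<in> {i..<j})}"
      by (simp only: Image_singleton r_iff)
    then show ?thesis by (cases "k \<in> {i..<j}") (simp_all only: if_True if_False simp_thms Int_def set_diff_eq mem_Collect_eq)
  qed
  have not_B: "r `` {k} = s `` {k}" if k: "k \<notin> B" for k
  proof -
    have side: "b \<notin> {i..<j} \<Longrightarrow> a \<notin> {i..<j}" if ab: "(a, b) \<in> s" and a: "a \<notin> B" for a b
    proof
      assume b: "b \<notin> {i..<j}" and aij: "a \<in> {i..<j}"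
      have "a \<noteq> i" using a D(1)[OF n(1)] unfolding B_iff by blast
      then have a': "i < a" "a < j" using aij by auto
      have "b \<notin> B" using a D(2,3) ab unfolding B_iff by blast
      then have "b \<noteq> j" using ij(1) unfolding B_iff by blast
      then consider "j < b" | "b < i" using b by (metis atLeastLessThan_iff linorder_neqE_nat not_less)
      then show False
      proof cases
        case 1
        then show False using D(5)[OF ij(1) ab a'] a unfolding B_iff by blast
      next
        case 2
        then have "(b, i) \<in> s" using D(5)[OF D(2)[OF ab] ij(1)] a' by blast
        then show False using D(2) \<open>b \<notin> B\<close> unfolding B_iff by blast
      qed
    qed
    have "k \<in> {i..<j} \<longleftrightarrow> l \<in> {i..<j}" if kl: "(k, l) \<in> s" for l
    proof -
      have "l \<notin> B" using k D(2,3) kl unfolding B_iff by blast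
      then show ?thesis using side[OF kl k] side[OF D(2)[OF kl]] by blast
    qed
    then show ?thesis unfolding Image_singleton r_iff by blast
  qed
  have iB: "i \<in> B" "j \<in> B" using D(1)[OF n(1)] ij unfolding B_iff by auto
  have B_class: "s `` {k} = B \<longleftrightarrow> k \<in> B" if "k < n" for k
    using eq_equiv_class_iff[OF e, of i k] that n by (auto simp: B_def)
  show ?thesis
  proof (intro equalityI subsetI)
    fix C assume "C \<in> {..<n} // r"
    then obtain k where k: "k < n" "C = r `` {k}" by (auto simp: quotient_def)
    show "C \<in> insert (B \<inter> {i..<j}) (insert (B - {i..<j}) ({..<n} // s - {B}))"
    proof (cases "k \<in> B")
      case True
      then show ?thesis using in_B k by simp
    next
      case False
      then show ?thesis using not_B[OF False] B_class[OF k(1)] k quotientI[of k "{..<n}" s] by simp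
    qed
  next
    fix C assume "C \<in> insert (B \<inter> {i..<j}) (insert (B - {i..<j}) ({..<n} // s - {B}))"
    then consider "C = B \<inter> {i..<j}" | "C = B - {i..<j}" | "C \<in> {..<n} // s" "C \<noteq> B" by blast
    then show "C \<in> {..<n} // r"
    proof cases
      case 1
      then have "C = r `` {i}" using in_B[OF iB(1)] ij by simp
      then show ?thesis using n by (simp add: quotientI)
    next
      case 2
      then have "C = r `` {j}" using in_B[OF iB(2)] ij by simp
      then show ?thesis using n by (simp add: quotientI)
    next
      case 3
      then obtain k where k: "k < n" "C = s `` {k}" by (auto simp: quotient_def)
      then have "C = r `` {k}" using not_B[of k] B_class[OF k(1)] 3(2) by simp
      then show ?thesis using k by (simp add: quotientI)
    qed
  qed
qed

text \<open>This is the product rule for an atom as first factor, where the geometry enters; the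
  general rule is derived from it by induction in the lattice. The block of \<open>i\<close> and
  \<open>j\<close> is split by \<open>block_braid_split\<close>, the product over the others is
  common to both sides.\<close>

lemma nc_braid_atom_factor:
  assumes s: "s \<in> noncrossing n" and ij: "(i, j) \<in> s" "i < j"
  shows "nc_braid s = ht (\<omega> i) (\<omega> j) \<otimes>\<^bsub>H\<^esub> nc_braid (kreweras n (atom n i j) \<inter> s)"
proof -
  have e: "equiv {..<n} s" using s by (simp add: noncrossing_def)
  have n: "i < n" "j < n" using noncrossingD(4)[OF s ij(1)] by auto
  define r where "r = kreweras n (atom n i j) \<inter> s"
  have r: "r \<in> noncrossing n" unfolding r_def by (intro noncrossing_Int kreweras_in s)
  define B where "B = s `` {i}"
  let ?B1 = "B \<inter> {i..<j}" and ?B2 = "B - {i..<j}"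
  let ?R = "{..<n} // s - {B}"
  have qr: "{..<n} // r = insert ?B1 (insert ?B2 ?R)"
    unfolding r_def B_def by (rule quotient_kreweras_atom[OF s ij])
  have BQ: "B \<in> {..<n} // s" unfolding B_def using n by (simp add: quotientI)
  have B: "B \<subseteq> {..<n}" "i \<in> B" "j \<in> B"
    using block_subset[OF s BQ] ij noncrossingD(1)[OF s] n unfolding B_def by auto
  have sub: "C \<subseteq> {..<n}" if "C \<in> {..<n} // s" for C by (rule block_subset[OF s that])
  have disj: "C \<inter> B = {}" if "C \<in> ?R" for C using quotient_disj[OF e _ BQ] that by auto
  have ne: "\<omega> ` ?B1 \<noteq> \<omega> ` ?B2" "\<omega> ` ?B1 \<notin> (`) \<omega> ` ?R" "\<omega> ` ?B2 \<notin> (`) \<omega> ` ?R" "\<omega> ` B \<notin> (`) \<omega> ` ?R"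
  proof -
    have 1: "i \<in> ?B1" "j \<in> ?B2" "?B1 \<subseteq> {..<n}" "?B2 \<subseteq> {..<n}" using B ij by auto
    then show "\<omega> ` ?B1 \<noteq> \<omega> ` ?B2" by (subst image_omega_eq_iff) auto
    have "D \<inter> B = {}" if D: "D \<subseteq> {..<n}" "\<omega> ` D \<in> (`) \<omega> ` ?R" for D
    proof -
      obtain C where C: "C \<in> ?R" "\<omega> ` D = \<omega> ` C" using D(2) by blast
      then have "D = C" using image_omega_eq_iff[OF D(1) sub[of C]] by blast
      then show ?thesis using disj C(1) by blast
    qed
    then show "\<omega> ` ?B1 \<notin> (`) \<omega> ` ?R" "\<omega> ` ?B2 \<notin> (`) \<omega> ` ?R" "\<omega> ` B \<notin> (`) \<omega> ` ?R"
      using 1 B by blast+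
  qed
  have bs: "blocks s = insert (\<omega> ` B) ((`) \<omega> ` ?R)" unfolding blocks_def using BQ by blast
  have br: "blocks r = insert (\<omega> ` ?B1) (insert (\<omega> ` ?B2) ((`) \<omega> ` ?R))" unfolding blocks_def qr by blast
  define f where "f = finprod H (part_braid x) ((`) \<omega> ` ?R)"
  have "blocks s - {\<omega> ` B} = (`) \<omega> ` ?R" using bs ne by blast
  then have 1: "nc_braid s = block_braid B \<otimes>\<^bsub>H\<^esub> f" "f \<in> carrier H"
    using finprod_blocks_remove[OF s subset_refl, of B] unfolding nc_braid_def partition_braid_def f_def bs by auto
  have "blocks r - {\<omega> ` ?B1} = insert (\<omega> ` ?B2) ((`) \<omega> ` ?R)"
    unfolding br by (rule Diff_insert_absorb) (use ne(1,2) in \<open>simp only: insert_iff, simp\<close>)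
  then have 2: "nc_braid r = block_braid ?B1 \<otimes>\<^bsub>H\<^esub> finprod H (part_braid x) (insert (\<omega> ` ?B2) ((`) \<omega> ` ?R))"
    using finprod_blocks_remove(1)[OF r subset_refl, of ?B1] unfolding nc_braid_def partition_braid_def br by simp
  have "insert (\<omega> ` ?B2) ((`) \<omega> ` ?R) - {\<omega> ` ?B2} = (`) \<omega> ` ?R" by (rule Diff_insert_absorb[OF ne(3)])
  then have 3: "finprod H (part_braid x) (insert (\<omega> ` ?B2) ((`) \<omega> ` ?R)) = block_braid ?B2 \<otimes>\<^bsub>H\<^esub> f"
    using finprod_blocks_remove(1)[OF r, of "insert (\<omega> ` ?B2) ((`) \<omega> ` ?R)" ?B2] unfolding f_def br by auto
  have in_H: "block_braid ?B1 \<in> carrier H" "block_braid ?B2 \<in> carrier H" "ht (\<omega> i) (\<omega> j) \<in> carrier H"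
    using B n ij by (auto intro!: block_braid_in ht_in simp: omega_in omega_eq_iff)
  show ?thesis
    unfolding r_def[symmetric] 1(1) 2 3 block_braid_split[OF B(1-3) ij(2)]
    using in_H 1(2) by (simp add: H.m_assoc)
qed

lemma nc_braid_Id: "nc_braid (Id_on {..<n}) = \<one>\<^bsub>H\<^esub>"
  unfolding nc_braid_def partition_braid_def
proof (rule H.finprod_one[OF finite_blocks])
  fix v assume "v \<in> blocks (Id_on {..<n})"
  then obtain k where k: "k < n" "v = {\<omega> k}" by (auto simp: blocks_def quotient_def)
  then show "part_braid x v = \<one>\<^bsub>H\<^esub>"
    using part_braid_eq_chain[of "[\<omega> k]" v] by (simp add: omega_in)
qed

lemma nc_braid_atom: "i < j \<Longrightarrow> j < n \<Longrightarrow> nc_braid (atom n i j) = ht (\<omega> i) (\<omega> j)"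
proof -
  assume ij: "i < j" "j < n"
  have a: "atom n i j \<in> noncrossing n" using ij by (intro atom_in) auto
  have "nc_braid (atom n i j) = ht (\<omega> i) (\<omega> j) \<otimes>\<^bsub>H\<^esub> nc_braid (kreweras n (atom n i j) \<inter> atom n i j)"
    by (rule nc_braid_atom_factor[OF a _ ij(1)]) (simp add: atom_def)
  also have "kreweras n (atom n i j) \<inter> atom n i j = Id_on {..<n}"
    using germ.inf_K_self[OF a] by simp
  finally show ?thesis
    using ij ht_in by (simp add: nc_braid_Id omega_in omega_eq_iff)
qed

lemma atom_le: "s \<in> noncrossing n \<Longrightarrow> (i, j) \<in> s \<Longrightarrow> atom n i j \<subseteq> s"
  using noncrossingD(1,2) by (auto simp: atom_def)

text \<open>Atoms are divided off on the left. The quotient is a proper subset, since the complement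
  of the atom does not contain \<open>(i, j)\<close>.\<close>

lemma noncrossing_atom_induct [consumes 1, case_names Id factor]:
  assumes "s \<in> noncrossing n" and "P (Id_on {..<n})"
    and "\<And>s i j. s \<in> noncrossing n \<Longrightarrow> (i, j) \<in> s \<Longrightarrow> i < j \<Longrightarrow> P (kreweras n (atom n i j) \<inter> s) \<Longrightarrow> P s"
  shows "P s"
  using assms(1)
proof (induction "card s" arbitrary: s rule: less_induct)
  case less
  show ?case
  proof (cases "s = Id_on {..<n}")
    case False
    have "\<exists>i j. (i, j) \<in> s \<and> i < j"
    proof (rule ccontr)
      assume none: "\<nexists>i j. (i, j) \<in> s \<and> i < j"
      have "s \<subseteq> Id_on {..<n}"
        by (rule noncrossing_subsetI[OF less.prems noncrossing_Id_on]) (use none in blast)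
      then show False using False germ.bot_le[OF less.prems] by blast
    qed
    then obtain i j where ij: "(i, j) \<in> s" "i < j" by blast
    have "finite s"
    proof (rule finite_subset)
      show "s \<subseteq> {..<n} \<times> {..<n}" using noncrossingD(4)[OF less.prems] by auto
    qed simp
    moreover have "(i, j) \<notin> kreweras n (atom n i j)" using ij(2) by (simp add: kreweras_atom)
    then have "kreweras n (atom n i j) \<inter> s \<subset> s" using ij(1) by blast
    ultimately have "card (kreweras n (atom n i j) \<inter> s) < card s" by (rule psubset_card_mono)
    then have "P (kreweras n (atom n i j) \<inter> s)"
      by (rule less.hyps) (intro noncrossing_Int kreweras_in less.prems)
    then show ?thesis by (rule assms(3)[OF less.prems ij])
  qed (use assms(2) in simp)
qed

text \<open>Write \<open>s\<close> as the product of an atom and \<open>s1\<close>. Since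
  \<open>K s\<close> is the intersection of the complements of these two, \<open>s1\<close> and
  \<open>t\<close> have a defined product, and it lies below the complement of the atom. So the
  product of \<open>s\<close> and \<open>t\<close> is the atom times that product.\<close>

lemma nc_braid_mult:
  assumes "s \<in> noncrossing n" "t \<in> noncrossing n" "t \<subseteq> kreweras n s"
  shows "nc_braid s \<otimes>\<^bsub>H\<^esub> nc_braid t = nc_braid (nc_join n s t)"
  using assms
proof (induction s arbitrary: t rule: noncrossing_atom_induct)
  case Id
  then show ?case by (simp add: nc_braid_Id nc_braid_in)
next
  case (factor s i j)
  let ?a = "atom n i j"
  define s1 where "s1 = kreweras n ?a \<inter> s"
  have n: "i < n" "j < n" using noncrossingD(4)[OF factor.hyps(1,2)] by auto
  have a: "?a \<in> noncrossing n" using n by (rule atom_in)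
  have s1: "s1 \<in> noncrossing n" unfolding s1_def by (intro noncrossing_Int kreweras_in factor.hyps)
  have s: "s = nc_join n ?a s1"
    using germ.J_quotient[OF a factor.hyps(1)] atom_le[OF factor.hyps(1,2)] by (simp add: s1_def)
  have t: "t \<subseteq> kreweras n ?a" "t \<subseteq> kreweras n s1"
    using factor.prems(2) kreweras_nc_join[OF a s1] s by auto
  define r where "r = nc_join n s1 t"
  have r: "r \<in> noncrossing n" unfolding r_def by (rule nc_join_in[OF s1 factor.prems(1)])
  have rK: "r \<subseteq> kreweras n ?a" unfolding r_def
    by (rule nc_join_least[OF kreweras_in _ t(1)]) (simp add: s1_def)
  have join: "nc_join n s t = nc_join n ?a r"
    unfolding r_def s using germ.J_assoc[OF a s1 factor.prems(1)] by simp
  have "(i, j) \<in> nc_join n ?a r" using nc_join_upper[of ?a n r] by (auto simp: atom_def)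
  then have "nc_braid (nc_join n ?a r) = ht (\<omega> i) (\<omega> j) \<otimes>\<^bsub>H\<^esub> nc_braid (kreweras n ?a \<inter> nc_join n ?a r)"
    by (intro nc_braid_atom_factor nc_join_in a r factor.hyps)
  also have "kreweras n ?a \<inter> nc_join n ?a r = r" by (rule kreweras_inter_nc_join[OF a r rK])
  also have "nc_braid r = nc_braid s1 \<otimes>\<^bsub>H\<^esub> nc_braid t"
    using factor.IH factor.prems t(2) unfolding r_def s1_def by simp
  also have "ht (\<omega> i) (\<omega> j) \<otimes>\<^bsub>H\<^esub> (nc_braid s1 \<otimes>\<^bsub>H\<^esub> nc_braid t) = nc_braid s \<otimes>\<^bsub>H\<^esub> nc_braid t"
    using nc_braid_atom_factor[OF factor.hyps] nc_braid_in[OF s1] nc_braid_in[OF factor.prems(1)] ht_in[of "\<omega> i" "\<omega> j"] n factor.hyps(3)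
    by (simp add: s1_def H.m_assoc omega_in omega_eq_iff)
  finally show ?case unfolding join by simp
qed

lemma non_obstructing_blocks:
  assumes s: "s \<in> noncrossing n" shows "non_obstructing_partition x (blocks s)"
  unfolding non_obstructing_partition_def
proof (intro conjI ballI impI)
  have e: "equiv {..<n} s" using s by (simp add: noncrossing_def)
  show "partition_on x (blocks s)"
  proof (rule partition_onI)
    have "\<Union> ({..<n} // s) = {..<n}" by (rule Union_quotient[OF e])
    then show "\<Union> (blocks s) = x" unfolding blocks_def x_def by (metis image_Union)
    show "{} \<notin> blocks s" using in_quotient_imp_non_empty[OF e] by (auto simp: blocks_def)
    fix v w assume vw: "v \<in> blocks s" "w \<in> blocks s" "v \<noteq> w"
    then obtain B C where B: "B \<in> {..<n} // s" "C \<in> {..<n} // s" "v = \<omega> ` B" "w = \<omega> ` C"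
      by (auto simp: blocks_def)
    then have "B \<inter> C = {}" using quotient_disj[OF e B(1,2)] vw(3) by blast
    then show "disjnt v w"
      using inj_on_image_Int[OF inj_omega block_subset[OF s B(1)] block_subset[OF s B(2)]] B by (simp add: disjnt_def)
  qed
  fix v assume v: "v \<in> blocks s"
  then obtain B where B: "B \<in> {..<n} // s" "v = \<omega> ` B" by (auto simp: blocks_def)
  have sub: "B \<subseteq> {..<n}" by (rule block_subset[OF s B(1)])
  show "convex_part v"
  proof (rule circle_convex_part)
    show "finite v" using sub finite_subset B by blast
    show "v \<noteq> {}" using in_quotient_imp_non_empty[OF e B(1)] B by blast
    show "v \<subseteq> sphere 0 1" using sub B norm_omega by auto
  qed
  fix w assume "w \<in> blocks s" "v \<noteq> w"
  then obtain C where "C \<in> {..<n} // s" "w = \<omega> ` C" "B \<noteq> C" using B by (auto simp: blocks_def)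
  then show "convex hull v \<inter> convex hull w = {}"
    using noncrossing_hulls_disjoint[OF s B(1)] B by blast
qed

text \<open>If the indices of two parts crossed, two chords would meet, and with them the convex
  hulls of the parts.\<close>

lemma non_obstructing_partition_blocks:
  assumes L: "non_obstructing_partition x L"
  obtains s where "s \<in> noncrossing n" "L = blocks s"
proof
  define s where "s = {(i, j). i < n \<and> j < n \<and> (\<exists>v\<in>L. \<omega> i \<in> v \<and> \<omega> j \<in> v)}"
  have part: "partition_on x L" and hull: "\<And>v w. v \<in> L \<Longrightarrow> w \<in> L \<Longrightarrow> v \<noteq> w \<Longrightarrow> convex hull v \<inter> convex hull w = {}"
    using L by (auto simp: non_obstructing_partition_def)
  have union: "\<Union>L = x" and nonempty: "{} \<notin> L"
    using partition_onD1[OF part] partition_onD3[OF part] by auto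
  have unique: "v = w" if "v \<in> L" "w \<in> L" "z \<in> v" "z \<in> w" for v w z
    using partition_onD2[OF part] that by (auto simp: disjoint_def)
  show "s \<in> noncrossing n"
  proof (rule noncrossingI)
    show "(a, a) \<in> s" if "a < n" for a using omega_in[OF that] union that by (auto simp: s_def)
    show "(b, a) \<in> s" if "(a, b) \<in> s" for a b using that by (auto simp: s_def)
    show "a < n \<and> b < n" if "(a, b) \<in> s" for a b using that by (auto simp: s_def)
    show "(a, c) \<in> s" if abc: "(a, b) \<in> s" "(b, c) \<in> s" for a b c
    proof -
      obtain v w where v: "v \<in> L" "\<omega> a \<in> v" "\<omega> b \<in> v" and w: "w \<in> L" "\<omega> b \<in> w" "\<omega> c \<in> w"
        using abc by (auto simp: s_def)
      have "v = w" by (rule unique[OF v(1) w(1) v(3) w(2)])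
      then show ?thesis using v w abc by (auto simp: s_def)
    qed
    fix a b c d assume ac: "(a, c) \<in> s" and bd: "(b, d) \<in> s" and less: "a < b" "b < c" "c < d"
    obtain v w where v: "v \<in> L" "\<omega> a \<in> v" "\<omega> c \<in> v" and w: "w \<in> L" "\<omega> b \<in> w" "\<omega> d \<in> w" and d: "d < n"
      using ac bd by (auto simp: s_def)
    have "closed_segment (\<omega> a) (\<omega> c) \<subseteq> convex hull v" "closed_segment (\<omega> b) (\<omega> d) \<subseteq> convex hull w"
      unfolding segment_convex_hull using v w by (auto intro!: hull_mono)
    then have "convex hull v \<inter> convex hull w \<noteq> {}" using chords_cross[OF less d] by blast
    then have "v = w" using hull v w by blast
    then show "(a, b) \<in> s" using v w less d by (auto simp: s_def)
  qed
  have cls: "\<omega> ` (s `` {i}) = v" if i: "i < n" "v \<in> L" "\<omega> i \<in> v" for i v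
  proof -
    have "s `` {i} = {j. j < n \<and> \<omega> j \<in> v}"
    proof (intro equalityI subsetI)
      fix j assume "j \<in> s `` {i}"
      then obtain w where w: "j < n" "w \<in> L" "\<omega> i \<in> w" "\<omega> j \<in> w" by (auto simp: s_def)
      have "w = v" by (rule unique[OF w(2) i(2) w(3) i(3)])
      then show "j \<in> {j. j < n \<and> \<omega> j \<in> v}" using w by simp
    qed (use i in \<open>auto simp: s_def\<close>)
    moreover have "v \<subseteq> x" using i(2) union by blast
    ultimately show ?thesis by (auto simp: x_def)
  qed
  show "L = blocks s"
  proof (intro equalityI subsetI)
    fix v assume v: "v \<in> L"
    have "v \<noteq> {}" using v nonempty by metis
    then obtain z where "z \<in> v" by blast
    moreover have "v \<subseteq> x" using v union by blast
    ultimately obtain i where "i < n" "\<omega> i \<in> v" by (auto simp: x_def)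
    then show "v \<in> blocks s" using cls[OF _ v] by (auto simp: blocks_def quotient_def)
  next
    fix v assume "v \<in> blocks s"
    then obtain i where i: "i < n" "v = \<omega> ` (s `` {i})" by (auto simp: blocks_def quotient_def)
    then obtain w where "w \<in> L" "\<omega> i \<in> w" using omega_in[OF i(1)] union by blast
    then show "v \<in> L" using cls[OF i(1)] i(2) by simp
  qed
qed

lemma partition_braids_eq: "partition_braids x = nc_braid ` noncrossing n"
proof (intro equalityI subsetI)
  fix b assume "b \<in> partition_braids x"
  then obtain L where L: "non_obstructing_partition x L" "b = partition_braid x L" by (auto simp: partition_braids_def)
  then obtain s where "s \<in> noncrossing n" "L = blocks s" using non_obstructing_partition_blocks by blast
  then show "b \<in> nc_braid ` noncrossing n" using L by (auto simp: nc_braid_def)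
next
  fix b assume "b \<in> nc_braid ` noncrossing n"
  then show "b \<in> partition_braids x" using non_obstructing_blocks by (auto simp: partition_braids_def nc_braid_def)
qed

end

section \<open>Groups representing the noncrossing partitions\<close>

lemma atom_le_kreweras:
  assumes "i < j" "k < n" "l < n" "k \<in> {i..<j} \<longleftrightarrow> l \<in> {i..<j}"
  shows "atom n k l \<subseteq> kreweras n (atom n i j)"
  unfolding kreweras_atom[OF assms(1)] using assms(2-4) by (auto simp: atom_def)

text \<open>The three joins belonging to the sides of a triangle are one partition; using this
  inclusion cyclically gives the equalities.\<close>

lemma nc_join_atom_rotate:
  assumes "p < n" "q < n" "r < n"
  shows "nc_join n (atom n p q) (atom n q r) \<subseteq> nc_join n (atom n q r) (atom n r p)"
proof -
  let ?J = "nc_join n (atom n q r) (atom n r p)"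
  have J: "?J \<in> noncrossing n" by (intro nc_join_in atom_in assms)
  note D = noncrossingD[OF J]
  have up: "atom n q r \<subseteq> ?J" "atom n r p \<subseteq> ?J" by (rule nc_join_upper)+
  then have "(q, r) \<in> ?J" "(r, p) \<in> ?J" by (auto simp: atom_def)
  then have "(q, p) \<in> ?J" by (rule D(3))
  then have "atom n p q \<subseteq> ?J" using D(1,2) by (auto simp: atom_def)
  then show ?thesis by (rule nc_join_least[OF J _ up(1)])
qed

locale noncrossing_representation = clockwise_circle n \<omega> + G: group G
  for n \<omega> and G :: "('b, 'c) monoid_scheme" (structure) +
  fixes \<iota> :: "nat rel \<Rightarrow> 'b"
  assumes iota_in: "s \<in> noncrossing n \<Longrightarrow> \<iota> s \<in> carrier G"
    and iota_mult: "s \<in> noncrossing n \<Longrightarrow> t \<in> noncrossing n \<Longrightarrow> t \<subseteq> kreweras n s \<Longrightarrow>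
      \<iota> s \<otimes> \<iota> t = \<iota> (nc_join n s t)"
begin

text \<open>The prospective image in \<open>G\<close> of the half twist along the chord from
  \<open>p\<close> to \<open>q\<close>.\<close>

definition edge :: "complex \<Rightarrow> complex \<Rightarrow> 'b" where
  "edge p q = \<iota> (atom n (inv_into {..<n} \<omega> p) (inv_into {..<n} \<omega> q))"

lemma edge_omega: "i < n \<Longrightarrow> j < n \<Longrightarrow> edge (\<omega> i) (\<omega> j) = \<iota> (atom n i j)"
  using inj_omega by (simp add: edge_def)

lemma edge_commute: "edge p q = edge q p"
  by (simp add: edge_def atom_commute)

lemma x_elem: assumes "p \<in> x" obtains i where "i < n" "p = \<omega> i"
  using assms by (auto simp: x_def)

lemma edge_in: "p \<in> x \<Longrightarrow> q \<in> x \<Longrightarrow> edge p q \<in> carrier G"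
  by (elim x_elem) (simp add: edge_omega iota_in atom_in)

lemma edge_sorted:
  assumes "i < j" "j < k" "k < n"
  shows "edge (\<omega> i) (\<omega> j) \<otimes> edge (\<omega> j) (\<omega> k) = edge (\<omega> j) (\<omega> k) \<otimes> edge (\<omega> k) (\<omega> i)"
    "edge (\<omega> j) (\<omega> k) \<otimes> edge (\<omega> k) (\<omega> i) = edge (\<omega> k) (\<omega> i) \<otimes> edge (\<omega> i) (\<omega> j)"
proof -
  have n: "i < n" "j < n" "k < n" using assms by auto
  have 1: "edge (\<omega> i) (\<omega> j) \<otimes> edge (\<omega> j) (\<omega> k) = \<iota> (nc_join n (atom n i j) (atom n j k))"
    unfolding edge_omega[OF n(1,2)] edge_omega[OF n(2,3)]
    by (intro iota_mult atom_in atom_le_kreweras n) (use assms in auto)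
  have 2: "edge (\<omega> j) (\<omega> k) \<otimes> edge (\<omega> k) (\<omega> i) = \<iota> (nc_join n (atom n j k) (atom n k i))"
    unfolding edge_omega[OF n(2,3)] edge_omega[OF n(3,1)]
    by (intro iota_mult atom_in atom_le_kreweras n) (use assms in auto)
  have 3: "edge (\<omega> k) (\<omega> i) \<otimes> edge (\<omega> i) (\<omega> j) = \<iota> (nc_join n (atom n k i) (atom n i j))"
    unfolding edge_omega[OF n(3,1)] edge_omega[OF n(1,2)] atom_commute[of n k i]
    by (intro iota_mult atom_in atom_le_kreweras n) (use assms in auto)
  note r = nc_join_atom_rotate[OF n] nc_join_atom_rotate[OF n(2,3,1)] nc_join_atom_rotate[OF n(3,1,2)]
  have "nc_join n (atom n i j) (atom n j k) = nc_join n (atom n j k) (atom n k i)"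
    by (rule subset_antisym[OF r(1) subset_trans[OF r(2,3)]])
  then show "edge (\<omega> i) (\<omega> j) \<otimes> edge (\<omega> j) (\<omega> k) = edge (\<omega> j) (\<omega> k) \<otimes> edge (\<omega> k) (\<omega> i)"
    unfolding 1 2 by (rule arg_cong)
  have "nc_join n (atom n j k) (atom n k i) = nc_join n (atom n k i) (atom n i j)"
    by (rule subset_antisym[OF r(2) subset_trans[OF r(3,1)]])
  then show "edge (\<omega> j) (\<omega> k) \<otimes> edge (\<omega> k) (\<omega> i) = edge (\<omega> k) (\<omega> i) \<otimes> edge (\<omega> i) (\<omega> j)"
    unfolding 2 3 by (rule arg_cong)
qed

lemma edge_triangle:
  assumes "p \<in> x" "q \<in> x" "r \<in> x" "cross (q - p) (r - p) < 0"
  shows "edge p q \<otimes> edge q r = edge q r \<otimes> edge r p"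
proof -
  obtain i j k where i: "i < n" "p = \<omega> i" and j: "j < n" "q = \<omega> j" and k: "k < n" "r = \<omega> k"
    using assms(1-3) by (metis x_elem)
  have neg: "\<not> cross (\<omega> k - \<omega> i) (\<omega> j - \<omega> i) < 0"
    using assms(4) cross_swap[of q p r] unfolding i j k by linarith
  have "i \<noteq> j" "j \<noteq> k" "i \<noteq> k"
    using assms(4) unfolding i j k by (auto simp: algebra_simps)
  \<comment> \<open>The first three orders are the cyclic rotations of the increasing one, hence
    clockwise. The other three are counterclockwise, against the assumption.\<close>
  then consider "i < j" "j < k" | "j < k" "k < i" | "k < i" "i < j"
    | "i < k" "k < j" | "k < j" "j < i" | "j < i" "i < k" by linarith
  then show ?thesis
  proof cases
    case 1
    then show ?thesis using edge_sorted(1) i j k by blast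
  next
    case 2
    then show ?thesis using edge_sorted[OF 2] i j k by simp
  next
    case 3
    then show ?thesis using edge_sorted[OF 3] i j k by simp
  next
    case 4
    then show ?thesis using neg clockwise[OF 4] j by blast
  next
    case 5
    then show ?thesis using neg clockwise[OF 5 i(1)] cross_rotate[of "\<omega> j" "\<omega> k" "\<omega> i"] cross_rotate[of "\<omega> i" "\<omega> j" "\<omega> k"]
      cross_rotate[of "\<omega> k" "\<omega> i" "\<omega> j"] by simp
  next
    case 6
    then show ?thesis using neg clockwise[OF 6 k(1)] cross_rotate[of "\<omega> j" "\<omega> k" "\<omega> i"] cross_rotate[of "\<omega> i" "\<omega> j" "\<omega> k"]
      cross_rotate[of "\<omega> k" "\<omega> i" "\<omega> j"] by simp
  qed
qed

lemma orientation_cases: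
  assumes "p \<in> x" "q \<in> x" "r \<in> x" "p \<noteq> q" "q \<noteq> r" "p \<noteq> r"
  shows "cross (q - p) (r - p) < 0 \<or> cross (q - r) (p - r) < 0"
proof -
  obtain i j k where i: "i < n" "p = \<omega> i" and j: "j < n" "q = \<omega> j" and k: "k < n" "r = \<omega> k"
    using assms(1-3) by (metis x_elem)
  have ne: "i \<noteq> j" "j \<noteq> k" "i \<noteq> k" using assms(4-6) i j k by auto
  have "cross (q - r) (p - r) = - cross (q - p) (r - p)"
    using cross_swap[of q p r] cross_rotate[of r p q] cross_rotate[of q r p] by simp
  moreover have "cross (q - p) (r - p) \<noteq> 0"
  proof (cases "i < j")
    case True
    then show ?thesis using chord_sign[OF True j(1) k(1)] ne unfolding i j k
      by (metis less_irrefl linorder_neqE_nat)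
  next
    case False
    then have ji: "j < i" using ne by simp
    have "cross (p - q) (r - q) \<noteq> 0"
      using chord_sign[OF ji i(1) k(1)] ne unfolding i j k by (metis less_irrefl linorder_neqE_nat)
    moreover have "cross (q - p) (r - p) = - cross (p - q) (r - q)"
      by (simp add: algebra_simps)
    ultimately show ?thesis by simp
  qed
  ultimately show ?thesis by linarith
qed

text \<open>The three equal products of a triangle imply the braid relation:
  \<open>a b = b c = c a\<close> gives \<open>a b a = b c a = b a b\<close>.\<close>

lemma edge_braid:
  assumes x: "p \<in> x" "q \<in> x" "r \<in> x" and ne: "p \<noteq> q" "q \<noteq> r" "p \<noteq> r"
  shows "edge p q \<otimes> edge q r \<otimes> edge p q = edge q r \<otimes> edge p q \<otimes> edge q r"
proof -
  have in_G: "edge p q \<in> carrier G" "edge q r \<in> carrier G" "edge r p \<in> carrier G"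
    using edge_in x by auto
  have rot: "a \<otimes> b \<otimes> a = b \<otimes> a \<otimes> b"
    if abc: "a \<in> carrier G" "b \<in> carrier G" "c \<in> carrier G" "a \<otimes> b = b \<otimes> c" "b \<otimes> c = c \<otimes> a" for a b c
  proof -
    have "a \<otimes> b \<otimes> a = b \<otimes> (c \<otimes> a)" unfolding abc(4) by (rule G.m_assoc[OF abc(2,3,1)])
    also have "c \<otimes> a = a \<otimes> b" using abc(4,5) by simp
    also have "b \<otimes> (a \<otimes> b) = b \<otimes> a \<otimes> b" by (rule G.m_assoc[OF abc(2,1,2), symmetric])
    finally show ?thesis .
  qed
  show ?thesis
    using orientation_cases[OF x ne]
  proof
    assume o: "cross (q - p) (r - p) < 0"
    then have o': "cross (r - q) (p - q) < 0" unfolding cross_rotate[of q p r] .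
    show ?thesis using rot[OF in_G] edge_triangle[OF x o] edge_triangle[OF x(2,3,1) o'] by blast
  next
    assume o: "cross (q - r) (p - r) < 0"
    then have o': "cross (p - q) (r - q) < 0" unfolding cross_rotate[of q r p] .
    have "edge q r \<otimes> edge p q = edge p q \<otimes> edge r p" "edge p q \<otimes> edge r p = edge r p \<otimes> edge q r"
      using edge_triangle[OF x(3,2,1) o] edge_triangle[OF x(2,1,3) o']
      by (simp_all add: edge_commute[of r q] edge_commute[of q p] edge_commute[of p r])
    then show ?thesis using rot[OF in_G(2,1,3)] by simp
  qed
qed

text \<open>Chords that do not meet do not cross in the order of the indices. Each atom then lies
  below the complement of the other, and both products are the join.\<close>

lemma edge_disjoint:
  assumes x: "p \<in> x" "q \<in> x" "p' \<in> x" "q' \<in> x" and ne: "p \<noteq> q" "p' \<noteq> q'"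
    and disj: "closed_segment p q \<inter> closed_segment p' q' = {}"
  shows "edge p q \<otimes> edge p' q' = edge p' q' \<otimes> edge p q"
proof -
  have main: "edge (\<omega> i) (\<omega> j) \<otimes> edge (\<omega> k) (\<omega> l) = edge (\<omega> k) (\<omega> l) \<otimes> edge (\<omega> i) (\<omega> j)"
    if ij: "i < j" "j < n" and kl: "k < l" "l < n"
      and disj: "closed_segment (\<omega> i) (\<omega> j) \<inter> closed_segment (\<omega> k) (\<omega> l) = {}" for i j k l
  proof -
    have n: "i < n" "k < n" using ij kl by auto
    have "i \<noteq> k" "i \<noteq> l" "j \<noteq> k" "j \<noteq> l" using disj by auto
    moreover have "\<not> (i < k \<and> k < j \<and> j < l)" using chords_cross[of i k j l] disj kl by blast
    moreover have "\<not> (k < i \<and> i < l \<and> l < j)" using chords_cross[of k i l j] disj ij by blast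
    ultimately have sides: "k \<in> {i..<j} \<longleftrightarrow> l \<in> {i..<j}" "i \<in> {k..<l} \<longleftrightarrow> j \<in> {k..<l}"
      using ij kl by auto
    note le = atom_le_kreweras[OF ij(1) n(2) kl(2) sides(1)] atom_le_kreweras[OF kl(1) n(1) ij(2) sides(2)]
    have a: "atom n i j \<in> noncrossing n" "atom n k l \<in> noncrossing n" using ij kl n atom_in by auto
    show ?thesis
      unfolding edge_omega[OF n(1) ij(2)] edge_omega[OF n(2) kl(2)]
        iota_mult[OF a le(1)] iota_mult[OF a(2,1) le(2)] germ.J_commute[OF a] ..
  qed
  have main': "edge (\<omega> i) (\<omega> j) \<otimes> edge p q = edge p q \<otimes> edge (\<omega> i) (\<omega> j)"
    if ij: "i < j" "j < n" and pq: "p \<in> x" "q \<in> x" "p \<noteq> q"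
      and disj: "closed_segment (\<omega> i) (\<omega> j) \<inter> closed_segment p q = {}" for i j p q
  proof -
    obtain k l where kl: "k < n" "p = \<omega> k" "l < n" "q = \<omega> l" using pq by (metis x_elem)
    have "k \<noteq> l" using pq kl by auto
    then consider "k < l" | "l < k" by linarith
    then show ?thesis
    proof cases
      case 1
      then show ?thesis using main[OF ij 1 kl(3)] disj kl by simp
    next
      case 2
      then show ?thesis using main[OF ij 2 kl(1)] disj kl edge_commute[of p q] closed_segment_commute[of \<open>\<omega> k\<close> \<open>\<omega> l\<close>] by simp
    qed
  qed
  obtain i j where ij: "i < n" "p = \<omega> i" "j < n" "q = \<omega> j" using x(1,2) by (metis x_elem)
  have "i \<noteq> j" using ne ij by auto
  then consider "i < j" | "j < i" by linarith
  then show ?thesis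
  proof cases
    case 1
    then show ?thesis using main'[OF 1 ij(3) x(3,4) ne(2)] disj ij by simp
  next
    case 2
    then show ?thesis
      using main'[OF 2 ij(1) x(3,4) ne(2)] disj ij edge_commute[of p q] closed_segment_commute[of \<open>\<omega> i\<close> \<open>\<omega> j\<close>] by simp
  qed
qed

end

text \<open>For \<open>v = Complex 1 s\<close> the numbers \<open>Re (v * z)\<close> and
  \<open>Re (v * w)\<close> agree only if \<open>Re (z - w) = s * Im (z - w)\<close>. So
  \<open>s\<close> has to avoid finitely many quotients.\<close>

lemma generic_direction:
  fixes x :: "complex set"
  assumes "finite x" obtains u :: complex where "norm u = 1" "inj_on (\<lambda>z. Re (u * z)) x"
proof -
  define slope where "slope = (\<lambda>(z, w). Re (z - w) / Im (z - w))"
  obtain s where s: "s \<notin> slope ` (x \<times> x)"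
    using ex_new_if_finite[OF infinite_UNIV_char_0[where 'a = real], of "slope ` (x \<times> x)"] assms by blast
  define v where "v = Complex 1 s"
  have v0: "v \<noteq> 0" by (simp add: v_def complex_eq_iff)
  define u where "u = v / of_real (norm v)"
  have Re_u: "Re (u * z) = Re (v * z) / norm v" for z
    unfolding u_def by (simp add: Re_divide_of_real)
  have "inj_on (\<lambda>z. Re (u * z)) x"
  proof (rule inj_onI)
    fix z w assume zw: "z \<in> x" "w \<in> x" "Re (u * z) = Re (u * w)"
    then have "Re (v * z) = Re (v * w)" using v0 unfolding Re_u by simp
    then have eq: "Re (z - w) = s * Im (z - w)" by (simp add: v_def algebra_simps)
    have "Im (z - w) = 0"
    proof (rule ccontr)
      assume "Im (z - w) \<noteq> 0"
      then have "slope (z, w) = s" unfolding slope_def using eq by simp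
      then show False using s zw by force
    qed
    with eq show "z = w" by (simp add: complex_eq_iff)
  qed
  moreover have "norm u = 1" using v0 by (simp add: u_def norm_divide)
  ultimately show thesis using that by blast
qed

lemma segments_separated:
  assumes "Re (u * a) < t" "Re (u * b) < t" "t \<le> Re (u * c)" "t \<le> Re (u * d)"
  shows "closed_segment a b \<inter> closed_segment c d = {}"
proof -
  have Re_inner: "Re (u * z) = inner (cnj u) z" for z by (simp add: inner_complex_def)
  have "closed_segment a b \<subseteq> {z. inner (cnj u) z < t}"
    using assms(1,2) by (intro closed_segment_subset convex_halfspace_lt) (auto simp: Re_inner simp del: times_complex.sel)
  moreover have "closed_segment c d \<subseteq> {z. t \<le> inner (cnj u) z}"
    using assms(3,4) by (intro closed_segment_subset convex_halfspace_ge) (auto simp: Re_inner simp del: times_complex.sel)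
  ultimately show ?thesis by fastforce
qed

section \<open>The morphism from the braid group to a group representing the partitions\<close>

context noncrossing_representation begin

lemma card_x: "card x = n"
  using inj_omega by (simp add: x_def card_image)

text \<open>Holonomy gives the values on neighbours in the order of a generic direction; the other
  pairs are treated by induction on the difference of their ranks. The numbering by
  \<open>\<omega>\<close> and this order are unrelated.\<close>

lemma edge_morphism:
  obtains \<Phi> where "\<Phi> \<in> hom H G" "\<And>p q. p \<in> x \<Longrightarrow> q \<in> x \<Longrightarrow> p \<noteq> q \<Longrightarrow> \<Phi> (ht p q) = edge p q"
proof -
  obtain u where u: "norm u = 1" and gen: "inj_on (\<lambda>z. Re (u * z)) x"
    using generic_direction[OF finite_x] .
  then have u0: "u \<noteq> 0" by auto
  let ?e = "nth_point u x"
  define \<sigma> where "\<sigma> i = edge (?e i) (?e (Suc i))" for i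
  have e_in: "?e i \<in> x" and rank_e: "rank_in u x (?e i) = i" if "i < n" for i
    using nth_point(1,2)[OF finite_x u0] that card_x by auto
  have e_rank: "?e (rank_in u x p) = p" if "p \<in> x" for p using nth_point(3)[OF finite_x u0 that] .
  have e_eq: "?e i = ?e j \<longleftrightarrow> i = j" if "i < n" "j < n" for i j using rank_e that by metis
  have e_less: "Re (u * ?e i) < Re (u * ?e j)" if ij: "i < j" "j < n" for i j
  proof -
    have i: "i < n" using ij by simp
    then have "lexless u (?e i) (?e j)"
      using rank_in_less_iff[OF finite_x u0 e_in[OF i] e_in[OF ij(2)]] ij rank_e by simp
    moreover have "Re (u * ?e i) \<noteq> Re (u * ?e j)"
      using inj_on_eq_iff[OF gen e_in[OF i] e_in[OF ij(2)]] e_eq[OF i ij(2)] ij(1) by (metis less_irrefl)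
    ultimately show ?thesis unfolding lexless_def by blast
  qed
  \<comment> \<open>Segments joining two disjoint pairs of neighbours are separated by a line
    \<open>Re (u * z) = const\<close>, hence disjoint. This is why the order comes from a
    direction.\<close>
  interpret braid_relations G n \<sigma>
  proof
    show "\<sigma> i \<in> carrier G" if "Suc i < n" for i using that by (simp add: \<sigma>_def edge_in e_in)
    show "\<sigma> i \<otimes> \<sigma> j = \<sigma> j \<otimes> \<sigma> i" if ij: "Suc i < j" "Suc j < n" for i j
      unfolding \<sigma>_def
    proof (rule edge_disjoint)
      show "closed_segment (?e i) (?e (Suc i)) \<inter> closed_segment (?e j) (?e (Suc j)) = {}"
        by (rule segments_separated[where t = "Re (u * ?e j)"])
          (use ij in \<open>auto intro!: e_less less_imp_le[OF e_less] simp del: times_complex.sel\<close>)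
    qed (use ij in \<open>auto simp: e_in e_eq\<close>)
    show "\<sigma> i \<otimes> \<sigma> (Suc i) \<otimes> \<sigma> i = \<sigma> (Suc i) \<otimes> \<sigma> i \<otimes> \<sigma> (Suc i)" if "Suc (Suc i) < n" for i
      unfolding \<sigma>_def by (rule edge_braid) (use that in \<open>auto simp: e_in e_eq\<close>)
  qed
  obtain \<Phi> where hom: "\<Phi> \<in> hom H G"
    and \<Phi>: "\<And>a b. a \<in> x \<Longrightarrow> b \<in> x \<Longrightarrow> rank_in u x b = Suc (rank_in u x a) \<Longrightarrow> non_obstructing_pair x a b \<Longrightarrow>
       \<Phi> (ht a b) = \<sigma> (rank_in u x a)"
    using holonomy_morphism[OF u finite_x card_x gen] by blast
  \<comment> \<open>The triangle relation for \<open>p\<close>, \<open>m\<close>, \<open>q\<close>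
    holds for half twists and for edges, and in either orientation it determines the side
    \<open>p q\<close> from the other two by cancellation in \<open>G\<close>.\<close>
  have third: "\<Phi> (ht p q) = edge p q"
    if x: "p \<in> x" "q \<in> x" "m \<in> x" and ne: "p \<noteq> q" "p \<noteq> m" "m \<noteq> q"
      and m: "\<Phi> (ht p m) = edge p m" "\<Phi> (ht m q) = edge m q" for p q m
  proof -
    have hom_ht: "\<Phi> (ht a b \<otimes>\<^bsub>H\<^esub> ht c d) = \<Phi> (ht a b) \<otimes> \<Phi> (ht c d)"
      if "a \<in> x" "b \<in> x" "c \<in> x" "d \<in> x" "a \<noteq> b" "c \<noteq> d" for a b c d
      using hom_mult[OF hom] ht_in that by blast
    have im: "\<Phi> (ht p q) \<in> carrier G" using hom_in_carrier[OF hom] ht_in x ne by blast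
    show ?thesis
      using orientation_cases[OF x(1,3,2) ne(2,3,1)]
    proof
      assume o: "cross (m - p) (q - p) < 0"
      have "edge m q \<otimes> \<Phi> (ht p q) = \<Phi> (ht p m \<otimes>\<^bsub>H\<^esub> ht m q)"
        unfolding ht_triangle[OF x(1,3,2) o] half_twist_commute[of x p q]
        using hom_ht[of m q q p] x ne m by simp
      also have "\<dots> = edge m q \<otimes> edge q p"
        using hom_ht[of p m m q] x ne m edge_triangle[OF x(1,3,2) o] by simp
      finally show ?thesis
        using G.Units_l_cancel[of "edge m q" "\<Phi> (ht p q)" "edge q p"] im x edge_in edge_commute[of p q] by (simp add: G.Units_eq)
    next
      assume o: "cross (m - q) (p - q) < 0"
      have "edge p m \<otimes> \<Phi> (ht p q) = \<Phi> (ht q m \<otimes>\<^bsub>H\<^esub> ht m p)"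
        unfolding ht_triangle[OF x(2,3,1) o] using hom_ht[of m p p q] x ne m half_twist_commute[of x m p] by simp
      also have "\<dots> = edge p m \<otimes> edge p q"
        using hom_ht[of q m m p] x ne m edge_triangle[OF x(2,3,1) o]
          half_twist_commute[of x m p] half_twist_commute[of x q m] edge_commute[of q m] edge_commute[of m p] by simp
      finally show ?thesis
        using G.Units_l_cancel[of "edge p m" "\<Phi> (ht p q)" "edge p q"] im x edge_in by (simp add: G.Units_eq)
    qed
  qed
  have \<Phi>_e: "\<Phi> (ht (?e i) (?e (Suc (i + d)))) = edge (?e i) (?e (Suc (i + d)))" if "Suc (i + d) < n" for i d
    using that
  proof (induction d arbitrary: i)
    case 0
    then have "\<Phi> (ht (?e i) (?e (Suc i))) = \<sigma> (rank_in u x (?e i))"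
      by (intro \<Phi> no_pair) (auto simp: e_in rank_e e_eq)
    then show ?case using 0 by (simp add: rank_e \<sigma>_def)
  next
    case (Suc d)
    have n: "i < n" "Suc i < n" "Suc (Suc i + d) < n" using Suc.prems by auto
    have "\<Phi> (ht (?e i) (?e (Suc (Suc i + d)))) = edge (?e i) (?e (Suc (Suc i + d)))"
    proof (rule third)
      show "\<Phi> (ht (?e i) (?e (Suc i))) = edge (?e i) (?e (Suc i))"
        using \<Phi>[of "?e i" "?e (Suc i)"] no_pair[of "?e i" "?e (Suc i)"] n by (simp add: e_in rank_e e_eq \<sigma>_def)
      show "\<Phi> (ht (?e (Suc i)) (?e (Suc (Suc i + d)))) = edge (?e (Suc i)) (?e (Suc (Suc i + d)))"
        by (rule Suc.IH[OF n(3)])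
    qed (use n in \<open>auto simp: e_in e_eq\<close>)
    then show ?case by simp
  qed
  show thesis
  proof (rule that[OF hom])
    fix p q assume pq: "p \<in> x" "q \<in> x" "p \<noteq> q"
    define i j where "i = rank_in u x p" and "j = rank_in u x q"
    have ij: "i < n" "j < n" "p = ?e i" "q = ?e j"
      using rank_in_less_card[OF finite_x, of _ u] card_x e_rank pq by (auto simp: i_def j_def)
    have "i \<noteq> j" using pq ij by auto
    then consider d where "j = Suc (i + d)" | d where "i = Suc (j + d)"
      by (metis less_iff_Suc_add linorder_neqE_nat)
    then show "\<Phi> (ht p q) = edge p q"
    proof cases
      case 1
      then show ?thesis using \<Phi>_e[of i d] ij by simp
    next
      case 2
      then show ?thesis using \<Phi>_e[of j d] ij half_twist_commute[of x p q] edge_commute[of p q] by simp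
    qed
  qed
qed

lemma iota_Id: "\<iota> (Id_on {..<n}) = \<one>"
proof -
  have Id: "Id_on {..<n} \<in> noncrossing n" by (rule noncrossing_Id_on)
  have "\<iota> (Id_on {..<n}) \<otimes> \<iota> (Id_on {..<n}) = \<iota> (Id_on {..<n})"
    using iota_mult[OF Id Id germ.bot_le[OF kreweras_in]] germ.J_idem[OF Id] by simp
  then show ?thesis using G.r_cancel_one[of "\<iota> (Id_on {..<n})" "\<iota> (Id_on {..<n})"] iota_in[OF Id] by simp
qed

lemma representation_extends:
  obtains \<Phi> where "\<Phi> \<in> hom H G" "\<Phi> \<one>\<^bsub>H\<^esub> = \<one>" "\<And>s. s \<in> noncrossing n \<Longrightarrow> \<Phi> (nc_braid s) = \<iota> s"
proof -
  obtain \<Phi> where hom: "\<Phi> \<in> hom H G"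
    and \<Phi>: "\<And>p q. p \<in> x \<Longrightarrow> q \<in> x \<Longrightarrow> p \<noteq> q \<Longrightarrow> \<Phi> (ht p q) = edge p q"
    by (rule edge_morphism) blast
  have one: "\<Phi> \<one>\<^bsub>H\<^esub> = \<one>"
    using hom_mult[OF hom, of "\<one>\<^bsub>H\<^esub>" "\<one>\<^bsub>H\<^esub>"] hom_in_carrier[OF hom, of "\<one>\<^bsub>H\<^esub>"] G.r_cancel_one[of "\<Phi> \<one>\<^bsub>H\<^esub>" "\<Phi> \<one>\<^bsub>H\<^esub>"] by simp
  have "\<Phi> (nc_braid s) = \<iota> s" if "s \<in> noncrossing n" for s
    using that
  proof (induction rule: noncrossing_atom_induct)
    case Id
    then show ?case by (simp add: nc_braid_Id one iota_Id)
  next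
    case (factor s i j)
    let ?r = "kreweras n (atom n i j) \<inter> s"
    have n: "i < n" "j < n" using noncrossingD(4)[OF factor.hyps(1,2)] by auto
    have a: "atom n i j \<in> noncrossing n" by (rule atom_in[OF n])
    have r: "?r \<in> noncrossing n" by (intro noncrossing_Int kreweras_in factor.hyps)
    have "\<Phi> (nc_braid s) = \<Phi> (ht (\<omega> i) (\<omega> j)) \<otimes> \<Phi> (nc_braid ?r)"
      unfolding nc_braid_atom_factor[OF factor.hyps]
      using ht_in n factor.hyps(3) by (intro hom_mult[OF hom] nc_braid_in[OF r]) (auto simp: omega_in omega_eq_iff)
    also have "\<Phi> (ht (\<omega> i) (\<omega> j)) = \<iota> (atom n i j)"
      using \<Phi> n factor.hyps(3) by (simp add: omega_in omega_eq_iff edge_omega)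
    also have "\<iota> (atom n i j) \<otimes> \<Phi> (nc_braid ?r) = \<iota> (nc_join n (atom n i j) ?r)"
      unfolding factor.IH by (rule iota_mult[OF a r Int_lower1])
    also have "nc_join n (atom n i j) ?r = s"
      using germ.J_quotient[OF a factor.hyps(1)] atom_le[OF factor.hyps(1,2)] by simp
    finally show ?case .
  qed
  then show thesis using that hom one by blast
qed

end

section \<open>The associated monoid\<close>

lemma word_equiv_list_product:
  assumes "monoid G" "P \<subseteq> carrier G" "word_equiv P \<one>\<^bsub>G\<^esub> (restricted_product G P) u v"
  shows "list_product G u = list_product G v"
proof -
  interpret G: monoid G by fact
  have app: "list_product G (u @ v) = list_product G u \<otimes>\<^bsub>G\<^esub> list_product G v" if "u \<in> lists P" "v \<in> lists P" for u v
    using that assms(2) by (intro G.list_product_append) auto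
  have car: "list_product G u \<in> carrier G" if "u \<in> lists P" for u
    using that assms(2) by (intro G.list_product_in) auto
  show ?thesis
    using assms(3)
  proof induction
    case (product u v a b c)
    then have c: "c = a \<otimes>\<^bsub>G\<^esub> b" by (simp add: restricted_product_def split: if_splits)
    have "a \<in> carrier G" "b \<in> carrier G" "list_product G v \<in> carrier G" using product assms(2) car by auto
    then have "list_product G ([a, b] @ v) = list_product G ([c] @ v)" by (simp add: c G.m_assoc)
    then show ?case using product app[of u "[a, b] @ v"] app[of u "[c] @ v"] by simp
  next
    case (unit u v)
    then show ?case using app[of u "[\<one>\<^bsub>G\<^esub>] @ v"] app[of u v] car by simp
  qed simp_all
qed

lemma natural_morphism_iso:
  assumes "monoid G" and P: "P \<subseteq> carrier G"
    and equiv_iff: "\<And>u v. u \<in> lists P \<Longrightarrow> v \<in> lists P \<Longrightarrow>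
      word_equiv P e m u v \<longleftrightarrow> list_product G u = list_product G v"
    and generated: "carrier G \<subseteq> list_product G ` lists P"
  shows "natural_morphism G \<in> iso (associated_monoid P e m) G"
proof -
  interpret monoid G by fact
  let ?A = "associated_monoid P e m"
  define E where "E = {(u, v). word_equiv P e m u v}"
  have E_class: "E `` {u} = {v \<in> lists P. list_product G v = list_product G u}" if "u \<in> lists P" for u
    using equiv_iff[OF that] word_equiv_lists(2) by (fastforce simp: E_def)
  have product_in: "list_product G u \<in> carrier G" if "u \<in> lists P" for u
    using that P by (intro list_product_in) auto
  have morphism: "natural_morphism G (E `` {u}) = list_product G u" if u: "u \<in> lists P" for u
  proof -
    have "list_product G ` (E `` {u}) = {list_product G u}" unfolding E_class[OF u] using u by auto
    then show ?thesis by (simp add: natural_morphism_def)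
  qed
  have carrier: "carrier ?A = (\<lambda>u. E `` {u}) ` lists P"
    by (auto simp: associated_monoid_def E_def quotient_def)
  have mult: "E `` {u} \<otimes>\<^bsub>?A\<^esub> E `` {v} = E `` {u @ v}" if uv: "u \<in> lists P" "v \<in> lists P" for u v
  proof -
    have cong: "E `` {u' @ v'} = E `` {u @ v}" if "u' \<in> E `` {u}" "v' \<in> E `` {v}" for u' v'
    proof -
      have "word_equiv P e m (u @ v) (u' @ v')"
        using that by (intro word_equiv_append) (simp_all add: E_def)
      then show ?thesis unfolding E_def by (auto intro: word_equiv.sym word_equiv.trans)
    qed
    have "u \<in> E `` {u}" "v \<in> E `` {v}" using uv by (simp_all add: E_def word_equiv.refl)
    then have "(\<Union>u'\<in>E `` {u}. \<Union>v'\<in>E `` {v}. E `` {u' @ v'}) = E `` {u @ v}"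
      using cong by blast
    then show ?thesis by (simp add: associated_monoid_def E_def)
  qed
  show ?thesis
  proof (rule isoI)
    show "natural_morphism G \<in> hom ?A G"
    proof (rule homI)
      fix U assume "U \<in> carrier ?A"
      then obtain u where u: "u \<in> lists P" "U = E `` {u}" unfolding carrier by blast
      then show "natural_morphism G U \<in> carrier G" by (simp only: morphism product_in)
      fix V assume "V \<in> carrier ?A"
      then obtain v where v: "v \<in> lists P" "V = E `` {v}" unfolding carrier by blast
      have "list_product G (u @ v) = list_product G u \<otimes>\<^bsub>G\<^esub> list_product G v"
        using u(1) v(1) P by (intro list_product_append) auto
      moreover have "u @ v \<in> lists P" using u(1) v(1) by simp
      ultimately show "natural_morphism G (U \<otimes>\<^bsub>?A\<^esub> V) = natural_morphism G U \<otimes>\<^bsub>G\<^esub> natural_morphism G V"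
        by (simp only: u(2) v(2) mult[OF u(1) v(1)] morphism u(1) v(1))
    qed
    show "bij_betw (natural_morphism G) (carrier ?A) (carrier G)"
      unfolding bij_betw_def
    proof
      show "inj_on (natural_morphism G) (carrier ?A)"
      proof (rule inj_onI)
        fix U V assume "U \<in> carrier ?A" "V \<in> carrier ?A" and eq: "natural_morphism G U = natural_morphism G V"
        then obtain u v where u: "u \<in> lists P" "U = E `` {u}" and v: "v \<in> lists P" "V = E `` {v}"
          unfolding carrier by blast
        have "list_product G u = list_product G v" using eq by (simp only: u(2) v(2) morphism u(1) v(1))
        then show "U = V" by (simp only: u(2) v(2) E_class[OF u(1)] E_class[OF v(1)])
      qed
      show "natural_morphism G ` carrier ?A = carrier G"
      proof (intro equalityI subsetI)
        fix b assume "b \<in> natural_morphism G ` carrier ?A"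
        then obtain u where u: "u \<in> lists P" "b = natural_morphism G (E `` {u})" unfolding carrier by blast
        show "b \<in> carrier G" unfolding u(2) morphism[OF u(1)] by (rule product_in[OF u(1)])
      next
        fix b assume "b \<in> carrier G"
        then obtain u where u: "u \<in> lists P" "b = list_product G u" using generated by blast
        show "b \<in> natural_morphism G ` carrier ?A"
          unfolding carrier u(2) morphism[OF u(1), symmetric] using u(1) by blast
      qed
    qed
  qed
qed

lemma (in monoid) submonoid_generated_subset:
  assumes "S \<subseteq> carrier G" shows "submonoid_generated G S \<subseteq> carrier G"
proof
  fix a assume "a \<in> submonoid_generated G S"
  then show "a \<in> carrier G" by induction (use assms in auto)
qed

lemma (in monoid) monoid_submonoid_generated:
  assumes "S \<subseteq> carrier G" shows "monoid (G\<lparr>carrier := submonoid_generated G S\<rparr>)"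
  using submonoid_generated_subset[OF assms]
  by (intro monoidI) (auto intro: submonoid_generated.intros simp: m_assoc subset_iff)

section \<open>The braid monoid of points on a circle\<close>

context clockwise_circle begin

abbreviation M :: "braid monoid" where "M \<equiv> braid_monoid x"

definition twists :: "braid set" where
  "twists = {ht z z' | z z'. non_obstructing_pair x z z'}"

lemma M_simps: "carrier M = submonoid_generated H twists" "\<one>\<^bsub>M\<^esub> = \<one>\<^bsub>H\<^esub>" "mult M = mult H"
  by (simp_all add: braid_monoid_def twists_def)

lemma twists_in_H: "twists \<subseteq> carrier H"
  using half_twist_in[OF finite_x] by (auto simp: twists_def)

lemma monoid_M: "monoid M"
  using H.monoid_submonoid_generated[OF twists_in_H] by (simp add: braid_monoid_def twists_def)

lemma twists_subset: "twists \<subseteq> nc_braid ` noncrossing n"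
proof
  fix b assume "b \<in> twists"
  then obtain z z' where z: "b = ht z z'" "z \<in> x" "z' \<in> x" "z \<noteq> z'"
    by (auto simp: twists_def non_obstructing_pair_def)
  then obtain i j where ij: "i < n" "z = \<omega> i" "j < n" "z' = \<omega> j" by (auto simp: x_def)
  have "i \<noteq> j" using z ij by auto
  then consider "i < j" | "j < i" by linarith
  then show "b \<in> nc_braid ` noncrossing n"
  proof cases
    case 1
    then have "b = nc_braid (atom n i j)" using nc_braid_atom[OF 1] z ij by simp
    then show ?thesis using atom_in[OF ij(1,3)] by blast
  next
    case 2
    then have "b = nc_braid (atom n j i)" using nc_braid_atom[OF 2] z ij half_twist_commute[of x z z'] by simp
    then show ?thesis using atom_in[OF ij(3,1)] by blast
  qed
qed

lemma nc_braid_in_M: "s \<in> noncrossing n \<Longrightarrow> nc_braid s \<in> carrier M"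
proof (induction rule: noncrossing_atom_induct)
  case Id
  then show ?case by (simp add: nc_braid_Id M_simps submonoid_generated.one)
next
  case (factor s i j)
  then have "i < n" "j < n" using noncrossingD(4) by blast+
  then have "non_obstructing_pair x (\<omega> i) (\<omega> j)"
    using no_pair factor.hyps(3) by (simp add: omega_in omega_eq_iff)
  then have "ht (\<omega> i) (\<omega> j) \<in> submonoid_generated H twists"
    by (intro submonoid_generated.incl) (auto simp: twists_def)
  then show ?case
    using factor.IH unfolding nc_braid_atom_factor[OF factor.hyps] M_simps by (rule submonoid_generated.mult)
qed

lemma list_product_M: "list_product M w = list_product H w"
  by (induction w) (simp_all add: M_simps)

lemma braid_monoid_words: "carrier M \<subseteq> list_product M ` lists (nc_braid ` noncrossing n)"
proof
  let ?P = "nc_braid ` noncrossing n"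
  have P: "?P \<subseteq> carrier H" using nc_braid_in by blast
  fix b assume "b \<in> carrier M"
  then have "b \<in> submonoid_generated H twists" by (simp add: M_simps)
  then have "\<exists>w\<in>lists ?P. b = list_product H w"
  proof induction
    case one
    show ?case by (rule bexI[of _ "[]"]) auto
  next
    case (incl s)
    then have s: "s \<in> ?P" using twists_subset by blast
    then have "s = list_product H [s]" using P by auto
    then show ?case using s by (intro bexI[of _ "[s]"]) auto
  next
    case (mult a b)
    then obtain u v where uv: "u \<in> lists ?P" "a = list_product H u" "v \<in> lists ?P" "b = list_product H v" by blast
    have "list_product H (u @ v) = a \<otimes>\<^bsub>H\<^esub> b"
      unfolding uv(2,4) by (rule H.list_product_append) (use uv(1,3) P in auto)
    then show ?case using uv by (intro bexI[of _ "u @ v"]) auto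
  qed
  then show "b \<in> list_product M ` lists ?P" by (auto simp: list_product_M)
qed

text \<open>Equal products in \<open>M\<close> have equal images under \<open>\<Phi>\<close>, which
  are the values in \<open>G\<close> of the underlying words of partitions. These words are
  therefore congruent by lattice products, each of which is a defined product of \<open>P\<close> by
  \<open>nc_braid_mult\<close>.\<close>

lemma word_equiv_braids_iff:
  defines "P \<equiv> nc_braid ` noncrossing n"
  assumes uv: "u \<in> lists P" "v \<in> lists P"
  shows "word_equiv P \<one>\<^bsub>M\<^esub> (restricted_product M P) u v \<longleftrightarrow> list_product M u = list_product M v"
proof
  assume "word_equiv P \<one>\<^bsub>M\<^esub> (restricted_product M P) u v"
  then show "list_product M u = list_product M v"
    by (rule word_equiv_list_product[OF monoid_M, rotated]) (use nc_braid_in_M in \<open>auto simp: P_def\<close>)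
next
  assume eq: "list_product M u = list_product M v"
  obtain G :: "(nat rel list \<times> nat) set monoid" and \<iota> where G: "group G" "\<iota> \<in> noncrossing n \<rightarrow> carrier G"
    and mult: "\<And>s t. s \<in> noncrossing n \<Longrightarrow> t \<in> noncrossing n \<Longrightarrow> t \<subseteq> kreweras n s \<Longrightarrow>
      \<iota> s \<otimes>\<^bsub>G\<^esub> \<iota> t = \<iota> (nc_join n s t)"
    and embed: "\<And>u v. u \<in> lists (noncrossing n) \<Longrightarrow> v \<in> lists (noncrossing n) \<Longrightarrow>
       list_product G (map \<iota> u) = list_product G (map \<iota> v) \<Longrightarrow>
       word_equiv (noncrossing n) (Id_on {..<n}) germ.prd u v"
    by (rule germ.embeds_in_group) blast
  interpret G: group G by fact
  interpret R: noncrossing_representation n \<omega> G \<iota>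
    by standard (use G(2) mult in auto)
  obtain \<Phi> where hom: "\<Phi> \<in> hom H G" and one: "\<Phi> \<one>\<^bsub>H\<^esub> = \<one>\<^bsub>G\<^esub>"
    and \<Phi>: "\<And>s. s \<in> noncrossing n \<Longrightarrow> \<Phi> (nc_braid s) = \<iota> s"
    by (rule R.representation_extends) blast
  have map_list: "list_product G (map \<iota> w) = \<Phi> (list_product H (map nc_braid w))" if "w \<in> lists (noncrossing n)" for w
    using that
  proof (induction w)
    case (Cons s w)
    then have "list_product H (map nc_braid w) \<in> carrier H" "nc_braid s \<in> carrier H"
      by (auto intro!: H.list_product_in nc_braid_in)
    then show ?case using Cons hom_mult[OF hom] by (simp add: \<Phi>)
  qed (simp add: one)
  obtain us vs where us: "us \<in> lists (noncrossing n)" "u = map nc_braid us"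
    and vs: "vs \<in> lists (noncrossing n)" "v = map nc_braid vs"
    using uv unfolding P_def lists_image by blast
  have "list_product G (map \<iota> us) = list_product G (map \<iota> vs)"
    using eq unfolding map_list[OF us(1)] map_list[OF vs(1)] us(2) vs(2) list_product_M by simp
  then have "word_equiv (noncrossing n) (Id_on {..<n}) germ.prd us vs" by (rule embed[OF us(1) vs(1)])
  then show "word_equiv P \<one>\<^bsub>M\<^esub> (restricted_product M P) u v"
    unfolding us(2) vs(2)
  proof (rule word_equiv_map)
    show "nc_braid (Id_on {..<n}) = \<one>\<^bsub>M\<^esub>" by (simp add: nc_braid_Id M_simps)
    show "nc_braid ` noncrossing n \<subseteq> P" by (simp add: P_def)
    fix a b c assume abc: "a \<in> noncrossing n" "b \<in> noncrossing n" "c \<in> noncrossing n" "germ.prd a b = Some c"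
    then have "b \<subseteq> kreweras n a" "c = nc_join n a b" by (auto simp: germ.prd_def split: if_splits)
    then have "nc_braid a \<otimes>\<^bsub>M\<^esub> nc_braid b = nc_braid c" using nc_braid_mult abc by (simp add: M_simps)
    then show "restricted_product M P (nc_braid a) (nc_braid b) = Some (nc_braid c)"
      using abc(3) by (simp add: restricted_product_def P_def)
  qed
qed

theorem natural_morphism_braids:
  "natural_morphism M \<in> iso (associated_monoid (partition_braids x) \<one>\<^bsub>M\<^esub>
     (restricted_product M (partition_braids x))) M"
  unfolding partition_braids_eq
  by (rule natural_morphism_iso[OF monoid_M _ word_equiv_braids_iff braid_monoid_words])
    (use nc_braid_in_M in auto)

end

text \<open>Twice the signed area of a triangle inscribed in the unit circle is four times the
  product of the sines of its angles, each angle being half the arc it subtends.\<close>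

lemma cross_cis: "cross (cis b - cis a) (cis c - cis a) = 4 * sin ((b - a) / 2) * sin ((c - b) / 2) * sin ((c - a) / 2)"
proof -
  define A B where "A = (b - a) / 2" and "B = (c - b) / 2"
  have "cross (cis b - cis a) (cis c - cis a) = sin (c - b) + sin (b - a) - sin (c - a)"
    by (simp add: sin_diff algebra_simps)
  also have "\<dots> = sin (2 * B) + sin (2 * A) - sin (2 * A + 2 * B)"
    by (simp add: A_def B_def diff_divide_distrib)
  also have "\<dots> = sin (2 * B) * (1 - cos (2 * A)) + sin (2 * A) * (1 - cos (2 * B))"
    by (simp add: sin_add algebra_simps)
  also have "\<dots> = 4 * sin A * sin B * sin (A + B)"
    by (simp only: cos_double_sin sin_double sin_add) (simp add: algebra_simps power2_eq_square)
  also have "A + B = (c - a) / 2" by (simp add: A_def B_def diff_divide_distrib)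
  finally show ?thesis by (simp add: A_def B_def)
qed

theorem corollary3p3:
  fixes n :: nat
  assumes "n \<ge> 1"
  shows "natural_morphism (braid_monoid (roots_of_unity n)) \<in>
    iso (associated_monoid (partition_braids (roots_of_unity n))
           \<one>\<^bsub>braid_monoid (roots_of_unity n)\<^esub>
           (restricted_product (braid_monoid (roots_of_unity n))
              (partition_braids (roots_of_unity n))))
        (braid_monoid (roots_of_unity n))"
proof -
  \<comment> \<open>The minus sign makes the numbering clockwise.\<close>
  define \<omega> where "\<omega> k = cis (- (2 * pi * real k / real n))" for k
  have b: "bij_betw (\<lambda>k. cis (2 * pi * real k / real n)) {..<n} {z. z ^ n = 1}"
    by (rule Complex.bij_betw_roots_unity) (use assms in simp)
  have cnj_omega: "\<omega> k = cnj (cis (2 * pi * real k / real n))" for k by (simp add: \<omega>_def cis_cnj)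
  interpret clockwise_circle n \<omega>
  proof
    show "norm (\<omega> k) = 1" for k by (simp add: \<omega>_def)
    show "inj_on \<omega> {..<n}"
      using bij_betw_imp_inj_on[OF b] by (simp add: inj_on_def cnj_omega)
    fix i j k assume ijk: "i < j" "j < k" "k < n"
    \<comment> \<open>Half the difference of two of the arguments lies strictly between
      \<open>- pi\<close> and \<open>0\<close>. The formula for the area has three such factors, so
      it is negative.\<close>
    have sin_neg: "sin ((- (2 * pi * real l / real n) - - (2 * pi * real m / real n)) / 2) < 0" if "m < l" "l < n" for l m
    proof -
      define t where "t = pi * (real l - real m) / real n"
      have "0 < t" using that by (simp add: t_def)
      moreover have "pi * (real l - real m) < pi * real n" using that by simp
      then have "t < pi" using that by (simp add: t_def divide_less_eq)
      moreover have "(- (2 * pi * real l / real n) - - (2 * pi * real m / real n)) / 2 = - t"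
        by (simp add: t_def field_simps diff_divide_distrib)
      ultimately show ?thesis using sin_gt_zero by simp
    qed
    show "cross (\<omega> j - \<omega> i) (\<omega> k - \<omega> i) < 0"
      unfolding \<omega>_def cross_cis
      by (intro mult_pos_neg mult_neg_neg sin_neg) (use ijk in auto)
  qed
  \<comment> \<open>Conjugation turns the counterclockwise numbering of the roots into the clockwise
    one and preserves the set of roots.\<close>
  have "x = cnj ` {z. z ^ n = 1}"
    unfolding x_def bij_betw_imp_surj_on[OF b, symmetric] by (simp add: image_image cnj_omega)
  also have "\<dots> = roots_of_unity n"
  proof -
    have "cnj z ^ n = 1 \<longleftrightarrow> z ^ n = 1" for z :: complex
      by (metis complex_cnj_cnj complex_cnj_one complex_cnj_power)
    then show ?thesis unfolding roots_of_unity_def by (auto simp: image_iff) (metis complex_cnj_cnj)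
  qed
  finally show ?thesis using natural_morphism_braids by simp
qed

end
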